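(* Let $\{S_i\}$ be a sequence of $p$-invariant closed subsets of $\mathbb{T}$, and suppose that $$\sum_{i=1}^{\infty} \frac{\dim_H(S_i)}{|\log \dim_H(S_i)|} = \infty .$$ Then $\dim_H(S_1+\cdots+S_n)\longrightarrow 1$ as $n\to\infty$.
   Context: $p\ge 2$ is an integer (not necessarily prime), $\mathbb{T}=\mathbb{R}/\mathbb{Z}$, and $\sigma_p(x)=px \pmod 1$ on $\mathbb{T}$. A closed set $S\subset\mathbb{T}$ is $p$-invariant if $\sigma_p(S)\subset S$. $\dim_H$ denotes Hausdorff dimension, and $S_1+\cdots+S_n=\{s_1+\cdots+s_n \pmod 1: s_i\in S_i\}$. *)

theory Defs
  imports "HOL-Analysis.Analysis"
begin

section \<open>The circle \<open>\<real>/\<int>\<close>\<close>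

quotient_type circle = real / "\<lambda>x y :: real. x - y \<in> \<int>"
proof (rule equivpI)
  show "reflp (\<lambda>x y :: real. x - y \<in> \<int>)"
    by (simp add: reflp_def)
  show "symp (\<lambda>x y :: real. x - y \<in> \<int>)"
    by (metis (no_types, lifting) Ints_minus minus_diff_eq sympI)
  show "transp (\<lambda>x y :: real. x - y \<in> \<int>)"
  proof (rule transpI)
    fix x y z :: real
    assume "x - y \<in> \<int>" "y - z \<in> \<int>"
    then have "(x - y) + (y - z) \<in> \<int>" by (rule Ints_add)
    then show "x - z \<in> \<int>" by simp
  qed
qed

lift_definition to_circle :: "real \<Rightarrow> circle" is "\<lambda>x. x" .

instantiation circle :: ab_group_add
begin

lift_definition zero_circle :: circle is 0 .

lift_definition plus_circle :: "circle \<Rightarrow> circle \<Rightarrow> circle" is "(+)"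
  by (metis Ints_add add_diff_add)

lift_definition uminus_circle :: "circle \<Rightarrow> circle" is uminus
  by (metis Ints_minus minus_diff_minus)

lift_definition minus_circle :: "circle \<Rightarrow> circle \<Rightarrow> circle" is "(-)"
  by (metis Ints_diff diff_diff_eq2 diff_add_eq add_diff_add diff_diff_eq add.commute)

instance
  by standard (transfer; simp add: algebra_simps)+

end

text \<open>The distance of two points of the circle is the distance of a difference of
  representatives to the nearest integer, i.e. the quotient metric.\<close>

lemma round_dist_shift:
  fixes s t :: real
  assumes "s - t \<in> \<int>"
  shows "\<bar>s - of_int (round s)\<bar> = \<bar>t - of_int (round t)\<bar>"
proof -
  have le: "\<bar>a - of_int (round a)\<bar> \<le> \<bar>b - of_int (round b)\<bar>"
    if "a - b \<in> \<int>" for a b :: real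
  proof -
    from that obtain k where k: "a - b = of_int k" by (auto elim: Ints_cases)
    have "\<bar>a - of_int (round a)\<bar> \<le> \<bar>a - of_int (round b + k)\<bar>"
      by (rule round_diff_minimal)
    also have "a - of_int (round b + k) = b - of_int (round b)"
      using k by simp
    finally show ?thesis .
  qed
  have "t - s \<in> \<int>" using assms by (metis Ints_minus minus_diff_eq)
  with le[OF assms] le[of t s] show ?thesis by simp
qed

instantiation circle :: metric_space
begin

lift_definition dist_circle :: "circle \<Rightarrow> circle \<Rightarrow> real"
  is "\<lambda>x y. \<bar>(x - y) - of_int (round (x - y))\<bar>"
proof (rule round_dist_shift)
  fix a b c d :: real
  assume "a - b \<in> \<int>" "c - d \<in> \<int>"
  then have "(a - b) - (c - d) \<in> \<int>" by (rule Ints_diff)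
  then show "(a - c) - (b - d) \<in> \<int>" by (simp add: algebra_simps)
qed

definition uniformity_circle :: "(circle \<times> circle) filter"
  where "uniformity_circle = (INF e\<in>{0<..}. principal {(x, y). dist x y < e})"

definition open_circle :: "circle set \<Rightarrow> bool"
  where "open_circle U \<longleftrightarrow> (\<forall>x\<in>U. eventually (\<lambda>(x', y). x' = x \<longrightarrow> y \<in> U) uniformity)"

instance
proof
  show "uniformity = (INF e\<in>{0<..}. principal {(x, y :: circle). dist x y < e})"
    by (rule uniformity_circle_def)
  show "open U \<longleftrightarrow> (\<forall>x\<in>U. eventually (\<lambda>(x', y). x' = x \<longrightarrow> y \<in> U) uniformity)"
    for U :: "circle set"
    by (rule open_circle_def)
  show "dist x y = 0 \<longleftrightarrow> x = y" for x y :: circle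
    by transfer (metis Ints_cases Ints_of_int abs_eq_0 eq_iff_diff_eq_0 round_of_int)
  show "dist x y \<le> dist x z + dist y z" for x y z :: circle
  proof transfer
    fix x y z :: real
    have "\<bar>(x - y) - of_int (round (x - y))\<bar>
        \<le> \<bar>(x - y) - of_int (round (x - z) - round (y - z))\<bar>"
      by (rule round_diff_minimal)
    also have "\<dots> = \<bar>((x - z) - of_int (round (x - z))) - ((y - z) - of_int (round (y - z)))\<bar>"
      by simp
    also have "\<dots> \<le> \<bar>(x - z) - of_int (round (x - z))\<bar> + \<bar>(y - z) - of_int (round (y - z))\<bar>"
      by (rule abs_triangle_ineq4)
    finally show "\<bar>(x - y) - of_int (round (x - y))\<bar>
        \<le> \<bar>(x - z) - of_int (round (x - z))\<bar> + \<bar>(y - z) - of_int (round (y - z))\<bar>" .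
  qed
qed

end

lemma dist_to_circle:
  "dist (to_circle s) (to_circle t) = \<bar>(s - t) - of_int (round (s - t))\<bar>"
  by transfer simp

lemma to_circle_eq_iff: "to_circle s = to_circle t \<longleftrightarrow> s - t \<in> \<int>"
  by transfer simp

lemma to_circle_surj: "\<exists>t. x = to_circle t"
  by transfer (metis Ints_0 diff_self)

lemma open_circle_iff_vimage: "open U \<longleftrightarrow> open (to_circle -` U)"
proof
  assume "open U"
  moreover have "continuous_on UNIV to_circle"
  proof (rule continuous_onI)
    fix s e :: real
    assume "0 < e"
    have "dist (to_circle t) (to_circle s) \<le> dist t s" for t
      using round_diff_minimal[of "t - s" 0] by (simp add: dist_to_circle dist_real_def)
    with \<open>0 < e\<close> show "\<exists>d>0. \<forall>t\<in>UNIV. dist t s < d \<longrightarrow> dist (to_circle t) (to_circle s) \<le> e"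
      by (meson less_eq_real_def order_trans)
  qed
  ultimately show "open (to_circle -` U)"
    by (simp add: open_vimage)
next
  assume op: "open (to_circle -` U)"
  show "open U"
    unfolding open_dist
  proof
    fix x assume "x \<in> U"
    obtain s where s: "x = to_circle s" using to_circle_surj by blast
    with op \<open>x \<in> U\<close> obtain e where e: "e > 0" "\<And>t. dist t s < e \<Longrightarrow> to_circle t \<in> U"
      unfolding open_dist by auto
    have "y \<in> U" if "dist y x < e" for y
    proof -
      obtain t where t: "y = to_circle t" using to_circle_surj by blast
      let ?u = "t - of_int (round (t - s))"
      have "dist ?u s < e"
        using that by (simp add: s t dist_to_circle dist_real_def algebra_simps)
      moreover have "to_circle ?u = y"
        by (simp add: t to_circle_eq_iff)
      ultimately show "y \<in> U" using e(2) by metis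
    qed
    with \<open>e > 0\<close> show "\<exists>e>0. \<forall>y. dist y x < e \<longrightarrow> y \<in> U" by blast
  qed
qed

lift_definition mult_map :: "nat \<Rightarrow> circle \<Rightarrow> circle" is "\<lambda>p x. real p * x"
  by (metis Ints_mult Ints_of_nat right_diff_distrib)

definition mult_invariant :: "nat \<Rightarrow> circle set \<Rightarrow> bool"
  where "mult_invariant p S \<longleftrightarrow> mult_map p ` S \<subseteq> S"

definition sumset :: "(nat \<Rightarrow> circle set) \<Rightarrow> nat \<Rightarrow> circle set"
  where "sumset S n = {\<Sum>i<n. s i | s. \<forall>i<n. s i \<in> S i}"


section \<open>Hausdorff measure and dimension\<close>

text \<open>The gauge \<open>diam(U)\<^sup>s\<close>, with \<open>diam(\<emptyset>)\<^sup>s = 0\<close> for all \<open>s\<close> and \<open>diam(U)\<^sup>0 = 1\<close> for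
  nonempty \<open>U\<close>. The latter is a separate case because \<^term>\<open>(0::real) powr 0\<close> is 0.\<close>

definition hausdorff_gauge :: "real \<Rightarrow> 'a::metric_space set \<Rightarrow> ennreal"
  where "hausdorff_gauge s U =
    (if U = {} then 0 else if s = 0 then 1 else ennreal (diameter U powr s))"

text \<open>Boundedness is required explicitly because \<^const>\<open>diameter\<close> is real-valued and
  meaningless on unbounded sets.\<close>

definition hausdorff_premeasure :: "real \<Rightarrow> real \<Rightarrow> 'a::metric_space set \<Rightarrow> ennreal"
  where "hausdorff_premeasure s \<delta> A =
    Inf {\<Sum>i. hausdorff_gauge s (U i) | U :: nat \<Rightarrow> 'a set.
          A \<subseteq> (\<Union>i. U i) \<and> (\<forall>i. bounded (U i) \<and> diameter (U i) \<le> \<delta>)}"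

definition hausdorff_measure :: "real \<Rightarrow> 'a::metric_space set \<Rightarrow> ennreal"
  where "hausdorff_measure s A = (SUP \<delta>\<in>{0<..}. hausdorff_premeasure s \<delta> A)"

definition hausdorff_dim :: "'a::metric_space set \<Rightarrow> ennreal"
  where "hausdorff_dim A = Inf {ennreal s | s. 0 \<le> s \<and> hausdorff_measure s A = 0}"

text \<open>The quantity \<open>d / |log d|\<close> for \<open>0 \<le> d \<le> 1\<close>, extended by its limits \<open>0\<close> at \<open>d = 0\<close>
  and \<open>\<infinity>\<close> at \<open>d = 1\<close>. Division in \<^typ>\<open>ennreal\<close> and \<^term>\<open>ln (0::real) = 0\<close> give exactly
  these values, as recorded below.\<close>

definition dim_log_ratio :: "ennreal \<Rightarrow> ennreal"
  where "dim_log_ratio d = d / ennreal \<bar>ln (enn2real d)\<bar>"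

lemma dim_log_ratio_0: "dim_log_ratio 0 = 0"
  by (simp add: dim_log_ratio_def)

lemma dim_log_ratio_1: "dim_log_ratio 1 = \<infinity>"
  by (simp add: dim_log_ratio_def ennreal_divide_zero)

lemma dim_log_ratio_between:
  assumes "0 < d" "d < 1"
  shows "dim_log_ratio (ennreal d) = ennreal (d / \<bar>ln d\<bar>)"
  using assms by (simp add: dim_log_ratio_def divide_ennreal)

end

theory Submission
  imports Defs
begin

text \<open>Count \<open>p\<close>-adic cells instead of measuring: for a \<open>p\<close>-invariant set the cell counts are
  submultiplicative and bounded below by the powers \<open>p\<^sup>h\<^sup>k\<close> with \<open>h\<close> the Hausdorff dimension,
  and for a compact \<open>p\<close>-invariant set a lower bound on the counts bounds the dimension from
  below (Furstenberg). So it suffices to find a random point of \<open>S\<^sub>1 + \<dots> + S\<^sub>n\<close> whose digits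
  have almost full entropy.

  Draw from each \<open>S\<^sub>i\<close> one of finitely many points uniformly, one point per cell of a deep
  level, and multiply it by \<open>p\<^sup>t\<close> for an independent uniform shift \<open>t\<close>. Split the points by a
  tree of intervals of length about \<open>p\<^sup>-\<^sup>l\<close> whose cuts avoid the place where the conditional
  mass concentrates. Then the entropy gained at a level bounds the conditional spread \<open>b\<close> at
  scale \<open>p\<^sup>-\<^sup>l\<close> through \<open>b ln (1 / b)\<close>, and because of the shift the mean spread at every level
  is at least a constant times \<open>h / ln (1 / h)\<close>.

  For the sum \<open>Z\<close>, couple two copies of the random walk of summands, started at distance at most
  \<open>p\<^sup>-\<^sup>j\<close>, so that their steps agree in tree node but are otherwise independent: the difference
  is a symmetric walk with total variance at least a multiple of \<open>\<Sum> h\<^sub>i / ln (1 / h\<^sub>i)\<close>, so the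
  copies come within \<open>p\<^sup>-\<^sup>j\<^sup>-\<^sup>c\<close> of each other with high probability. Hence the law of \<open>Z\<close> is
  almost invariant under shifts at scale \<open>p\<^sup>-\<^sup>j\<close>, and the next digit is almost uniform given the
  previous ones. As this works with real distances and not modulo \<open>p\<^sup>k\<close>, the arithmetic of \<open>p\<close>
  plays no role.\<close>

section \<open>Averages over fibers and entropy\<close>

text \<open>The obstacle is that entropy gained in a fixed \<open>p\<close>-adic grid need not come
  with distance: points close together on opposite sides of a cut carry entropy, yet hardly move a
  random walk. In each class of the tree two grids, half a mesh apart, compete, and the one with the
  heaviest cell is used. A small interval around any point fits into a cell of one of them, so the
  mass outside the heaviest cell bounds from below the mass at distance at least a quarter mesh from
  any given point. The same mass \<open>b\<close> bounds the entropy gain from above, but only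
  through \<open>b ln (1 / b)\<close>; inverting this costs the logarithm in the hypothesis.

  The order of choices matters: the scale parameters and the required total spread depend on
  \<open>p\<close> and the target dimension only, then comes the number of summands, and last the
  depth of the finite sets, which may depend on the summands.

  All laws are uniform on finite sets, so entropies are averages of logarithms, and the tangent line
  of \<open>ln\<close> replaces Jensen's inequality.\<close>

definition avg :: "'a set \<Rightarrow> ('a \<Rightarrow> real) \<Rightarrow> real"
  where "avg B g = (\<Sum>a\<in>B. g a) / real (card B)"

definition fiber :: "'a set \<Rightarrow> ('a \<Rightarrow> 'b) \<Rightarrow> 'a \<Rightarrow> 'a set"
  where "fiber B f a = {a'\<in>B. f a' = f a}"

lemma avg_add: "avg B (\<lambda>a. g a + h a) = avg B g + avg B h"
  by (simp add: avg_def sum.distrib add_divide_distrib)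

lemma avg_diff: "avg B (\<lambda>a. g a - h a) = avg B g - avg B h"
  by (simp add: avg_def sum_subtractf diff_divide_distrib)

lemma avg_cmult: "avg B (\<lambda>a. c * g a) = c * avg B g"
  by (simp add: avg_def sum_distrib_left)

lemma avg_const: "finite B \<Longrightarrow> B \<noteq> {} \<Longrightarrow> avg B (\<lambda>a. c) = c"
  by (simp add: avg_def)

lemma avg_mono: "(\<And>a. a \<in> B \<Longrightarrow> g a \<le> h a) \<Longrightarrow> avg B g \<le> avg B h"
  unfolding avg_def by (intro divide_right_mono sum_mono) auto

lemma avg_cong: "(\<And>a. a \<in> B \<Longrightarrow> g a = h a) \<Longrightarrow> avg B g = avg B h"
  unfolding avg_def by (metis (mono_tags, lifting) sum.cong)

lemma avg_nonneg: "(\<And>a. a \<in> B \<Longrightarrow> 0 \<le> g a) \<Longrightarrow> 0 \<le> avg B g"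
  unfolding avg_def by (intro divide_nonneg_nonneg sum_nonneg) auto

lemma avg_sum: "avg B (\<lambda>a. \<Sum>i\<in>I. g i a) = (\<Sum>i\<in>I. avg B (g i))"
  unfolding avg_def by (subst sum.swap) (simp add: sum_divide_distrib)

lemma avg_abs_le: "\<bar>avg B g\<bar> \<le> avg B (\<lambda>a. \<bar>g a\<bar>)"
  unfolding avg_def by (simp add: divide_right_mono)

lemma fiber_self: "a \<in> B \<Longrightarrow> a \<in> fiber B f a"
  by (simp add: fiber_def)

lemma finite_fiber: "finite B \<Longrightarrow> finite (fiber B f a)"
  by (simp add: fiber_def)

lemma fiber_eq: "a' \<in> fiber B f a \<Longrightarrow> fiber B f a' = fiber B f a"
  by (auto simp: fiber_def)

lemma card_fiber_pos: "finite B \<Longrightarrow> a \<in> B \<Longrightarrow> 0 < card (fiber B f a)"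
  by (metis card_gt_0_iff empty_iff fiber_self finite_fiber)

section \<open>Conditionally independent pairs in a common class\<close>

abbreviation pair_avg :: "'a set \<Rightarrow> ('a \<Rightarrow> 'b) \<Rightarrow> ('a \<Rightarrow> 'a \<Rightarrow> real) \<Rightarrow> real"
  where "pair_avg B f G \<equiv> avg B (\<lambda>a. avg (fiber B f a) (G a))"

text \<open>The pair \<open>(a, a')\<close> has weight proportional to
  \<open>1 / card (fiber B f a)\<close> on the relation \<open>f a = f a'\<close>, and both are
  symmetric. Hence \<open>a'\<close> has the same law as \<open>a\<close>, and antisymmetric
  functions average to 0.\<close>

lemma pair_avg_swap:
  assumes "finite B"
  shows "pair_avg B f (\<lambda>a a'. G a' a) = pair_avg B f G"
proof -
  have *: "(\<Sum>a\<in>B. (\<Sum>a'\<in>fiber B f a. H a a') / real (card (fiber B f a)))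
     = (\<Sum>a\<in>B. \<Sum>a'\<in>B. if f a' = f a then H a a' / real (card (fiber B f a)) else 0)" for H
    using assms by (simp add: sum_divide_distrib fiber_def sum.inter_filter if_distrib[of
        "\<lambda>v. v / _"] cong: if_cong)
  have "(\<Sum>a\<in>B. \<Sum>a'\<in>B. if f a' = f a then G a' a / real (card (fiber B f a)) else 0)
      = (\<Sum>a\<in>B. \<Sum>a'\<in>B. if f a' = f a then G a a' / real (card (fiber B f a)) else 0)"
    by (subst sum.swap) (intro sum.cong refl; simp add: fiber_def)
  then show ?thesis
    unfolding avg_def * by simp
qed

lemma pair_avg_fst:
  assumes "finite B"
  shows "pair_avg B f (\<lambda>a a'. g a) = avg B g"
  by (intro avg_cong avg_const) (use assms fiber_self finite_fiber in \<open>fastforce+\<close>)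

lemma pair_avg_snd:
  assumes "finite B"
  shows "pair_avg B f (\<lambda>a a'. g a') = avg B g"
  using pair_avg_swap[OF assms, of f "\<lambda>a a'. g a"] pair_avg_fst[OF assms, of f g] by simp

section \<open>Shannon entropy (in nats) of finite partitions\<close>

definition ent :: "'a set \<Rightarrow> ('a \<Rightarrow> 'b) \<Rightarrow> real"
  where "ent B f = avg B (\<lambda>x. ln (real (card B) / real (card (fiber B f x))))"

lemma ln_le_scaled:
  fixes x c :: real
  assumes "0 < x" "0 < c"
  shows "ln x \<le> ln c + x / c - 1"
  using ln_le_minus_one[of "x / c"] assms by (simp add: ln_div)

lemma sum_inverse_fiber:
  assumes "finite B"
  shows "(\<Sum>x\<in>B. 1 / real (card (fiber B f x))) = real (card (f ` B))"
proof -
  have "(\<Sum>x\<in>B. 1 / real (card (fiber B f x)))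
      = (\<Sum>u\<in>f ` B. \<Sum>x\<in>{x\<in>B. f x = u}. 1 / real (card (fiber B f x)))"
    by (rule sum.image_gen[OF assms])
  also have "\<dots> = (\<Sum>u\<in>f ` B. 1)"
  proof (intro sum.cong refl)
    fix u assume "u \<in> f ` B"
    then have ne: "{x\<in>B. f x = u} \<noteq> {}" by auto
    have "(\<Sum>x\<in>{x\<in>B. f x = u}. 1 / real (card (fiber B f x)))
        = (\<Sum>x\<in>{x\<in>B. f x = u}. 1 / real (card {x\<in>B. f x = u}))"
      by (intro sum.cong refl) (auto simp: fiber_def)
    then show "(\<Sum>x\<in>{x\<in>B. f x = u}. 1 / real (card (fiber B f x))) = 1"
      using ne assms by simp
  qed
  finally show ?thesis by simp
qed

text \<open>If \<open>f\<close> refines \<open>g\<close>, the right-hand side is the conditional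
  entropy of \<open>f\<close> given \<open>g\<close>.\<close>

lemma ent_refine_diff:
  assumes "finite B" "B \<noteq> {}"
  shows "ent B f - ent B g = avg B (\<lambda>x. ln (real (card (fiber B g x)) / real (card (fiber B f x))))"
  unfolding ent_def avg_diff[symmetric]
proof (intro avg_cong)
  fix x assume "x \<in> B"
  then have "0 < card (fiber B f x)" "0 < card (fiber B g x)" "0 < card B"
    using card_fiber_pos[OF assms(1)] assms by (blast, blast, simp add: card_gt_0_iff)
  then show "ln (real (card B) / real (card (fiber B f x))) - ln (real (card B) / real (card (fiber
      B g x)))
     = ln (real (card (fiber B g x)) / real (card (fiber B f x)))"
    by (simp add: ln_div)
qed

lemma sum_by_fibers:
  fixes h :: "'a \<Rightarrow> real"
  assumes "finite B" and "\<And>x. x \<in> B \<Longrightarrow> sum h (fiber B g x) \<le> sum k (fiber B g x)"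
  shows "sum h B \<le> sum k B"
proof -
  have "sum h B = (\<Sum>u\<in>g ` B. sum h {x\<in>B. g x = u})" by (rule sum.image_gen[OF assms(1)])
  also have "\<dots> \<le> (\<Sum>u\<in>g ` B. sum k {x\<in>B. g x = u})"
  proof (rule sum_mono)
    fix u assume "u \<in> g ` B"
    then obtain x where "x \<in> B" "u = g x" by blast
    then show "sum h {x\<in>B. g x = u} \<le> sum k {x\<in>B. g x = u}"
      using assms(2)[of x] by (simp add: fiber_def)
  qed
  also have "\<dots> = sum k B" by (rule sum.image_gen[OF assms(1), symmetric])
  finally show ?thesis .
qed

lemma fiber_of_fiber:
  assumes "\<And>x x'. x \<in> B \<Longrightarrow> x' \<in> B \<Longrightarrow> f x = f x' \<Longrightarrow> g x = g x'" "x' \<in> fiber B g x"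
  shows "fiber (fiber B g x) f x' = fiber B f x'"
proof -
  have "g a = g x" if "a \<in> B" "f a = f x'" for a
    using assms(1)[OF that(1) _ that(2)] assms(2) by (simp add: fiber_def)
  then show ?thesis by (auto simp: fiber_def)
qed

text \<open>Tangent of \<open>ln\<close> at \<open>N\<close> inside each class \<open>C\<close> of
  \<open>g\<close>: by \<open>sum_inverse_fiber\<close> the linear terms add up to
  \<open>card C / N\<close> times the number of subclasses, hence to at most \<open>card C\<close>,
  which the summands \<open>- 1\<close> cancel.\<close>

lemma ent_refine_le:
  assumes fin: "finite B" "B \<noteq> {}"
    and ref: "\<And>x x'. x \<in> B \<Longrightarrow> x' \<in> B \<Longrightarrow> f x = f x' \<Longrightarrow> g x = g x'"
    and N: "\<And>x. x \<in> B \<Longrightarrow> card (f ` fiber B g x) \<le> N" and "0 < N"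
  shows "ent B f \<le> ent B g + ln (real N)"
proof -
  have main: "(\<Sum>x\<in>B. ln (real (card (fiber B g x)) / real (card (fiber B f x))))
      \<le> (\<Sum>x\<in>B. ln (real N))"
  proof (rule sum_by_fibers[OF fin(1), of _ g])
    fix x assume x: "x \<in> B"
    let ?C = "fiber B g x"
    have C: "finite ?C" "0 < card ?C" using finite_fiber[OF fin(1)] card_fiber_pos[OF fin(1) x] .
    have "(\<Sum>x'\<in>?C. ln (real (card (fiber B g x')) / real (card (fiber B f x'))))
        \<le> (\<Sum>x'\<in>?C. (ln (real N) - 1) + real (card ?C) / N * (1 / real (card (fiber ?C f x'))))"
    proof (intro sum_mono)
      fix x' assume x': "x' \<in> ?C"
      then have "x' \<in> B" by (simp add: fiber_def)
      then have "0 < card (fiber B f x')" by (rule card_fiber_pos[OF fin(1)])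
      have e: "fiber ?C f x' = fiber B f x'" by (rule fiber_of_fiber[OF _ x']) (rule ref)
      from \<open>0 < card (fiber B f x')\<close> show "ln (real (card (fiber B g x')) / real (card (fiber B f
          x')))
          \<le> (ln (real N) - 1) + real (card ?C) / N * (1 / real (card (fiber ?C f x')))"
        unfolding fiber_eq[OF x'] e
        using ln_le_scaled[of "real (card ?C) / real (card (fiber B f x'))" N] \<open>0 < N\<close> C
        by (simp add: mult.commute)
    qed
    also have "\<dots> = real (card ?C) * (ln (real N) - 1) + real (card ?C) / N * card (f ` ?C)"
      unfolding sum.distrib sum_distrib_left[symmetric] sum_inverse_fiber[OF C(1)] by simp
    also have "\<dots> \<le> real (card ?C) * (ln (real N) - 1) + real (card ?C) / N * N"
      by (intro add_left_mono mult_left_mono) (use N[OF x] in auto)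
    also have "\<dots> = (\<Sum>x'\<in>?C. ln (real N))" using \<open>0 < N\<close> by (simp add: algebra_simps)
    finally show "(\<Sum>x'\<in>?C. ln (real (card (fiber B g x')) / real (card (fiber B f x')))) \<le> \<dots>" .
  qed
  have "ent B f - ent B g \<le> avg B (\<lambda>x. ln (real N))"
    unfolding ent_refine_diff[OF fin] avg_def by (intro divide_right_mono main) auto
  then show ?thesis using fin by (simp add: avg_const)
qed

lemma ent_le_ln_card:
  assumes "finite B" "B \<noteq> {}" "card (f ` B) \<le> N"
  shows "ent B f \<le> ln (real N)"
proof -
  have "0 < card (f ` B)" using assms by (simp add: card_gt_0_iff)
  then have "ent B f \<le> ent B (\<lambda>_. ()) + ln (real N)"
  proof (intro ent_refine_le[OF assms(1,2)])
    show "card (f ` fiber B (\<lambda>_. ()) x) \<le> N" for x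
      using assms(3) by (simp add: fiber_def)
  qed (use \<open>0 < card (f ` B)\<close> assms(3) in auto)
  moreover have "ent B (\<lambda>_. ()) = 0" using assms by (simp add: ent_def fiber_def avg_def)
  ultimately show ?thesis by simp
qed

lemma ent_ge:
  assumes "finite B" "B \<noteq> {}" "0 < c" "\<And>x. x \<in> B \<Longrightarrow> real (card (fiber B f x)) \<le> c"
  shows "ln (real (card B) / c) \<le> ent B f"
proof -
  have "ln (real (card B) / c) = avg B (\<lambda>x. ln (real (card B) / c))" using assms
      by (simp add: avg_const)
  also have "\<dots> \<le> ent B f" unfolding ent_def
  proof (intro avg_mono)
    fix x assume "x \<in> B"
    then have "0 < card (fiber B f x)" "0 < card B"
      using card_fiber_pos[OF assms(1)] assms by (blast, simp add: card_gt_0_iff)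
    then show "ln (real (card B) / c) \<le> ln (real (card B) / real (card (fiber B f x)))"
      using assms(3) assms(4)[OF \<open>x \<in> B\<close>] by (intro ln_mono divide_left_mono) auto
  qed
  finally show ?thesis .
qed


section \<open>Coupling of random walks\<close>

text \<open>The expectation of \<open>F\<close> at the end of a walk from \<open>x\<close>. The
  steps are drawn from \<open>B (k - 1)\<close> down to \<open>B 0\<close>, so that induction on
  \<open>k\<close> peels off the first step.\<close>

primrec walk_avg :: "(nat \<Rightarrow> 'a set) \<Rightarrow> ('a \<Rightarrow> real) \<Rightarrow> nat \<Rightarrow> (real \<Rightarrow> real) \<Rightarrow> real \<Rightarrow> real" where
  "walk_avg B y 0 F x = F x"
| "walk_avg B y (Suc k) F x = avg (B k) (\<lambda>a. walk_avg B y k F (x + y a))"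

lemma walk_avg_abs_le:
  assumes "\<And>k. finite (B k)" "\<And>k. B k \<noteq> {}" "\<And>x. \<bar>F x\<bar> \<le> M"
  shows "\<bar>walk_avg B y k F x\<bar> \<le> M"
proof (induction k arbitrary: x)
  case (Suc k)
  have "\<bar>walk_avg B y (Suc k) F x\<bar> \<le> avg (B k) (\<lambda>a. \<bar>walk_avg B y k F (x + y a)\<bar>)"
    by (simp add: avg_abs_le)
  also have "\<dots> \<le> avg (B k) (\<lambda>a. M)" by (intro avg_mono Suc)
  finally show ?case using assms by (simp add: avg_const)
qed (use assms in simp)

lemma walk_avg_lipschitz:
  assumes "\<And>k. finite (B k)" "\<And>k. B k \<noteq> {}" "\<And>x x'. \<bar>F x - F x'\<bar> \<le> C * \<bar>x - x'\<bar>"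
  shows "\<bar>walk_avg B y k F x - walk_avg B y k F x'\<bar> \<le> C * \<bar>x - x'\<bar>"
proof (induction k arbitrary: x x')
  case (Suc k)
  have "\<bar>walk_avg B y (Suc k) F x - walk_avg B y (Suc k) F x'\<bar>
      = \<bar>avg (B k) (\<lambda>a. walk_avg B y k F (x + y a) - walk_avg B y k F (x' + y a))\<bar>"
    by (simp add: avg_diff)
  also have "\<dots> \<le> avg (B k) (\<lambda>a. \<bar>walk_avg B y k F (x + y a) - walk_avg B y k F (x' + y a)\<bar>)"
    by (rule avg_abs_le)
  also have "\<dots> \<le> avg (B k) (\<lambda>a. C * \<bar>x - x'\<bar>)"
  proof (intro avg_mono)
    fix a
    show "\<bar>walk_avg B y k F (x + y a) - walk_avg B y k F (x' + y a)\<bar> \<le> C * \<bar>x - x'\<bar>"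
      using Suc[of "x + y a" "x' + y a"] by simp
  qed
  finally show ?case using assms by (simp add: avg_const)
qed (use assms in simp)

text \<open>The right-hand side is a supersolution of the difference recursion: couple the two walks
  so that their steps are independent inside each fiber while the distance lies in \<open>[r, L]\<close>. The
  linear term is a martingale, the cosine term contracts by \<open>c k\<close>, and the Lipschitz bound takes
  over once the walks are within \<open>r\<close> of each other.\<close>

lemma walk_avg_shift:
  fixes B :: "nat \<Rightarrow> 'a set" and f :: "nat \<Rightarrow> 'a \<Rightarrow> 'b" and y :: "'a \<Rightarrow> real"
    and F :: "real \<Rightarrow> real" and c :: "nat \<Rightarrow> real" and r L \<theta> C d x :: real
  assumes fin: "\<And>k. finite (B k)" and ne: "\<And>k. B k \<noteq> {}"
    and bd: "\<And>x. \<bar>F x\<bar> \<le> 1" and lip: "\<And>x x'. \<bar>F x - F x'\<bar> \<le> C * \<bar>x - x'\<bar>" and "0 \<le> C"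
    and step: "\<And>k a a'. a \<in> B k \<Longrightarrow> a' \<in> fiber (B k) (f k) a \<Longrightarrow> \<bar>y a' - y a\<bar> \<le> r"
    and cos: "\<And>k. pair_avg (B k) (f k) (\<lambda>a a'. cos (\<theta> * (y a' - y a))) \<le> c k"
    and c: "\<And>k. 0 \<le> c k" and r: "0 \<le> r" and L: "0 < L" and th: "0 \<le> \<theta>" "\<theta> * (L / 2 + r) \<le> 1"
    and d: "0 \<le> d" "d \<le> L + r"
  shows "\<bar>walk_avg B y n F x - walk_avg B y n F (x + d)\<bar>
    \<le> C * r + 2 * d / L + 4 * (\<Prod>k<n. c k) * cos (\<theta> * (d - L / 2))"
proof -
  \<comment> \<open>The condition on \<open>\<theta>\<close> keeps the angle within 1, below
    \<open>pi / 3\<close>. With the factor 4 the cosine term is thus at least 2 before any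
    contraction, which covers the trivial bound for \<open>\<bar>F\<bar> \<le> 1\<close>.\<close>
  have cos_ge: "1 / 2 \<le> cos (\<theta> * (d - L / 2))" if "0 \<le> d" "d \<le> L + r" for d
  proof -
    have "\<bar>d - L / 2\<bar> \<le> L / 2 + r" using that r by (auto simp: abs_if)
    then have "\<theta> * \<bar>d - L / 2\<bar> \<le> \<theta> * (L / 2 + r)" using th(1) by (intro mult_left_mono)
    then have "\<bar>\<theta> * (d - L / 2)\<bar> \<le> 1" using th by (simp add: abs_mult)
    moreover have "1 \<le> pi / 3" using pi_gt3 by simp
    ultimately have "cos (pi / 3) \<le> cos \<bar>\<theta> * (d - L / 2)\<bar>"
      by (intro cos_monotone_0_pi_le) (use pi_gt3 in linarith)+
    then show ?thesis by (simp add: cos_60)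
  qed
  have near: "\<bar>walk_avg B y n F x - walk_avg B y n F (x + d)\<bar>
      \<le> C * r + 2 * d / L + 4 * (\<Prod>k<n. c k) * cos (\<theta> * (d - L / 2))"
    if d: "0 \<le> d" "d \<le> L + r" and o: "d \<le> r \<or> L \<le> d" for n x d
  proof -
    have p: "0 \<le> 4 * (\<Prod>k<n. c k) * cos (\<theta> * (d - L / 2))"
      using c cos_ge[OF d] by (intro mult_nonneg_nonneg prod_nonneg) auto
    from o show ?thesis
    proof
      assume "d \<le> r"
      have "\<bar>walk_avg B y n F x - walk_avg B y n F (x + d)\<bar> \<le> C * \<bar>x - (x + d)\<bar>"
        by (intro walk_avg_lipschitz fin ne lip)
      also have "\<dots> \<le> C * r" using d \<open>d \<le> r\<close> \<open>0 \<le> C\<close> by (auto intro: mult_left_mono)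
      finally have "\<bar>walk_avg B y n F x - walk_avg B y n F (x + d)\<bar> \<le> C * r" .
      moreover have "0 \<le> 2 * d / L" using d L by simp
      ultimately show ?thesis using p by linarith
    next
      assume "L \<le> d"
      have "\<bar>walk_avg B y n F x - walk_avg B y n F (x + d)\<bar> \<le> 2"
        using walk_avg_abs_le[of B F 1 y n x, OF fin ne bd]
          walk_avg_abs_le[of B F 1 y n "x + d", OF fin ne bd]
        by linarith
      moreover have "2 \<le> 2 * d / L" using \<open>L \<le> d\<close> L by (simp add: field_simps)
      moreover have "0 \<le> C * r" using r \<open>0 \<le> C\<close> by simp
      ultimately show ?thesis using p by linarith
    qed
  qed
  show ?thesis
    using d
  proof (induction n arbitrary: x d)
    case 0
    show ?case
    proof (cases "d \<le> r \<or> L \<le> d")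
      case False
      have "\<bar>F x - F (x + d)\<bar> \<le> 2" using bd[of x] bd[of "x + d"] by linarith
      moreover have "2 \<le> 4 * cos (\<theta> * (d - L / 2))" using cos_ge[OF 0] by simp
      moreover have "0 \<le> C * r + 2 * d / L" using 0 r \<open>0 \<le> C\<close> L by simp
      ultimately show ?thesis by simp
    qed (rule near[OF 0])
  next
    case (Suc n)
    show ?case
    proof (cases "d \<le> r \<or> L \<le> d")
      case False
      define P where "P = (\<Prod>k<n. c k)"
      have "0 \<le> P" unfolding P_def using c by (simp add: prod_nonneg)
      let ?u = "walk_avg B y n F"
      let ?E = "pair_avg (B n) (f n)"
      have "\<bar>walk_avg B y (Suc n) F x - walk_avg B y (Suc n) F (x + d)\<bar>
          = \<bar>?E (\<lambda>a a'. ?u (x + y a)) - ?E (\<lambda>a a'. ?u (x + d + y a'))\<bar>"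
        using pair_avg_fst[OF fin, of n "f n" "\<lambda>a. ?u (x + y a)"]
          pair_avg_snd[OF fin, of n "f n" "\<lambda>a. ?u (x + d + y a)"]
        by simp
      also have "\<dots> = \<bar>?E (\<lambda>a a'. ?u (x + y a) - ?u (x + d + y a'))\<bar>"
        by (simp add: avg_diff)
      also have "\<dots> \<le> ?E (\<lambda>a a'. \<bar>?u (x + y a) - ?u (x + d + y a')\<bar>)"
        by (intro order_trans[OF avg_abs_le] avg_mono order_refl)
      also have "\<dots> \<le> ?E (\<lambda>a a'. C * r + 2 * (d + (y a' - y a)) / L
          + 4 * P * cos (\<theta> * (d + (y a' - y a) - L / 2)))"
      proof (intro avg_mono)
        fix a a' assume "a \<in> B n" "a' \<in> fiber (B n) (f n) a"
        from step[OF this] have "\<bar>y a' - y a\<bar> \<le> r" .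
        \<comment> \<open>As \<open>r < d < L\<close> and a coupled step changes the difference by
          at most \<open>r\<close>, it stays in \<open>[0, L + r]\<close>, the range of the
          induction hypothesis.\<close>
        have e: "x + d + y a' = x + y a + (d + (y a' - y a))" by simp
        show "\<bar>?u (x + y a) - ?u (x + d + y a')\<bar> \<le> C * r + 2 * (d + (y a' - y a)) / L
            + 4 * P * cos (\<theta> * (d + (y a' - y a) - L / 2))"
          unfolding P_def e by (rule Suc.IH) (use \<open>\<bar>y a' - y a\<bar> \<le> r\<close> False in linarith)+
      qed
      also have "\<dots> = ?E (\<lambda>a a'. (C * r + 2 * d / L) + (2 / L * (y a' - y a)
          + (4 * P * cos (\<theta> * (d - L / 2)) * cos (\<theta> * (y a' - y a))
          - 4 * P * sin (\<theta> * (d - L / 2)) * sin (\<theta> * (y a' - y a)))))"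
      proof (intro avg_cong)
        fix a a'
        have e: "\<theta> * (d + (y a' - y a) - L / 2) = \<theta> * (d - L / 2) + \<theta> * (y a' - y a)"
          by (simp add: algebra_simps)
        have trig: "4 * P * cos (s + t) = 4 * P * cos s * cos t - 4 * P * sin s * sin t" for s t
          by (simp add: cos_add right_diff_distrib)
        have "4 * P * cos (\<theta> * (d + (y a' - y a) - L / 2))
            = 4 * P * cos (\<theta> * (d - L / 2)) * cos (\<theta> * (y a' - y a))
            - 4 * P * sin (\<theta> * (d - L / 2)) * sin (\<theta> * (y a' - y a))"
          unfolding e trig by (rule refl)
        moreover have "2 * (d + (y a' - y a)) / L = 2 * d / L + 2 / L * (y a' - y a)"
          by (simp add: add_divide_distrib distrib_left)
        ultimately show "C * r + 2 * (d + (y a' - y a)) / L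
            + 4 * P * cos (\<theta> * (d + (y a' - y a) - L / 2))
          = (C * r + 2 * d / L) + (2 / L * (y a' - y a)
          + (4 * P * cos (\<theta> * (d - L / 2)) * cos (\<theta> * (y a' - y a))
          - 4 * P * sin (\<theta> * (d - L / 2)) * sin (\<theta> * (y a' - y a))))"
          by linarith
      qed
      also have "\<dots> = (C * r + 2 * d / L) + 2 / L * ?E (\<lambda>a a'. y a' - y a)
          + (4 * P * cos (\<theta> * (d - L / 2)) * ?E (\<lambda>a a'. cos (\<theta> * (y a' - y a)))
          - 4 * P * sin (\<theta> * (d - L / 2)) * ?E (\<lambda>a a'. sin (\<theta> * (y a' - y a))))"
        by (simp only: avg_add avg_diff avg_cmult pair_avg_fst[OF fin] avg_const[OF fin ne])
      finally have main: "\<bar>walk_avg B y (Suc n) F x - walk_avg B y (Suc n) F (x + d)\<bar> \<le> \<dots>" .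
      have z1: "?E (\<lambda>a a'. y a' - y a) = 0"
        by (simp add: avg_diff pair_avg_fst[OF fin] pair_avg_snd[OF fin])
      have z2: "?E (\<lambda>a a'. sin (\<theta> * (y a' - y a))) = 0"
      proof -
        have "?E (\<lambda>a a'. sin (\<theta> * (y a - y a'))) = ?E (\<lambda>a a'. sin (\<theta> * (y a' - y a)))"
          by (rule pair_avg_swap[OF fin])
        moreover have "?E (\<lambda>a a'. sin (\<theta> * (y a' - y a)) + sin (\<theta> * (y a - y a'))) = ?E (\<lambda>a a'. 0)"
        proof (intro avg_cong)
          fix a a'
          have "\<theta> * (y a - y a') = - (\<theta> * (y a' - y a))" by (simp add: algebra_simps)
          then show "sin (\<theta> * (y a' - y a)) + sin (\<theta> * (y a - y a')) = 0"
              by (metis sin_minus add.right_inverse)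
        qed
        moreover have "?E (\<lambda>a a'. 0) = 0" by (simp add: avg_def)
        ultimately show ?thesis by (simp only: avg_add)
      qed
      have "4 * P * cos (\<theta> * (d - L / 2)) * ?E (\<lambda>a a'. cos (\<theta> * (y a' - y a)))
          \<le> 4 * P * cos (\<theta> * (d - L / 2)) * c n"
        using \<open>0 \<le> P\<close> cos_ge[OF Suc.prems] by (intro mult_left_mono cos) auto
      also have "\<dots> = 4 * (\<Prod>k<Suc n. c k) * cos (\<theta> * (d - L / 2))"
        by (simp add: P_def mult_ac)
      finally show ?thesis using main unfolding z1 z2 by linarith
    qed (rule near[OF Suc.prems])
  qed
qed


section \<open>Almost uniform digits\<close>

definition nearest_dist :: "real \<Rightarrow> real"
  where "nearest_dist x = \<bar>x - of_int (round x)\<bar>"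

lemma nearest_dist_le: "nearest_dist x \<le> \<bar>x - of_int k\<bar>"
  unfolding nearest_dist_def by (rule round_diff_minimal)

lemma nearest_dist_nonneg: "0 \<le> nearest_dist x"
  by (simp add: nearest_dist_def)

lemma nearest_dist_lipschitz: "\<bar>nearest_dist x - nearest_dist y\<bar> \<le> \<bar>x - y\<bar>"
proof -
  have "nearest_dist a \<le> nearest_dist b + \<bar>a - b\<bar>" for a b
    using nearest_dist_le[of a "round b"] by (simp add: nearest_dist_def)
  from this[of x y] this[of y x] show ?thesis by linarith
qed

lemma nearest_dist_add_int: "nearest_dist (x + of_int k) = nearest_dist x"
  using nearest_dist_le[of "x + of_int k" "round x + k"] nearest_dist_le[of x "round (x
      + of_int k) - k"]
  by (simp add: nearest_dist_def algebra_simps)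

text \<open>For positive \<open>I\<close> a \<open>1\<close>-periodic trapezoid, zero at the
  integers and 1 at distance at least \<open>1 / (2 * I)\<close> from them. Multiplication by it
  makes functions of the floor Lipschitz, at the price of the mass near the integers.\<close>

definition cutoff :: "nat \<Rightarrow> real \<Rightarrow> real"
  where "cutoff I x = min 1 (2 * real I * nearest_dist x)"

lemma cutoff_bounds: "0 \<le> cutoff I x" "cutoff I x \<le> 1"
  by (simp_all add: cutoff_def nearest_dist_nonneg)

lemma cutoff_lipschitz: "\<bar>cutoff I x - cutoff I y\<bar> \<le> 2 * real I * \<bar>x - y\<bar>"
proof -
  have "\<bar>cutoff I x - cutoff I y\<bar> \<le> \<bar>2 * real I * nearest_dist x - 2 * real I * nearest_dist y\<bar>"
    by (auto simp: cutoff_def min_def)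
  also have "\<dots> = 2 * real I * \<bar>nearest_dist x - nearest_dist y\<bar>"
    by (simp add: abs_mult right_diff_distrib[symmetric])
  also have "\<dots> \<le> 2 * real I * \<bar>x - y\<bar>"
    by (intro mult_left_mono nearest_dist_lipschitz) auto
  finally show ?thesis .
qed

lemma cutoff_add_int: "cutoff I (x + of_int k) = cutoff I x"
  by (simp add: cutoff_def nearest_dist_add_int)

text \<open>The translates of \<open>1 - cutoff I\<close> by multiples of \<open>1 / I\<close> are
  nonzero on disjoint sets. A law that is almost invariant under these translations therefore has
  little more than mass \<open>1 / I\<close> near the integers.\<close>

lemma sum_cutoff_translates:
  assumes "0 < I"
  shows "(\<Sum>i<I. 1 - cutoff I (x + real i / real I)) \<le> 1"
proof (cases "\<exists>j<I. cutoff I (x + real j / real I) < 1")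
  case False
  have "1 - cutoff I (x + real i / real I) = 0" if "i < I" for i
  proof -
    have "\<not> cutoff I (x + real i / real I) < 1" using False that by blast
    then show ?thesis using cutoff_bounds(2)[of I "x + real i / real I"] by linarith
  qed
  then show ?thesis by simp
next
  case True
  then obtain j where j: "j < I" "cutoff I (x + real j / real I) < 1" by blast
  have "1 - cutoff I (x + real i / real I) = 0" if "i < I" "i \<noteq> j" for i
  proof (rule ccontr)
    assume "1 - cutoff I (x + real i / real I) \<noteq> 0"
    then have i: "cutoff I (x + real i / real I) < 1"
      using cutoff_bounds(2)[of I "x + real i / real I"] by linarith
    define k l where "k = round (x + real i / real I)" and "l = round (x + real j / real I)"
    have a: "2 * real I * \<bar>x + real i / real I - of_int k\<bar> < 1" "2 * real I * \<bar>x
        + real j / real I - of_int l\<bar> < 1"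
      using i j(2) by (auto simp: cutoff_def nearest_dist_def k_def l_def min_def split: if_splits)
    have e: "2 * real I * \<bar>x + real i / real I - of_int k\<bar> = 2 * \<bar>real I * x
        + real i - real I * of_int k\<bar>"
      "2 * real I * \<bar>x + real j / real I - of_int l\<bar> = 2 * \<bar>real I * x
          + real j - real I * of_int l\<bar>"
      using \<open>0 < I\<close> by (simp_all add: abs_mult_pos' algebra_simps)
    have tri: "\<bar>u\<bar> < 1" if "2 * \<bar>a\<bar> < 1" "2 * \<bar>b\<bar> < 1" "u = a - b" for u a b :: real
      using that by linarith
    have "\<bar>(real i - real j) - real I * (of_int k - of_int l)\<bar> < 1"
      by (rule tri[OF a[unfolded e]]) (simp add: right_diff_distrib)
    then have "\<bar>real_of_int ((int i - int j) - int I * (k - l))\<bar> < 1" by simp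
    then have "int i - int j = int I * (k - l)" by linarith
    then have "int I dvd int i - int j" by simp
    then have "int i mod int I = int j mod int I" by (simp add: mod_eq_dvd_iff)
    with that j(1) show False by simp
  qed
  then have "(\<Sum>i<I. 1 - cutoff I (x + real i / real I)) = (\<Sum>i\<in>{j}. 1 - cutoff I (x
      + real i / real I))"
    using j(1) by (intro sum.mono_neutral_right) auto
  also have "\<dots> \<le> 1" using cutoff_bounds by simp
  finally show ?thesis .
qed

text \<open>The jumps of \<open>e \<lfloor>x\<rfloor>\<close> sit at integers, where the cutoff
  vanishes. If the floors differ, the integer \<open>\<lfloor>y\<rfloor>\<close> separates the
  points, and each cutoff is at most \<open>2 * I\<close> times the distance to it.\<close>

lemma floor_cutoff_lipschitz:
  assumes e: "\<And>q. 0 \<le> e q" "\<And>q. e q \<le> (1::real)"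
  shows "\<bar>e \<lfloor>x\<rfloor> * cutoff I x - e \<lfloor>y\<rfloor> * cutoff I y\<bar> \<le> 2 * real I * \<bar>x - y\<bar>"
proof (induction x y rule: linorder_wlog)
  case (le x y)
  show ?case
  proof (cases "\<lfloor>x\<rfloor> = \<lfloor>y\<rfloor>")
    case True
    then have "\<bar>e \<lfloor>x\<rfloor> * cutoff I x - e \<lfloor>y\<rfloor> * cutoff I y\<bar> = e \<lfloor>y\<rfloor> * \<bar>cutoff I x - cutoff I y\<bar>"
      using e by (simp add: right_diff_distrib[symmetric] abs_mult)
    also have "\<dots> \<le> 1 * \<bar>cutoff I x - cutoff I y\<bar>" using e by (intro mult_right_mono) auto
    also have "\<dots> \<le> 2 * real I * \<bar>x - y\<bar>" using cutoff_lipschitz[of I x y] by simp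
    finally show ?thesis .
  next
    case False
    let ?k = "\<lfloor>y\<rfloor>"
    have k: "x \<le> of_int ?k" "of_int ?k \<le> y"
      using le False floor_mono[OF le] by linarith+
    have c: "cutoff I z \<le> 2 * real I * \<bar>z - of_int ?k\<bar>" for z
      using mult_left_mono[OF nearest_dist_le[of z ?k], of "2 * real I"] by (simp add: cutoff_def)
    have "0 \<le> e \<lfloor>x\<rfloor> * cutoff I x" "e \<lfloor>x\<rfloor> * cutoff I x \<le> cutoff I x"
      "0 \<le> e \<lfloor>y\<rfloor> * cutoff I y" "e \<lfloor>y\<rfloor> * cutoff I y \<le> cutoff I y"
      using e cutoff_bounds by (auto intro: mult_left_le_one_le)
    moreover have "2 * real I * \<bar>x - of_int ?k\<bar> + 2 * real I * \<bar>y - of_int ?k\<bar>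
        = 2 * real I * \<bar>x - y\<bar>"
    proof -
      have "\<bar>x - of_int ?k\<bar> = of_int ?k - x" "\<bar>y - of_int ?k\<bar> = y - of_int ?k" "\<bar>x - y\<bar> = y - x"
        using k le by auto
      then show ?thesis by (simp only: distrib_left[symmetric]) simp
    qed
    moreover have "0 \<le> 2 * real I * \<bar>x - of_int ?k\<bar>" "0 \<le> 2 * real I * \<bar>y - of_int ?k\<bar>" by simp_all
    ultimately show ?thesis using c[of x] c[of y] by linarith
  qed
next
  case (sym x y)
  then show ?case by (simp add: abs_minus_commute)
qed

lemma sum_card_vimage_le:
  fixes p :: nat
  assumes "finite G" "inj_on q {..<p}"
  shows "(\<Sum>d<p. card {\<omega>\<in>G. h \<omega> = q d}) \<le> card G"
proof -
  have "(\<Sum>d<p. card {\<omega>\<in>G. h \<omega> = q d}) = card (\<Union>d<p. {\<omega>\<in>G. h \<omega> = q d})"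
    using assms by (subst card_UN_disjoint) (auto simp: inj_on_def)
  also have "\<dots> \<le> card G" using assms by (intro card_mono) auto
  finally show ?thesis .
qed

text \<open>For \<open>v = p ^ (j + 1) * Z\<close> the floor is the cell of \<open>Z\<close> at
  level \<open>j + 1\<close> and its quotient by \<open>p\<close> the cell at level
  \<open>j\<close>, so the right-hand side is the conditional entropy of the next digit. Almost
  invariance makes the conditional probability of the actual digit at most
  \<open>1 / p + p * \<kappa>\<close> on average, and the tangent of \<open>ln\<close> at
  \<open>1 / p\<close> turns this into entropy.\<close>

lemma ent_digit_ge:
  fixes v :: "'a \<Rightarrow> real" and p I :: nat
  assumes fin: "finite \<Omega>" "\<Omega> \<noteq> {}" and "0 < p" "0 < I"
    and SI: "\<And>F d. (\<And>x. \<bar>F x\<bar> \<le> 1) \<Longrightarrow> (\<And>x x'. \<bar>F x - F x'\<bar> \<le> 2 * real I * \<bar>x - x'\<bar>) \<Longrightarrow>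
      0 \<le> d \<Longrightarrow> d \<le> real p \<Longrightarrow> \<bar>avg \<Omega> (\<lambda>\<omega>. F (v \<omega>)) - avg \<Omega> (\<lambda>\<omega>. F (v \<omega> + d))\<bar> \<le> \<Psi>"
  shows "ln (real p) - (real p)\<^sup>2 * (3 * \<Psi> + 2 / real I)
    \<le> ent \<Omega> (\<lambda>\<omega>. \<lfloor>v \<omega>\<rfloor>) - ent \<Omega> (\<lambda>\<omega>. \<lfloor>v \<omega>\<rfloor> div int p)"
proof -
  \<comment> \<open>One \<open>\<Psi>\<close> pays for shifting a smoothed function, and
    \<open>\<Psi> + 1 / I\<close> on each side for inserting the cutoff.\<close>
  define \<kappa> where "\<kappa> = 3 * \<Psi> + 2 / real I"
  have boundary: "avg \<Omega> (\<lambda>\<omega>. 1 - cutoff I (v \<omega>)) \<le> \<Psi> + 1 / real I"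
  proof -
    have "avg \<Omega> (\<lambda>\<omega>. 1 - cutoff I (v \<omega>)) \<le> \<Psi> + avg \<Omega> (\<lambda>\<omega>. 1 - cutoff I (v \<omega> + real i / real I))"
      if "i < I" for i
    proof -
      have "real i / real I \<le> 1" using that by (simp add: field_simps)
      then have "real i / real I \<le> real p" using \<open>0 < p\<close> by linarith
      moreover have "\<bar>1 - cutoff I x\<bar> \<le> 1" "\<bar>(1 - cutoff I x) - (1 - cutoff I y)\<bar>
          \<le> 2 * real I * \<bar>x - y\<bar>" for x y
        using cutoff_bounds[of I x] cutoff_lipschitz[of I x y] by linarith+
      ultimately show ?thesis using SI[of "\<lambda>x. 1 - cutoff I x" "real i / real I"] by simp
    qed
    then have "(\<Sum>i<I. avg \<Omega> (\<lambda>\<omega>. 1 - cutoff I (v \<omega>)))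
        \<le> (\<Sum>i<I. \<Psi> + avg \<Omega> (\<lambda>\<omega>. 1 - cutoff I (v \<omega> + real i / real I)))"
      by (intro sum_mono) simp
    also have "\<dots> = real I * \<Psi> + avg \<Omega> (\<lambda>\<omega>. \<Sum>i<I. 1 - cutoff I (v \<omega> + real i / real I))"
      by (simp add: sum.distrib avg_sum)
    also have "\<dots> \<le> real I * \<Psi> + avg \<Omega> (\<lambda>\<omega>. 1)"
      by (intro add_left_mono avg_mono sum_cutoff_translates \<open>0 < I\<close>)
    finally have "real I * avg \<Omega> (\<lambda>\<omega>. 1 - cutoff I (v \<omega>)) \<le> real I * \<Psi> + 1"
      using fin by (simp add: avg_const)
    then show ?thesis using \<open>0 < I\<close> by (simp add: field_simps)
  qed
  have shift: "\<bar>avg \<Omega> (\<lambda>\<omega>. e \<lfloor>v \<omega>\<rfloor>) - avg \<Omega> (\<lambda>\<omega>. e (\<lfloor>v \<omega>\<rfloor> + int i))\<bar> \<le> \<kappa>"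
    if e: "\<And>q. 0 \<le> e q" "\<And>q. e q \<le> (1::real)" and "i \<le> p" for e i
  proof -
    let ?G = "\<lambda>x. e \<lfloor>x\<rfloor> * cutoff I x"
    have near: "0 \<le> e q - e q * cutoff I x \<and> e q - e q * cutoff I x \<le> 1 - cutoff I x" for q x
    proof -
      have "e q - e q * cutoff I x = e q * (1 - cutoff I x)" by (simp add: algebra_simps)
      then show ?thesis
        using e[of q] cutoff_bounds[of I x] by (simp add: mult_left_le_one_le)
    qed
    have gap: "0 \<le> avg \<Omega> (\<lambda>\<omega>. e (q \<omega>) - e (q \<omega>) * cutoff I (v \<omega>))"
      "avg \<Omega> (\<lambda>\<omega>. e (q \<omega>) - e (q \<omega>) * cutoff I (v \<omega>)) \<le> \<Psi> + 1 / real I" for q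
    proof -
      show "0 \<le> avg \<Omega> (\<lambda>\<omega>. e (q \<omega>) - e (q \<omega>) * cutoff I (v \<omega>))"
        using near by (intro avg_nonneg) blast
      have "avg \<Omega> (\<lambda>\<omega>. e (q \<omega>) - e (q \<omega>) * cutoff I (v \<omega>)) \<le> avg \<Omega> (\<lambda>\<omega>. 1 - cutoff I (v \<omega>))"
        using near by (intro avg_mono) blast
      then show "avg \<Omega> (\<lambda>\<omega>. e (q \<omega>) - e (q \<omega>) * cutoff I (v \<omega>)) \<le> \<Psi> + 1 / real I"
        using boundary by (rule order_trans)
    qed
    have eq: "?G (v \<omega> + real i) = e (\<lfloor>v \<omega>\<rfloor> + int i) * cutoff I (v \<omega>)" for \<omega>
      using cutoff_add_int[of I "v \<omega>" "int i"] floor_add_int[of "v \<omega>" "int i"] by simp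
    have "\<bar>?G x\<bar> \<le> 1" for x
      using e[of "\<lfloor>x\<rfloor>"] cutoff_bounds[of I x] by (simp add: abs_mult mult_le_one)
    then have "\<bar>avg \<Omega> (\<lambda>\<omega>. ?G (v \<omega>)) - avg \<Omega> (\<lambda>\<omega>. ?G (v \<omega> + real i))\<bar> \<le> \<Psi>"
      using \<open>i \<le> p\<close> by (intro SI floor_cutoff_lipschitz e) auto
    then show ?thesis
      using gap[of "\<lambda>\<omega>. \<lfloor>v \<omega>\<rfloor>"] gap[of "\<lambda>\<omega>. \<lfloor>v \<omega>\<rfloor> + int i"]
      unfolding \<kappa>_def avg_diff eq by linarith
  qed
  \<comment> \<open>\<open>SI\<close> allows only nonnegative shifts; a negative one is a positive
    shift of the translated function.\<close>
  have shift': "avg \<Omega> (\<lambda>\<omega>. e \<lfloor>v \<omega>\<rfloor>) \<le> avg \<Omega> (\<lambda>\<omega>. e (\<lfloor>v \<omega>\<rfloor> + (int d - int d'))) + \<kappa>"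
    if e: "\<And>q. 0 \<le> e q" "\<And>q. e q \<le> (1::real)" and "d < p" "d' < p" for e d d'
  proof (cases "d' \<le> d")
    case True
    then have "\<bar>avg \<Omega> (\<lambda>\<omega>. e \<lfloor>v \<omega>\<rfloor>) - avg \<Omega> (\<lambda>\<omega>. e (\<lfloor>v \<omega>\<rfloor> + (int d - int d')))\<bar> \<le> \<kappa>"
      using shift[of e "d - d'", OF e] \<open>d < p\<close> by (simp add: of_nat_diff)
    then show ?thesis by linarith
  next
    case False
    then have "\<bar>avg \<Omega> (\<lambda>\<omega>. e (\<lfloor>v \<omega>\<rfloor> + (int d - int d'))) - avg \<Omega> (\<lambda>\<omega>. e \<lfloor>v \<omega>\<rfloor>)\<bar> \<le> \<kappa>"
      using shift[of "\<lambda>q. e (q + (int d - int d'))" "d' - d", OF e] \<open>d' < p\<close>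
      by (simp add: of_nat_diff)
    then show ?thesis by linarith
  qed
  define f g where "f = (\<lambda>\<omega>. \<lfloor>v \<omega>\<rfloor>)" and "g = (\<lambda>\<omega>. \<lfloor>v \<omega>\<rfloor> div int p)"
  \<comment> \<open>The conditional probability of the cell \<open>q\<close> given its parent; it is
    0 if the parent is empty.\<close>
  define \<rho> where "\<rho> q = real (card {\<omega>\<in>\<Omega>. f \<omega> = q}) / real (card {\<omega>\<in>\<Omega>. g \<omega> = q div int p})" for q
  have rho: "0 \<le> \<rho> q" "\<rho> q \<le> 1" for q
  proof -
    have "card {\<omega>\<in>\<Omega>. f \<omega> = q} \<le> card {\<omega>\<in>\<Omega>. g \<omega> = q div int p}"
      using fin by (intro card_mono) (auto simp: f_def g_def)
    then show "0 \<le> \<rho> q" "\<rho> q \<le> 1" by (auto simp: \<rho>_def divide_le_eq_1)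
  qed
  have rho_sum: "(\<Sum>d<p. \<rho> (int p * k + int d)) \<le> 1" for k
  proof -
    let ?G = "{\<omega>\<in>\<Omega>. g \<omega> = k}"
    have "\<rho> (int p * k + int d) = real (card {\<omega>\<in>?G. f \<omega> = int p * k + int d}) / real (card ?G)"
        if "d < p" for d
    proof -
      have "(int p * k + int d) div int p = k" using that by simp
      moreover have "{\<omega>\<in>\<Omega>. f \<omega> = int p * k + int d} = {\<omega>\<in>?G. f \<omega> = int p * k + int d}"
        using that by (auto simp: f_def g_def)
      ultimately show ?thesis by (simp add: \<rho>_def)
    qed
    then have "(\<Sum>d<p. \<rho> (int p * k + int d)) = real (\<Sum>d<p. card {\<omega>\<in>?G. f \<omega> = int p * k
        + int d}) / real (card ?G)"
      by (simp add: sum_divide_distrib)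
    also have "\<dots> \<le> real (card ?G) / real (card ?G)"
      by (intro divide_right_mono of_nat_mono sum_card_vimage_le) (use fin in \<open>auto simp:
          inj_on_def\<close>)
    also have "\<dots> \<le> 1" by simp
    finally show ?thesis .
  qed
  \<comment> \<open>For each \<open>\<omega>\<close> exactly one of the \<open>p\<close> shifts
    \<open>d - d'\<close> produces the digit \<open>d\<close>, and it lands on the sibling of
    \<open>f \<omega>\<close> with that digit. So the sum over \<open>d'\<close> no longer depends
    on the digit of \<open>f \<omega>\<close>.\<close>
  have digit: "real p * avg \<Omega> (\<lambda>\<omega>. if f \<omega> mod int p = int d then \<rho> (f \<omega>) else 0)
      \<le> avg \<Omega> (\<lambda>\<omega>. \<rho> (int p * g \<omega> + int d)) + real p * \<kappa>" if "d < p" for d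
  proof -
    let ?e = "\<lambda>q. if q mod int p = int d then \<rho> q else 0"
    have "(\<Sum>d'<p. avg \<Omega> (\<lambda>\<omega>. ?e (f \<omega>))) \<le> (\<Sum>d'<p. avg \<Omega> (\<lambda>\<omega>. ?e (f \<omega> + (int d - int d'))) + \<kappa>)"
      unfolding f_def by (intro sum_mono shift') (use rho that in auto)
    also have "\<dots> = avg \<Omega> (\<lambda>\<omega>. \<Sum>d'<p. ?e (f \<omega> + (int d - int d'))) + real p * \<kappa>"
      by (simp add: sum.distrib avg_sum)
    also have "avg \<Omega> (\<lambda>\<omega>. \<Sum>d'<p. ?e (f \<omega> + (int d - int d'))) = avg \<Omega> (\<lambda>\<omega>. \<rho> (int p * g \<omega> + int d))"
    proof (intro avg_cong)
      fix \<omega>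
      define r where "r = nat (f \<omega> mod int p)"
      have r: "r < p" "int r = f \<omega> mod int p" using \<open>0 < p\<close> by (auto simp: r_def nat_less_iff)
      have e: "?e (f \<omega> + (int d - int d')) = (if d' = r then \<rho> (int p * g \<omega> + int d) else 0)"
          if "d' < p" for d'
      proof -
        have fr: "f \<omega> = int p * g \<omega> + int r" by (simp add: r(2) f_def g_def)
        have "(f \<omega> + (int d - int d')) mod int p = int d \<longleftrightarrow> (f \<omega> + (int d - int d')) mod int p
            = int d mod int p"
          using \<open>d < p\<close> by simp
        also have "\<dots> \<longleftrightarrow> int p dvd f \<omega> - int d'" by (simp add: mod_eq_dvd_iff algebra_simps)
        also have "\<dots> \<longleftrightarrow> int r = int d' mod int p" by (simp add: r(2) mod_eq_dvd_iff)
        also have "\<dots> \<longleftrightarrow> d' = r" using that by auto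
        finally show ?thesis by (auto simp: fr)
      qed
      have "(\<Sum>d'<p. ?e (f \<omega> + (int d - int d'))) = (\<Sum>d'<p.
          if d' = r then \<rho> (int p * g \<omega> + int d) else 0)"
        by (intro sum.cong refl e) simp
      then show "(\<Sum>d'<p. ?e (f \<omega> + (int d - int d'))) = \<rho> (int p * g \<omega> + int d)"
        using r(1) by simp
    qed
    finally show ?thesis by simp
  qed
  have "real p * avg \<Omega> (\<lambda>\<omega>. \<rho> (f \<omega>))
      = (\<Sum>d<p. real p * avg \<Omega> (\<lambda>\<omega>. if f \<omega> mod int p = int d then \<rho> (f \<omega>) else 0))"
  proof -
    have "\<rho> (f \<omega>) = (\<Sum>d<p. if f \<omega> mod int p = int d then \<rho> (f \<omega>) else 0)" for \<omega>
    proof -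
      have "(\<Sum>d<p. if f \<omega> mod int p = int d then \<rho> (f \<omega>) else 0)
          = (\<Sum>d<p. if d = nat (f \<omega> mod int p) then \<rho> (f \<omega>) else 0)"
        using \<open>0 < p\<close> by (intro sum.cong refl if_cong) auto
      also have "\<dots> = \<rho> (f \<omega>)" using \<open>0 < p\<close> by (simp add: nat_less_iff)
      finally show ?thesis by simp
    qed
    then have "avg \<Omega> (\<lambda>\<omega>. \<rho> (f \<omega>)) = avg \<Omega> (\<lambda>\<omega>. \<Sum>d<p. if f \<omega> mod int p = int d then \<rho> (f \<omega>) else 0)"
      by (intro avg_cong)
    then show ?thesis by (simp add: avg_sum sum_distrib_left)
  qed
  also have "\<dots> \<le> (\<Sum>d<p. avg \<Omega> (\<lambda>\<omega>. \<rho> (int p * g \<omega> + int d)) + real p * \<kappa>)"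
    by (intro sum_mono digit) simp
  also have "\<dots> = avg \<Omega> (\<lambda>\<omega>. \<Sum>d<p. \<rho> (int p * g \<omega> + int d)) + (real p)\<^sup>2 * \<kappa>"
    by (simp add: sum.distrib avg_sum power2_eq_square)
  also have "\<dots> \<le> avg \<Omega> (\<lambda>\<omega>. 1) + (real p)\<^sup>2 * \<kappa>"
    by (intro add_right_mono avg_mono rho_sum)
  finally have rho_avg: "real p * avg \<Omega> (\<lambda>\<omega>. \<rho> (f \<omega>)) \<le> 1 + (real p)\<^sup>2 * \<kappa>"
    using fin by (simp add: avg_const)
  have "ln (real p) + 1 - real p * avg \<Omega> (\<lambda>\<omega>. \<rho> (f \<omega>)) = avg \<Omega> (\<lambda>\<omega>. (ln (real p)
      + 1) - real p * \<rho> (f \<omega>))"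
    using fin by (simp add: avg_diff avg_cmult avg_const)
  also have "\<dots> \<le> avg \<Omega> (\<lambda>x. ln (real (card (fiber \<Omega> g x)) / real (card (fiber \<Omega> f x))))"
  proof (intro avg_mono)
    fix x assume x: "x \<in> \<Omega>"
    have pos: "0 < card (fiber \<Omega> f x)" "0 < card (fiber \<Omega> g x)"
      by (rule card_fiber_pos[OF fin(1) x])+
    have "\<rho> (f x) = real (card (fiber \<Omega> f x)) / real (card (fiber \<Omega> g x))"
      by (simp add: \<rho>_def fiber_def f_def g_def)
    moreover have "ln (real (card (fiber \<Omega> f x)) / real (card (fiber \<Omega> g x)))
        \<le> ln (1 / real p) + (real (card (fiber \<Omega> f x)) / real (card (fiber \<Omega> g x))) / (1 / real p) -
            1"
      by (rule ln_le_scaled) (use pos \<open>0 < p\<close> in auto)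
    ultimately show "(ln (real p) + 1) - real p * \<rho> (f x)
        \<le> ln (real (card (fiber \<Omega> g x)) / real (card (fiber \<Omega> f x)))"
      using pos \<open>0 < p\<close> by (simp add: ln_div mult.commute)
  qed
  also have "\<dots> = ent \<Omega> f - ent \<Omega> g" by (rule ent_refine_diff[OF fin, symmetric])
  finally show ?thesis using rho_avg unfolding f_def g_def \<kappa>_def by linarith
qed


section \<open>Adaptive interval trees\<close>

text \<open>The largest cell of mesh \<open>1 / P\<close> over both competing grids. The index set
  is infinite, but the sizes are at most \<open>card C\<close>, so the maximum is over a finite
  set.\<close>

definition max_child :: "real \<Rightarrow> real set \<Rightarrow> nat"
  where "max_child P C = Max ((\<lambda>(t, k). card {x\<in>C. \<lfloor>P * x + t\<rfloor> = k}) ` ({0, 1 / 2} \<times> UNIV))"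

definition best_offset :: "real \<Rightarrow> real set \<Rightarrow> real"
  where "best_offset P C = (SOME t. t \<in> {0, 1 / 2} \<and> (\<exists>k. card {x\<in>C. \<lfloor>P * x + t\<rfloor> = k}
      = max_child P C))"

context
  fixes C :: "real set" and P :: real
  assumes fin: "finite C"
begin

lemma finite_child_sizes:
  "finite ((\<lambda>(t, k). card {x\<in>C. \<lfloor>P * x + t\<rfloor> = k}) ` ({0, 1 / 2} \<times> UNIV))"
  using fin by (intro finite_subset[OF _ finite_atMost[of "card C"]]) (auto intro: card_mono)

lemma child_le_max: "t \<in> {0, 1 / 2} \<Longrightarrow> card {x\<in>C. \<lfloor>P * x + t\<rfloor> = k} \<le> max_child P C"
  unfolding max_child_def by (rule Max_ge[OF finite_child_sizes]) force

lemma best_offset: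
  "best_offset P C \<in> {0, 1 / 2}"
  "\<exists>k. card {x\<in>C. \<lfloor>P * x + best_offset P C\<rfloor> = k} = max_child P C"
proof -
  have "max_child P C \<in> (\<lambda>(t, k). card {x\<in>C. \<lfloor>P * x + t\<rfloor> = k}) ` ({0, 1 / 2} \<times> UNIV)"
    unfolding max_child_def by (rule Max_in[OF finite_child_sizes]) auto
  then have "\<exists>t. t \<in> {0, 1 / 2} \<and> (\<exists>k. card {x\<in>C. \<lfloor>P * x + t\<rfloor> = k} = max_child P C)" by force
  from someI_ex[OF this] show "best_offset P C \<in> {0, 1 / 2}"
    "\<exists>k. card {x\<in>C. \<lfloor>P * x + best_offset P C\<rfloor> = k} = max_child P C"
    unfolding best_offset_def by blast+
qed

lemma max_child_pos: "C \<noteq> {} \<Longrightarrow> 0 < max_child P C"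
proof -
  assume "C \<noteq> {}"
  then obtain x where "x \<in> C" by blast
  then have "0 < card {x'\<in>C. \<lfloor>P * x' + 0\<rfloor> = \<lfloor>P * x + 0\<rfloor>}" using fin by (auto simp: card_gt_0_iff)
  then show ?thesis using child_le_max[of 0 "\<lfloor>P * x + 0\<rfloor>"] by force
qed

lemma max_child_le: "max_child P C \<le> card C"
  using best_offset(2) fin by (metis (no_types, lifting) card_mono mem_Collect_eq subsetI)

text \<open>One of the two offsets puts no cut within distance \<open>1 / (4 * P)\<close> of a given point.\<close>

lemma card_near_le_max_child:
  assumes "0 < P"
  shows "card {y\<in>C. \<bar>y - x\<bar> < 1 / (4 * P)} \<le> max_child P C"
proof -
  \<comment> \<open>The interval \<open>[w, w + 1 / 2)\<close> around \<open>P * x\<close> is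
    crossed by a cut of at most one of the grids: the unshifted grid serves if the fractional part
    of \<open>w\<close> is below \<open>1 / 2\<close>, the shifted one otherwise.\<close>
  define w where "w = P * x - 1 / 4"
  obtain t k where t: "t \<in> {0, 1 / 2}" and k: "\<And>z. w \<le> z \<Longrightarrow> z < w + 1 / 2 \<Longrightarrow> \<lfloor>z + t\<rfloor> = k"
  proof (cases "w < of_int \<lfloor>w\<rfloor> + 1 / 2")
    case True
    show ?thesis
    proof (rule that[of 0 "\<lfloor>w\<rfloor>"])
      show "\<lfloor>z + 0\<rfloor> = \<lfloor>w\<rfloor>" if "w \<le> z" "z < w + 1 / 2" for z
        using that True by (intro floor_unique) linarith+
    qed simp
  next
    case False
    show ?thesis
    proof (rule that[of "1 / 2" "\<lfloor>w\<rfloor> + 1"])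
      show "\<lfloor>z + 1 / 2\<rfloor> = \<lfloor>w\<rfloor> + 1" if "w \<le> z" "z < w + 1 / 2" for z
        using that False by (intro floor_unique; simp; linarith)
    qed simp
  qed
  have "{y\<in>C. \<bar>y - x\<bar> < 1 / (4 * P)} \<subseteq> {y\<in>C. \<lfloor>P * y + t\<rfloor> = k}"
  proof safe
    fix y assume "\<bar>y - x\<bar> < 1 / (4 * P)"
    then have "P * \<bar>y - x\<bar> < P * (1 / (4 * P))" using \<open>0 < P\<close> by (rule mult_strict_left_mono)
    moreover have "P * \<bar>y - x\<bar> = \<bar>P * y - P * x\<bar>"
      using \<open>0 < P\<close> by (simp add: abs_mult_pos' right_diff_distrib)
    moreover have "P * (1 / (4 * P)) = 1 / 4" using \<open>0 < P\<close> by simp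
    ultimately have "\<bar>P * y - P * x\<bar> < 1 / 4" by simp
    then show "\<lfloor>P * y + t\<rfloor> = k" by (intro k; unfold w_def; linarith)
  qed
  then have "card {y\<in>C. \<bar>y - x\<bar> < 1 / (4 * P)} \<le> card {y\<in>C. \<lfloor>P * y + t\<rfloor> = k}"
    using fin by (intro card_mono) auto
  also have "\<dots> \<le> max_child P C" by (rule child_le_max[OF t])
  finally show ?thesis .
qed

end

text \<open>With \<open>n = card C\<close>, the heavy class contributes
  \<open>M ln (n / M) \<le> n - M\<close>. For the others the tangent at \<open>Q / b\<close> gives
  at most \<open>(n - M) * (ln (Q / b) - 1) + b * n\<close>, and the two terms \<open>n - M\<close>
  cancel. This is the bound \<open>b ln (1 / b)\<close> made linear in the spread; a free
  \<open>b\<close> allows averaging over classes and summing over levels.\<close>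

lemma class_entropy_le:
  assumes fin: "finite C" and M: "M = card {x\<in>C. f x = k0}" "0 < M"
    and Q: "card (f ` C) \<le> Suc Q" "0 < Q" and b: "0 < (b :: real)"
  shows "(\<Sum>x\<in>C. ln (real (card C) / real (card (fiber C f x))))
    \<le> (real (card C) - real M) * ln (real Q / b) + b * real (card C)"
proof -
  define C0 C1 where "C0 = {x\<in>C. f x = k0}" and "C1 = {x\<in>C. f x \<noteq> k0}"
  have split: "C = C0 \<union> C1" "C0 \<inter> C1 = {}" "finite C0" "finite C1" using fin
      by (auto simp: C0_def C1_def)
  have M0: "card C0 = M" by (simp add: M C0_def)
  have n: "card C = M + card C1" using split card_Un_disjoint M0 by metis
  have s0: "(\<Sum>x\<in>C0. ln (real (card C) / real (card (fiber C f x)))) \<le> real (card C) - real M"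
  proof -
    have "(\<Sum>x\<in>C0. ln (real (card C) / real (card (fiber C f x))))
        = (\<Sum>x\<in>C0. ln (real (card C) / real M))"
      by (intro sum.cong refl) (simp add: C0_def fiber_def M)
    also have "\<dots> = real M * ln (real (card C) / real M)" using M0 by simp
    also have "\<dots> \<le> real M * (real (card C) / real M - 1)"
      using M(2) n by (intro mult_left_mono ln_le_minus_one) auto
    also have "\<dots> = real (card C) - real M" using M(2) by (simp add: right_diff_distrib)
    finally show ?thesis .
  qed
  have img: "card (f ` C1) \<le> Q"
  proof -
    have "C0 \<noteq> {}" using M0 M(2) by auto
    then have "f ` C = insert k0 (f ` C1)" by (auto simp: C0_def C1_def)
    moreover have "k0 \<notin> f ` C1" by (auto simp: C1_def)
    ultimately show ?thesis using Q(1) split(4) by simp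
  qed
  have "(\<Sum>x\<in>C1. ln (real (card C) / real (card (fiber C f x))))
      \<le> (\<Sum>x\<in>C1. (ln (real Q / b) - 1) + real (card C) * (b / real Q) * (1 / real (card (fiber C1 f
          x))))"
  proof (rule sum_mono)
    fix x assume x: "x \<in> C1"
    have "fiber C f x = fiber C1 f x" using x by (auto simp: fiber_def C1_def)
    moreover have "0 < card (fiber C1 f x)" by (rule card_fiber_pos[OF split(4) x])
    moreover have "0 < card C" using M(2) n by simp
    ultimately show "ln (real (card C) / real (card (fiber C f x)))
        \<le> (ln (real Q / b) - 1) + real (card C) * (b / real Q) * (1 / real (card (fiber C1 f x)))"
      using ln_le_scaled[of "real (card C) / real (card (fiber C1 f x))" "real Q / b"] Q(2) b
      by (simp add: mult_ac)
  qed
  also have "\<dots> = real (card C1) * (ln (real Q / b) - 1)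
      + real (card C) * (b / real Q) * real (card (f ` C1))"
    unfolding sum.distrib sum_distrib_left[symmetric] sum_inverse_fiber[OF split(4)] by simp
  also have "\<dots> \<le> real (card C1) * (ln (real Q / b) - 1) + real (card C) * (b / real Q) * real Q"
    using img b by (intro add_left_mono mult_left_mono) auto
  also have "\<dots> = real (card C1) * ln (real Q / b) - real (card C1) + b * real (card C)"
    using Q(2) by (simp add: algebra_simps)
  finally have s1: "(\<Sum>x\<in>C1. ln (real (card C) / real (card (fiber C f x)))) \<le> \<dots>" .
  have "(\<Sum>x\<in>C. ln (real (card C) / real (card (fiber C f x))))
      = (\<Sum>x\<in>C0. ln (real (card C) / real (card (fiber C f x))))
          + (\<Sum>x\<in>C1. ln (real (card C) / real (card (fiber C f x))))"
    by (subst split(1), rule sum.union_disjoint) (use split in auto)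
  moreover have e: "real (card C) - real M = real (card C1)" using n by simp
  ultimately show ?thesis using s0 s1 unfolding e by linarith
qed

text \<open>The key keeps the whole history, newest cell first, so finer keys refine coarser ones.
  It has to, since the offset at the next level depends on the class reached so far.\<close>

primrec tree_key :: "nat \<Rightarrow> real set \<Rightarrow> nat \<Rightarrow> real \<Rightarrow> int list" where
  "tree_key p A 0 x = []"
| "tree_key p A (Suc l) x =
    \<lfloor>real p ^ Suc l * x + best_offset (real p ^ Suc l) (fiber A (tree_key p A l) x)\<rfloor> # tree_key p A
        l x"

text \<open>By the choice of \<open>best_offset\<close> this is the fraction of the class of
  \<open>x\<close> that lies outside the heaviest cell of the next level.\<close>

definition tree_spread :: "nat \<Rightarrow> real set \<Rightarrow> nat \<Rightarrow> real \<Rightarrow> real"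
  where "tree_spread p A l x = 1 - real (max_child (real p ^ Suc l) (fiber A (tree_key p A l) x))
      / real (card (fiber A (tree_key p A l) x))"

context
  fixes p :: nat and A :: "real set"
  assumes p: "2 \<le> p" and fin: "finite A" "A \<noteq> {}" and sub: "A \<subseteq> {0..<1}"
begin

lemma tree_key_diam:
  assumes "x \<in> A" "y \<in> A" "tree_key p A l x = tree_key p A l y"
  shows "\<bar>x - y\<bar> < 1 / real p ^ l"
proof (cases l)
  case 0
  then have "x \<in> {0..<1}" "y \<in> {0..<1}" using assms sub by blast+
  then show ?thesis using 0 by auto
next
  case (Suc m)
  define t where "t = best_offset (real p ^ l) (fiber A (tree_key p A m) x)"
  have "fiber A (tree_key p A m) x = fiber A (tree_key p A m) y"
    using assms(3) Suc by (simp add: fiber_def)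
  then have "\<lfloor>real p ^ l * x + t\<rfloor> = \<lfloor>real p ^ l * y + t\<rfloor>"
    using assms(3) Suc by (simp add: t_def)
  then have "\<bar>real p ^ l * x - real p ^ l * y\<bar> < 1" by linarith
  then have "real p ^ l * \<bar>x - y\<bar> < 1"
    by (simp add: right_diff_distrib[symmetric] abs_mult)
  then show ?thesis using p by (simp add: field_simps)
qed

text \<open>Whatever the offsets, all cuts up to level \<open>l\<close> lie at multiples of half a
  mesh of level \<open>l\<close>, so the grid of half that mesh refines the tree. This ties the
  adaptive tree to the cell counts.\<close>

lemma tree_key_coarse:
  assumes "\<lfloor>2 * real p ^ l * x\<rfloor> = \<lfloor>2 * real p ^ l * y\<rfloor>"
  shows "tree_key p A l x = tree_key p A l y"
  using assms
proof (induction l)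
  case (Suc l)
  have "\<lfloor>2 * real p ^ l * z\<rfloor> = \<lfloor>2 * real p ^ Suc l * z\<rfloor> div int p" for z
    using floor_divide_real_eq_div[of "int p" "2 * real p ^ Suc l * z"] p by (simp add: mult_ac)
  with Suc have IH: "tree_key p A l x = tree_key p A l y" by simp
  define t where "t = best_offset (real p ^ Suc l) (fiber A (tree_key p A l) x)"
  have "t \<in> {0, 1 / 2}" unfolding t_def by (intro best_offset(1) finite_fiber fin)
  then obtain a :: int where a: "t = of_int a / 2" by force
  have "\<lfloor>real p ^ Suc l * z + t\<rfloor> = (\<lfloor>2 * real p ^ Suc l * z\<rfloor> + a) div 2" for z
  proof -
    have "real p ^ Suc l * z + t = (2 * real p ^ Suc l * z + of_int a) / of_int 2" by (simp add: a)
    then show ?thesis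
      by (simp only: floor_divide_real_eq_div floor_add_int)
  qed
  then have "\<lfloor>real p ^ Suc l * x + t\<rfloor> = \<lfloor>real p ^ Suc l * y + t\<rfloor>" using Suc.prems by simp
  moreover have "fiber A (tree_key p A l) y = fiber A (tree_key p A l) x"
      by (simp add: fiber_def IH)
  ultimately show ?case by (simp add: IH t_def)
qed simp

lemma tree_spread_nonneg: "x \<in> A \<Longrightarrow> 0 \<le> tree_spread p A l x"
  using max_child_le[OF finite_fiber[OF fin(1)], of "real p ^ Suc l"
      "tree_key p A l" x] card_fiber_pos[OF fin(1), of x "tree_key p A l"]
  unfolding tree_spread_def by (simp add: divide_le_eq_1 del: power_Suc)

text \<open>A class is shorter than \<open>p\<close> meshes of the next level, so it has at most
  \<open>p + 1\<close> children. One of them is the heaviest cell, and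
  \<open>class_entropy_le\<close> applies with \<open>Q = p\<close>.\<close>

lemma tree_ent_step:
  assumes b: "0 < b"
  shows "ent A (tree_key p A (Suc l)) \<le> ent A (tree_key p A l)
      + ln (real p / b) * avg A (tree_spread p A l) + b"
proof -
  let ?g = "tree_key p A l" and ?f = "tree_key p A (Suc l)"
  let ?P = "real p ^ Suc l"
  have "(\<Sum>x\<in>A. ln (real (card (fiber A ?g x)) / real (card (fiber A ?f x))))
      \<le> (\<Sum>x\<in>A. ln (real p / b) * tree_spread p A l x + b)"
  proof (rule sum_by_fibers[OF fin(1), of _ ?g])
    fix x assume x: "x \<in> A"
    define C where "C = fiber A ?g x"
    define t where "t = best_offset ?P C"
    have C: "finite C" "x \<in> C" "C \<subseteq> A" using fin x by (auto simp: C_def fiber_def)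
    have fibC: "fiber A ?g y = C" if "y \<in> C" for y using fiber_eq that unfolding C_def by metis
    have f: "?f y = \<lfloor>?P * y + t\<rfloor> # ?g x" if "y \<in> C" for y
      using fibC[OF that] that by (simp add: t_def C_def fiber_def)
    obtain k where k: "card {y\<in>C. \<lfloor>?P * y + t\<rfloor> = k} = max_child ?P C"
      using best_offset(2)[OF C(1)] unfolding t_def by blast
    have M: "max_child ?P C = card {y\<in>C. ?f y = k # ?g x}"
      unfolding k[symmetric] by (rule arg_cong[of _ _ card]) (use f in auto)
    have img: "card (?f ` C) \<le> Suc p"
    proof -
      define m where "m = Min ((\<lambda>y. \<lfloor>?P * y + t\<rfloor>) ` C)"
      have "\<lfloor>?P * y + t\<rfloor> \<in> {m..m + int p}" if y: "y \<in> C" for y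
      proof -
        have "m \<in> (\<lambda>y. \<lfloor>?P * y + t\<rfloor>) ` C" unfolding m_def using C by (intro Min_in) auto
        then obtain z where z: "z \<in> C" "m = \<lfloor>?P * z + t\<rfloor>" by auto
        have "\<bar>y - z\<bar> < 1 / real p ^ l"
          using y z C by (intro tree_key_diam) (auto simp: C_def fiber_def)
        then have "real p ^ l * \<bar>y - z\<bar> < 1" using p by (simp add: field_simps)
        then have "real p * (real p ^ l * \<bar>y - z\<bar>) < real p" using p by simp
        then have "\<bar>?P * y - ?P * z\<bar> < real p"
            by (simp add: right_diff_distrib[symmetric] abs_mult mult.assoc)
        then have "\<lfloor>?P * y + t\<rfloor> \<le> m + int p" unfolding z(2) by linarith
        moreover have "m \<le> \<lfloor>?P * y + t\<rfloor>" unfolding m_def using C y by (intro Min_le) auto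
        ultimately show ?thesis by simp
      qed
      then have "?f ` C \<subseteq> (\<lambda>q. q # ?g x) ` {m..m + int p}" using f by auto
      then have "card (?f ` C) \<le> card {m..m + int p}" by (rule surj_card_le[rotated]) simp
      then show ?thesis by simp
    qed
    have "(\<Sum>y\<in>C. ln (real (card (fiber A ?g y)) / real (card (fiber A ?f y))))
        = (\<Sum>y\<in>C. ln (real (card C) / real (card (fiber C ?f y))))"
    proof (intro sum.cong refl)
      fix y assume y: "y \<in> C"
      have "fiber C ?f y = fiber A ?f y"
        unfolding C_def by (rule fiber_of_fiber) (use y in \<open>auto simp: C_def\<close>)
      then show "ln (real (card (fiber A ?g y)) / real (card (fiber A ?f y)))
          = ln (real (card C) / real (card (fiber C ?f y)))"
        using fibC[OF y] by simp
    qed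
    also have "\<dots> \<le> (real (card C) - real (max_child ?P C)) * ln (real p / b) + b * real (card C)"
      using p b C max_child_pos[OF C(1)] by (intro class_entropy_le[OF C(1) M _ img]) auto
    also have "\<dots> = (\<Sum>y\<in>C. ln (real p / b) * tree_spread p A l y + b)"
    proof -
      have "(\<Sum>y\<in>C. ln (real p / b) * tree_spread p A l y + b)
          = (\<Sum>y\<in>C. ln (real p / b) * (1 - real (max_child ?P C) / real (card C)) + b)"
        by (intro sum.cong refl) (simp add: tree_spread_def fibC)
      also have "\<dots> = (real (card C) - real (max_child ?P C)) * ln (real p / b) + b * real (card C)"
        using C by (auto simp: field_simps card_gt_0_iff)
      finally show ?thesis by simp
    qed
    finally show "(\<Sum>y\<in>fiber A ?g x. ln (real (card (fiber A ?g y)) / real (card (fiber A ?f y))))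
        \<le> (\<Sum>y\<in>fiber A ?g x. ln (real p / b) * tree_spread p A l y + b)"
      unfolding C_def .
  qed
  then have "ent A ?f - ent A ?g \<le> avg A (\<lambda>x. ln (real p / b) * tree_spread p A l x + b)"
    unfolding ent_refine_diff[OF fin] avg_def by (intro divide_right_mono) auto
  then show ?thesis by (simp only: avg_add avg_cmult avg_const[OF fin])
qed

text \<open>By \<open>card_near_le_max_child\<close>, at least the fraction
  \<open>tree_spread\<close> of the class of \<open>x\<close> lies a quarter mesh or more away from
  \<open>x\<close>. Spread thus becomes variance of the difference of a coupled pair.\<close>

lemma tree_pair_spread:
  "(1 / (4 * real p ^ Suc l))\<^sup>2 * avg A (tree_spread p A l)
    \<le> pair_avg A (tree_key p A l) (\<lambda>x y. (y - x)\<^sup>2)"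
  unfolding avg_cmult[symmetric]
proof (intro avg_mono)
  fix x assume x: "x \<in> A"
  define C where "C = fiber A (tree_key p A l) x"
  let ?P = "real p ^ Suc l"
  let ?r = "1 / (4 * ?P)"
  have C: "finite C" "0 < card C" unfolding C_def by (auto intro: finite_fiber card_fiber_pos fin x)
  have "card {y\<in>C. \<bar>y - x\<bar> < ?r} \<le> max_child ?P C"
    using p by (intro card_near_le_max_child C) simp
  moreover have "card C = card {y\<in>C. \<bar>y - x\<bar> < ?r} + card {y\<in>C. \<not> \<bar>y - x\<bar> < ?r}"
    using C(1) by (subst card_Un_disjoint[symmetric]) (auto intro: arg_cong[of _ _ card])
  ultimately have far: "real (card C) - real (max_child ?P C) \<le> real (card {y\<in>C. \<not> \<bar>y - x\<bar> < ?r})"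
      by linarith
  have "?r\<^sup>2 * (real (card C) - real (max_child ?P C)) \<le> ?r\<^sup>2 * real (card {y\<in>C. \<not> \<bar>y - x\<bar> < ?r})"
    by (intro mult_left_mono far) simp
  also have "\<dots> = (\<Sum>y\<in>{y\<in>C. \<not> \<bar>y - x\<bar> < ?r}. ?r\<^sup>2)" by simp
  also have "\<dots> \<le> (\<Sum>y\<in>{y\<in>C. \<not> \<bar>y - x\<bar> < ?r}. (y - x)\<^sup>2)"
  proof (rule sum_mono)
    fix y assume "y \<in> {y\<in>C. \<not> \<bar>y - x\<bar> < ?r}"
    then have "\<bar>?r\<bar> \<le> \<bar>y - x\<bar>" using p by simp
    then show "?r\<^sup>2 \<le> (y - x)\<^sup>2" by (simp only: abs_le_square_iff)
  qed
  also have "\<dots> \<le> (\<Sum>y\<in>C. (y - x)\<^sup>2)" using C(1) by (intro sum_mono2) auto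
  finally have "?r\<^sup>2 * (real (card C) - real (max_child ?P C)) / real (card C)
      \<le> avg C (\<lambda>y. (y - x)\<^sup>2)"
    unfolding avg_def by (rule divide_right_mono) simp
  moreover have "?r\<^sup>2 * tree_spread p A l x = ?r\<^sup>2 * (real (card C) - real (max_child ?P C)) / real
      (card C)"
    unfolding tree_spread_def C_def[symmetric] using C(2)
        by (simp add: diff_divide_distrib right_diff_distrib)
  ultimately show "?r\<^sup>2 * tree_spread p A l x \<le> avg (fiber A (tree_key p A l) x) (\<lambda>y. (y - x)\<^sup>2)"
    unfolding C_def by simp
qed

lemma tree_spread_sum_ge:
  assumes "0 < b"
  shows "ent A (tree_key p A (l + m)) - ent A (tree_key p A l) - real m * b
    \<le> ln (real p / b) * (\<Sum>t<m. avg A (tree_spread p A (l + t)))"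
proof (induction m)
  case (Suc m)
  then show ?case using tree_ent_step[OF assms, of "l + m"]
    by (simp add: distrib_left distrib_right del: tree_key.simps)
qed simp

end


section \<open>Cell counts and Hausdorff dimension\<close>

lemma to_circle_add: "to_circle (x + y) = to_circle x + to_circle y"
  by transfer simp

lemma to_circle_frac: "to_circle (frac x) = to_circle x"
  by (simp add: to_circle_eq_iff frac_def)

lemma mult_map_to_circle: "mult_map p (to_circle x) = to_circle (real p * x)"
  by transfer simp

lemma dist_to_circle_le: "dist (to_circle x) (to_circle y) \<le> \<bar>x - y\<bar>"
  using round_diff_minimal[of "x - y" 0] by (simp add: dist_to_circle)

lemma continuous_on_to_circle: "continuous_on A to_circle"
proof (rule continuous_onI)
  show "\<exists>d>0. \<forall>t\<in>A. dist t s < d \<longrightarrow> dist (to_circle t) (to_circle s) \<le> e" if "0 < e" for s e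
    using that dist_to_circle_le by (metis dist_real_def less_eq_real_def order_trans)
qed

lemma to_circle_unit: "\<exists>t\<in>{0..<1}. x = to_circle t"
proof -
  obtain s where "x = to_circle s" using to_circle_surj by blast
  then show ?thesis by (intro bexI[of _ "frac s"]) (auto simp: to_circle_frac frac_lt_1)
qed

lemma compact_circle: "compact (UNIV :: circle set)"
proof -
  have "to_circle ` {0..1} = UNIV" using to_circle_unit by (fastforce simp: image_iff)
  then show ?thesis
    using compact_continuous_image[OF continuous_on_to_circle compact_Icc] by metis
qed

lemma dist_circle_add_le: "dist (a + b) (c + d) \<le> dist a c + dist b (d :: circle)"
proof -
  obtain x where "a = to_circle x" using to_circle_surj by blast
  moreover obtain y where "b = to_circle y" using to_circle_surj by blast
  moreover obtain z where "c = to_circle z" using to_circle_surj by blast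
  moreover obtain w where "d = to_circle w" using to_circle_surj by blast
  moreover have "\<bar>((x + y) - (z + w)) - of_int (round ((x + y) - (z + w)))\<bar>
      \<le> \<bar>((x + y) - (z + w)) - of_int (round (x - z) + round (y - w))\<bar>"
    by (rule round_diff_minimal)
  ultimately show ?thesis
    by (simp add: to_circle_add[symmetric] dist_to_circle)
qed

lemma compact_circle_plus:
  assumes "compact A" "compact (B :: circle set)"
  shows "compact {a + b | a b. a \<in> A \<and> b \<in> B}"
proof -
  have "continuous_on (A \<times> B) (\<lambda>x. fst x + snd x)"
    unfolding continuous_on_iff
  proof (intro ballI allI impI)
    fix x :: "circle \<times> circle" and e :: real
    assume "0 < e"
    have "dist (fst x' + snd x') (fst x + snd x) < e" if "dist x' x < e / 2" for x'
      using that dist_circle_add_le[of "fst x'" "snd x'" "fst x" "snd x"]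
        dist_fst_le[of x' x] dist_snd_le[of x' x] by linarith
    then show "\<exists>d>0. \<forall>x'\<in>A \<times> B. dist x' x < d \<longrightarrow> dist (fst x' + snd x') (fst x + snd x) < e"
      using \<open>0 < e\<close> by (intro exI[of _ "e / 2"]) simp
  qed
  then have "compact ((\<lambda>x. fst x + snd x) ` (A \<times> B))"
    by (intro compact_continuous_image compact_Times assms)
  moreover have "(\<lambda>x. fst x + snd x) ` (A \<times> B) = {a + b | a b. a \<in> A \<and> b \<in> B}" by force
  ultimately show ?thesis by simp
qed

lemma sumset_Suc: "sumset S (Suc n) = {a + b | a b. a \<in> sumset S n \<and> b \<in> S n}"
proof (intro set_eqI iffI)
  fix x assume "x \<in> {a + b | a b. a \<in> sumset S n \<and> b \<in> S n}"
  then obtain s b where x: "x = (\<Sum>i<n. s i) + b" "\<forall>i<n. s i \<in> S i" "b \<in> S n"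
    by (auto simp: sumset_def)
  have "x = (\<Sum>i<Suc n. (s(n := b)) i)" using x(1) by simp
  moreover have "\<forall>i<Suc n. (s(n := b)) i \<in> S i" using x by (simp add: less_Suc_eq)
  ultimately show "x \<in> sumset S (Suc n)" unfolding sumset_def by blast
next
  fix x assume "x \<in> sumset S (Suc n)"
  then obtain s where s: "x = (\<Sum>i<n. s i) + s n" "\<forall>i<Suc n. s i \<in> S i" by (auto simp: sumset_def)
  then have "(\<Sum>i<n. s i) \<in> sumset S n" "s n \<in> S n" by (auto simp: sumset_def)
  with s(1) show "x \<in> {a + b | a b. a \<in> sumset S n \<and> b \<in> S n}" by blast
qed

lemma compact_sumset:
  assumes "\<And>i. closed (S i)"
  shows "compact (sumset S n)"
proof (induction n)
  case 0
  then show ?case by (simp add: sumset_def)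
next
  case (Suc n)
  have "compact (S n)" using compact_Int_closed[OF compact_circle assms] by simp
  with Suc show ?case unfolding sumset_Suc by (rule compact_circle_plus)
qed

lemma mult_map_add: "mult_map p (x + y) = mult_map p x + mult_map p y"
  by transfer (simp add: distrib_left)

lemma mult_invariant_sumset:
  assumes "\<And>i. mult_invariant p (S i)"
  shows "mult_invariant p (sumset S n)"
proof (induction n)
  case 0
  have "mult_map p 0 = 0" by transfer simp
  then show ?case by (simp add: sumset_def mult_invariant_def)
next
  case (Suc n)
  show ?case
    unfolding mult_invariant_def
  proof (intro image_subsetI)
    fix x assume "x \<in> sumset S (Suc n)"
    then obtain a b where ab: "x = a + b" "a \<in> sumset S n" "b \<in> S n" unfolding sumset_Suc by blast
    then have "mult_map p a \<in> sumset S n" "mult_map p b \<in> S n"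
      using Suc assms[of n] by (auto simp: mult_invariant_def)
    then show "mult_map p x \<in> sumset S (Suc n)" unfolding sumset_Suc ab(1) mult_map_add by blast
  qed
qed

lemma to_circle_power_mem:
  assumes "mult_invariant p S" "to_circle x \<in> S"
  shows "to_circle (real p ^ k * x) \<in> S"
proof (induction k)
  case (Suc k)
  then have "mult_map p (to_circle (real p ^ k * x)) \<in> S" using assms
      by (auto simp: mult_invariant_def)
  then show ?case by (simp add: mult_map_to_circle mult.assoc)
qed (use assms in simp)

section \<open>Cell counts of invariant sets\<close>

definition unit_lift :: "circle set \<Rightarrow> real set"
  where "unit_lift S = {x\<in>{0..<1}. to_circle x \<in> S}"

definition cells :: "nat \<Rightarrow> circle set \<Rightarrow> nat \<Rightarrow> int set"
  where "cells p S k = (\<lambda>x. \<lfloor>real p ^ k * x\<rfloor>) ` unit_lift S"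

lemma frac_mem_unit_lift: "to_circle x \<in> S \<Longrightarrow> frac x \<in> unit_lift S"
  by (simp add: unit_lift_def to_circle_frac frac_lt_1)

lemma cells_subset:
  assumes "0 < p"
  shows "cells p S k \<subseteq> {0..<int p ^ k}"
proof
  fix q assume "q \<in> cells p S k"
  then obtain x where x: "q = \<lfloor>real p ^ k * x\<rfloor>" "0 \<le> x" "x < 1"
      by (auto simp: cells_def unit_lift_def)
  have "real p ^ k * x < real p ^ k" using x assms by simp
  then have "q < int p ^ k" unfolding x(1) by (simp add: floor_less_iff)
  moreover have "0 \<le> q" using x assms by simp
  ultimately show "q \<in> {0..<int p ^ k}" by simp
qed

lemma finite_cells: "0 < p \<Longrightarrow> finite (cells p S k)"
  by (rule finite_subset[OF cells_subset]) simp_all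

lemma card_cells_le:
  assumes "0 < p"
  shows "card (cells p S k) \<le> p ^ k"
proof -
  have "card (cells p S k) \<le> card {0..<int p ^ k}" by (intro card_mono cells_subset assms) simp
  then show ?thesis by (simp add: nat_power_eq)
qed

lemma card_cells_pos:
  assumes "0 < p" "S \<noteq> {}"
  shows "0 < card (cells p S k)"
proof -
  obtain x where "x \<in> S" using assms(2) by blast
  moreover obtain t where "t \<in> {0..<1}" "x = to_circle t" using to_circle_unit by blast
  ultimately have "t \<in> unit_lift S" by (simp add: unit_lift_def)
  then show ?thesis using finite_cells[OF assms(1)] by (auto simp: card_gt_0_iff cells_def)
qed

lemma floor_power_split:
  "\<lfloor>real p ^ (a + b) * x\<rfloor> = int p ^ b * \<lfloor>real p ^ a * x\<rfloor> + \<lfloor>real p ^ b * frac (real p ^ a * x)\<rfloor>"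
proof -
  have e: "real p ^ (a + b) * x = real p ^ b * frac (real p ^ a * x)
      + of_int (int p ^ b * \<lfloor>real p ^ a * x\<rfloor>)"
    by (simp add: frac_def power_add algebra_simps)
  show ?thesis unfolding e floor_add_int[symmetric] by (rule add.commute)
qed

text \<open>A cell of level \<open>a + b\<close> is a cell of level \<open>a\<close> followed by the
  level \<open>b\<close> cell of \<open>p ^ a * x\<close>, and that point stays in \<open>S\<close>
  by invariance. \<open>X\<close> may be any set of real representatives, because this is applied to
  pieces of covers, to tree classes and to sums not reduced modulo 1.\<close>

lemma card_subcells_le:
  assumes "0 < p" "mult_invariant p S" "\<And>x. x \<in> X \<Longrightarrow> to_circle x \<in> S"
    and fin: "finite ((\<lambda>x. \<lfloor>real p ^ a * x\<rfloor>) ` X)"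
  shows "card ((\<lambda>x. \<lfloor>real p ^ (a + b) * x\<rfloor>) ` X)
    \<le> card ((\<lambda>x. \<lfloor>real p ^ a * x\<rfloor>) ` X) * card (cells p S b)"
proof -
  let ?f = "\<lambda>(q, r). int p ^ b * q + r :: int"
  let ?D = "(\<lambda>x. \<lfloor>real p ^ a * x\<rfloor>) ` X \<times> cells p S b"
  have "\<lfloor>real p ^ (a + b) * x\<rfloor> \<in> ?f ` ?D" if "x \<in> X" for x
  proof -
    have "\<lfloor>real p ^ b * frac (real p ^ a * x)\<rfloor> \<in> cells p S b"
      unfolding cells_def
      by (intro imageI frac_mem_unit_lift to_circle_power_mem assms that)
    moreover have "\<lfloor>real p ^ a * x\<rfloor> \<in> (\<lambda>x. \<lfloor>real p ^ a * x\<rfloor>) ` X" using that by blast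
    ultimately have "?f (\<lfloor>real p ^ a * x\<rfloor>, \<lfloor>real p ^ b * frac (real p ^ a * x)\<rfloor>) \<in> ?f ` ?D" by blast
    then show ?thesis by (simp only: floor_power_split prod.case)
  qed
  then have sub: "(\<lambda>x. \<lfloor>real p ^ (a + b) * x\<rfloor>) ` X \<subseteq> ?f ` ?D" by blast
  have D: "finite ?D" by (rule finite_cartesian_product[OF fin finite_cells[OF assms(1)]])
  have "card ((\<lambda>x. \<lfloor>real p ^ (a + b) * x\<rfloor>) ` X) \<le> card (?f ` ?D)"
    by (rule card_mono[OF finite_imageI[OF D] sub])
  also have "\<dots> \<le> card ?D" by (rule card_image_le[OF D])
  finally show ?thesis by (simp add: card_cartesian_product)
qed

lemma card_cells_add:
  assumes "0 < p" "mult_invariant p S"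
  shows "card (cells p S (a + b)) \<le> card (cells p S a) * card (cells p S b)"
  unfolding cells_def[of p S "a + b"] cells_def[of p S a]
  by (intro card_subcells_le assms finite_cells[unfolded cells_def]) (auto simp: unit_lift_def)

lemma card_cells_mult:
  assumes "0 < p" "mult_invariant p S" "S \<noteq> {}"
  shows "card (cells p S (k * j)) \<le> card (cells p S k) ^ j"
proof (induction j)
  case 0
  then show ?case using card_cells_le[OF assms(1), of S 0] by simp
next
  case (Suc j)
  have "card (cells p S (k * Suc j)) \<le> card (cells p S k) * card (cells p S (k * j))"
    using card_cells_add[OF assms(1,2), of k "k * j"] by simp
  with Suc show ?case by (metis le_trans mult_le_mono2 power_Suc)
qed

section \<open>Upper bounds for the dimension\<close>

lemma bounded_circle: "bounded (A :: circle set)"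
  by (rule bounded_subset[OF compact_imp_bounded[OF compact_circle]]) simp

lemma diameter_circle_le:
  assumes "0 \<le> d" "\<And>x y. x \<in> A \<Longrightarrow> y \<in> A \<Longrightarrow> dist x y \<le> d"
  shows "diameter (A :: circle set) \<le> d"
  unfolding diameter_def using assms by (auto intro!: cSUP_least)

definition arc :: "nat \<Rightarrow> nat \<Rightarrow> int \<Rightarrow> circle set"
  where "arc p k q = to_circle ` {x\<in>{0..<1}. \<lfloor>real p ^ k * x\<rfloor> = q}"

lemma diameter_arc_le:
  assumes "0 < p"
  shows "diameter (arc p k q) \<le> (1 / real p) ^ k"
proof (rule diameter_circle_le)
  fix a b assume "a \<in> arc p k q" "b \<in> arc p k q"
  then obtain x y where xy: "a = to_circle x" "b = to_circle y" "\<lfloor>real p ^ k * x\<rfloor>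
      = \<lfloor>real p ^ k * y\<rfloor>"
    by (auto simp: arc_def)
  then have "\<bar>real p ^ k * x - real p ^ k * y\<bar> < 1" by linarith
  then have "real p ^ k * \<bar>x - y\<bar> < 1" by (simp add: right_diff_distrib[symmetric] abs_mult)
  then have "\<bar>x - y\<bar> \<le> (1 / real p) ^ k" using assms by (simp add: field_simps)
  then show "dist a b \<le> (1 / real p) ^ k" using dist_to_circle_le[of x y] xy by simp
qed simp

lemma hausdorff_premeasure_le:
  assumes "0 < p" "0 < s" "(1 / real p) ^ k \<le> \<delta>"
  shows "hausdorff_premeasure s \<delta> S \<le> ennreal (real (card (cells p S k)) * ((1 / real p) ^ k) powr
      s)"
proof -
  \<comment> \<open>The covering sequence is indexed by the cell number; unoccupied numbers get the
    empty set, whose gauge is 0.\<close>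
  define U where "U i = (if int i \<in> cells p S k then arc p k (int i) else {})" for i
  define J where "J = {i. int i \<in> cells p S k}"
  have J: "finite J" "card J = card (cells p S k)"
  proof -
    have "cells p S k = int ` J"
      using cells_subset[OF assms(1), of S k] unfolding J_def
          by (auto simp: image_iff) (metis zero_le_imp_eq_int atLeastLessThan_iff subsetD)
    then show "finite J" "card J = card (cells p S k)"
      using finite_cells[OF assms(1), of S k] by (auto simp: card_image finite_image_iff)
  qed
  have g: "hausdorff_gauge s (U i) \<le> (if i \<in> J then ennreal (((1 / real p) ^ k) powr s) else 0)"
      for i
  proof (cases "i \<in> J")
    case True
    have "0 \<le> diameter (U i)" by (rule diameter_ge_0[OF bounded_circle])
    then have "diameter (U i) powr s \<le> ((1 / real p) ^ k) powr s"
      using True diameter_arc_le[OF assms(1)] assms(2)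
          by (intro powr_mono2) (auto simp: U_def J_def)
    then show ?thesis using True assms(2) by (simp add: hausdorff_gauge_def ennreal_leI)
  qed (simp add: hausdorff_gauge_def U_def J_def)
  have "hausdorff_premeasure s \<delta> S \<le> (\<Sum>i. hausdorff_gauge s (U i))"
    unfolding hausdorff_premeasure_def
  proof (intro Inf_lower, safe intro!: exI[of _ U])
    fix x assume "x \<in> S"
    obtain t where t: "t \<in> {0..<1}" "x = to_circle t" using to_circle_unit by blast
    let ?q = "\<lfloor>real p ^ k * t\<rfloor>"
    have "?q \<in> cells p S k" using t \<open>x \<in> S\<close> by (auto simp: cells_def unit_lift_def)
    moreover have "?q = int (nat ?q)" using t by simp
    moreover have "x \<in> arc p k ?q" using t by (auto simp: arc_def)
    ultimately have "x \<in> U (nat ?q)" by (simp add: U_def)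
    then show "x \<in> (\<Union>i. U i)" by blast
  next
    fix i
    show "bounded (U i)" by (rule bounded_circle)
    have "0 \<le> \<delta>" using assms by (meson order_trans zero_le_power zero_le_divide_1_iff
        of_nat_0_le_iff)
    then show "diameter (U i) \<le> \<delta>"
      using diameter_arc_le[OF assms(1), of k "int i"] assms(3) by (auto simp: U_def)
  qed
  also have "\<dots> \<le> (\<Sum>i. if i \<in> J then ennreal (((1 / real p) ^ k) powr s) else 0)"
    by (intro suminf_le g) auto
  also have "\<dots> = (\<Sum>i\<in>J. ennreal (((1 / real p) ^ k) powr s))"
    by (subst suminf_finite[OF J(1)]) auto
  also have "\<dots> = ennreal (real (card (cells p S k)) * ((1 / real p) ^ k) powr s)"
    by (simp add: J(2) ennreal_mult ennreal_of_nat_eq_real_of_nat)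
  finally show ?thesis .
qed

text \<open>One level \<open>k\<close> with too few cells suffices: by submultiplicativity the arcs
  of level \<open>k * j\<close> have gauge sum at most \<open>\<rho> ^ j\<close> with
  \<open>\<rho> < 1\<close>.\<close>

lemma hausdorff_dim_le:
  assumes p: "2 \<le> p" and inv: "mult_invariant p S" "S \<noteq> {}"
    and "0 < s" "0 < k" and N: "real (card (cells p S k)) < (real p ^ k) powr s"
  shows "hausdorff_dim S \<le> ennreal s"
proof -
  have "0 < p" using p by simp
  define \<rho> where "\<rho> = real (card (cells p S k)) * ((1 / real p) ^ k) powr s"
  have rho: "0 \<le> \<rho>" "\<rho> < 1"
  proof -
    have "(1 / real p) ^ k = 1 / real p ^ k" by (simp add: power_one_over)
    then have "\<rho> = real (card (cells p S k)) / (real p ^ k) powr s"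
      using p by (simp add: \<rho>_def powr_divide)
    then show "0 \<le> \<rho>" "\<rho> < 1" using N p by (simp_all add: divide_less_eq)
  qed
  have "hausdorff_premeasure s \<delta> S = 0" if "0 < \<delta>" for \<delta>
  proof -
    have bound: "hausdorff_premeasure s \<delta> S \<le> ennreal (\<rho> ^ j)" if "(1 / real p) ^ (k * j) \<le> \<delta>" for j
    proof -
      have "hausdorff_premeasure s \<delta> S
          \<le> ennreal (real (card (cells p S (k * j))) * ((1 / real p) ^ (k * j)) powr s)"
        by (intro hausdorff_premeasure_le) (use \<open>0 < p\<close> \<open>0 < s\<close> that in auto)
      also have "\<dots> \<le> ennreal (real (card (cells p S k) ^ j) * ((1 / real p) ^ (k * j)) powr s)"
        by (intro ennreal_leI mult_right_mono of_nat_mono card_cells_mult \<open>0 < p\<close> inv) auto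
      also have "((1 / real p) ^ (k * j)) powr s = (((1 / real p) ^ k) powr s) ^ j"
        using \<open>0 < p\<close> by (simp add: power_mult powr_power powr_powr powr_realpow[symmetric] mult_ac)
      finally show ?thesis by (simp add: \<rho>_def power_mult_distrib)
    qed
    have "(\<lambda>j. (1 / real p) ^ (k * j)) \<longlonglongrightarrow> 0"
      unfolding power_mult by (intro LIMSEQ_realpow_zero) (use p \<open>0
          < k\<close> in \<open>auto intro: power_Suc_less_one simp: power_less_one_iff\<close>)
    then have "\<forall>\<^sub>F j in sequentially. (1 / real p) ^ (k * j) < \<delta>"
      using that by (rule order_tendstoD)
    then have ev: "\<forall>\<^sub>F j in sequentially. hausdorff_premeasure s \<delta> S \<le> ennreal (\<rho> ^ j)"
      by eventually_elim (rule bound, simp)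
    have "(\<lambda>j. ennreal (\<rho> ^ j)) \<longlonglongrightarrow> ennreal 0"
      using rho by (intro tendsto_ennrealI LIMSEQ_realpow_zero)
    then have "hausdorff_premeasure s \<delta> S \<le> ennreal 0"
      using ev by (rule tendsto_lowerbound) simp
    then show ?thesis by simp
  qed
  then have "hausdorff_measure s S = 0" by (simp add: hausdorff_measure_def)
  then show ?thesis unfolding hausdorff_dim_def using \<open>0 < s\<close> by (intro Inf_lower) auto
qed

section \<open>Lower bounds for the dimension of compact invariant sets\<close>

lemma exists_scale:
  fixes e :: real
  assumes "2 \<le> (p::nat)" "0 < e" "e \<le> 1 / real p"
  shows "\<exists>l\<ge>1. e \<le> (1 / real p) ^ l \<and> (1 / real p) ^ l \<le> real p * e"
proof -
  have q: "0 < 1 / real p" "1 / real p < 1" using assms by auto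
  obtain n where n: "(1 / real p) ^ n < e" using real_arch_pow_inv[OF assms(2) q(2)] by blast
  define l where "l = (LEAST l. (1 / real p) ^ Suc l < e)"
  have "(1 / real p) ^ Suc n \<le> (1 / real p) ^ n" using q by (intro power_decreasing) auto
  then have "(1 / real p) ^ Suc n < e" using n by linarith
  then have l: "(1 / real p) ^ Suc l < e" unfolding l_def
      by (rule LeastI[of "\<lambda>l. (1 / real p) ^ Suc l < e"])
  have "l \<noteq> 0" using l assms(3) by (intro notI) simp
  then obtain k where k: "l = Suc k" using not0_implies_Suc by blast
  have "\<not> (1 / real p) ^ Suc k < e"
    using not_less_Least[of k "\<lambda>l. (1 / real p) ^ Suc l < e"] k unfolding l_def by simp
  moreover have "(1 / real p) ^ l = real p * (1 / real p) ^ Suc l" using assms by simp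
  moreover have "real p * (1 / real p) ^ Suc l \<le> real p * e" using l by (intro mult_left_mono) auto
  ultimately show ?thesis using k by (intro exI[of _ l]) simp
qed

text \<open>The radius is two cells, so the cell numbers of \<open>y\<close> and \<open>z\<close>
  differ by at most 2, up to a multiple of \<open>p ^ l\<close> from going around the
  circle.\<close>

lemma card_ball_cells:
  assumes "2 \<le> p"
  shows "card ((\<lambda>y. \<lfloor>real p ^ l * y\<rfloor>) ` {y\<in>{0..<1}. dist (to_circle y) (to_circle z)
      < 2 * (1 / real p) ^ l}) \<le> 5"
    and "finite ((\<lambda>y. \<lfloor>real p ^ l * y\<rfloor>) ` {y\<in>{0..<1}. dist (to_circle y) (to_circle z)
        < 2 * (1 / real p) ^ l})"
proof -
  let ?Y = "{y\<in>{0..<1}. dist (to_circle y) (to_circle z) < 2 * (1 / real p) ^ l}"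
  define n where "n = \<lfloor>real p ^ l * z\<rfloor>"
  let ?W = "(\<lambda>q. q mod (int p ^ l)) ` {n - 2..n + 2}"
  have sub: "(\<lambda>y. \<lfloor>real p ^ l * y\<rfloor>) ` ?Y \<subseteq> ?W"
  proof (rule image_subsetI)
    fix y assume y: "y \<in> ?Y"
    define k where "k = round (y - z)"
    have pl: "0 < real p ^ l" using assms by simp
    have "\<bar>y - z - of_int k\<bar> < 2 * (1 / real p) ^ l" using y by (simp add: dist_to_circle k_def)
    then have "real p ^ l * \<bar>y - z - of_int k\<bar> < real p ^ l * (2 * (1 / real p) ^ l)"
      using pl by (rule mult_strict_left_mono)
    also have "\<dots> = 2" using assms by (simp add: power_one_over)
    also have "real p ^ l * \<bar>y - z - of_int k\<bar>
        = \<bar>real p ^ l * y - real p ^ l * z - of_int (int p ^ l * k)\<bar>"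
      using pl by (simp add: abs_mult_pos' right_diff_distrib)
    finally have a: "\<bar>real p ^ l * y - real p ^ l * z - of_int (int p ^ l * k)\<bar> < 2" .
    define q where "q = \<lfloor>real p ^ l * y\<rfloor> - int p ^ l * k"
    have floor_near: "\<lfloor>u\<rfloor> - i \<in> {\<lfloor>v\<rfloor> - 2..\<lfloor>v\<rfloor> + 2}" if "\<bar>u - v - of_int i\<bar> < 2"
        for u v :: real and i
      unfolding atLeastAtMost_iff using that by (intro conjI; linarith)
    have "q \<in> {n - 2..n + 2}" unfolding q_def n_def by (rule floor_near[OF a])
    moreover have "\<lfloor>real p ^ l * y\<rfloor> = q mod (int p ^ l)"
    proof -
      have "\<lfloor>real p ^ l * y\<rfloor> \<in> cells p UNIV l" using y by (simp add: cells_def unit_lift_def)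
      then have "\<lfloor>real p ^ l * y\<rfloor> \<in> {0..<int p ^ l}" using cells_subset[of p UNIV l] assms by auto
      then have "\<lfloor>real p ^ l * y\<rfloor> = \<lfloor>real p ^ l * y\<rfloor> mod (int p ^ l)" by simp
      also have "\<dots> = (\<lfloor>real p ^ l * y\<rfloor> - int p ^ l * k) mod (int p ^ l)"
        by (simp add: mod_eq_dvd_iff)
      finally show ?thesis by (simp add: q_def)
    qed
    ultimately show "\<lfloor>real p ^ l * y\<rfloor> \<in> ?W" by blast
  qed
  have "card ?W \<le> card {n - 2..n + 2}" by (rule card_image_le) simp
  then have W: "card ?W \<le> 5" by simp
  show "card ((\<lambda>y. \<lfloor>real p ^ l * y\<rfloor>) ` ?Y) \<le> 5"
    using card_mono[OF _ sub] W by simp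
  show "finite ((\<lambda>y. \<lfloor>real p ^ l * y\<rfloor>) ` ?Y)"
    by (rule finite_subset[OF sub]) simp
qed

text \<open>Each covering ball of size \<open>(1 / p) ^ l i\<close> magnifies under the dynamics to all of \<open>T\<close>, so
  the cell counts satisfy a renewal inequality, which forces exponential growth at rate at most
  \<open>s\<close>.\<close>

lemma card_cells_of_cover:
  assumes p: "2 \<le> p" and inv: "mult_invariant p T" and "finite F" and "0 < s"
    and cov: "T \<subseteq> (\<Union>i\<in>F. ball (x i) (2 * (1 / real p) ^ l i))"
    and l: "\<And>i. i \<in> F \<Longrightarrow> 1 \<le> l i"
    and small: "5 * (\<Sum>i\<in>F. ((1 / real p) ^ l i) powr s) \<le> 1"
  shows "\<exists>C>0. \<forall>m. real (card (cells p T m)) \<le> C * real p powr (s * real m)"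
proof -
  have "0 < p" using p by simp
  \<comment> \<open>A common bound for all \<open>l i\<close>. Below level \<open>M\<close> the
    trivial bound \<open>p ^ M\<close> starts the induction; from \<open>M\<close> on each
    \<open>m - l i\<close> is a true difference, smaller than \<open>m\<close> because
    \<open>l i \<ge> 1\<close>.\<close>
  define M where "M = (\<Sum>i\<in>F. l i)"
  have lM: "l i \<le> M" if "i \<in> F" for i unfolding M_def using that \<open>finite F\<close>
      by (intro member_le_sum) auto
  define C where "C = real (p ^ M)"
  have C1: "1 \<le> C" unfolding C_def using \<open>0 < p\<close> by simp
  have rec: "card (cells p T m) \<le> (\<Sum>i\<in>F. 5 * card (cells p T (m - l i)))" if "M \<le> m" for m
  proof -
    define X where "X i = {y\<in>unit_lift T. to_circle y \<in> ball (x i) (2 * (1 / real p) ^ l i)}" for i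
    let ?c = "\<lambda>k Y. (\<lambda>y. \<lfloor>real p ^ k * y\<rfloor>) ` Y"
    have X: "card (?c m (X i)) \<le> 5 * card (cells p T (m - l i))" if "i \<in> F" for i
    proof -
      obtain z where z: "x i = to_circle z" using to_circle_surj by blast
      have sub: "?c (l i) (X i) \<subseteq> ?c (l i) {y\<in>{0..<1}. dist (to_circle y) (to_circle z)
          < 2 * (1 / real p) ^ l i}"
        by (auto simp: X_def z unit_lift_def dist_commute)
      note fin = finite_subset[OF sub card_ball_cells(2)[OF p]]
      have "card (?c (l i) (X i)) \<le> 5"
        using card_mono[OF card_ball_cells(2)[OF p] sub] card_ball_cells(1)[OF p, of "l i" z]
            by linarith
      moreover have "card (?c (l i + (m - l i)) (X i))
          \<le> card (?c (l i) (X i)) * card (cells p T (m - l i))"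
        by (rule card_subcells_le[OF \<open>0 < p\<close> inv _ fin]) (simp add: X_def unit_lift_def)
      moreover have "l i + (m - l i) = m" using lM[OF that] \<open>M \<le> m\<close> by simp
      ultimately show ?thesis by (metis le_trans mult_le_mono1)
    qed
    have "unit_lift T = (\<Union>i\<in>F. X i)" using cov unfolding X_def unit_lift_def by blast
    then have "cells p T m = (\<Union>i\<in>F. ?c m (X i))" unfolding cells_def by blast
    then have "card (cells p T m) \<le> (\<Sum>i\<in>F. card (?c m (X i)))" using card_UN_le[OF \<open>finite F\<close>]
        by simp
    also have "\<dots> \<le> (\<Sum>i\<in>F. 5 * card (cells p T (m - l i)))" by (intro sum_mono X)
    finally show ?thesis .
  qed
  have "real (card (cells p T m)) \<le> C * real p powr (s * real m)" for m
  proof (induction m rule: less_induct)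
    case (less m)
    show ?case
    proof (cases "M \<le> m \<and> F \<noteq> {}")
      case False
      show ?thesis
      proof (cases "F = {}")
        case True
        then have "cells p T m = {}" using cov by (simp add: cells_def unit_lift_def)
        then show ?thesis using C1 by simp
      next
        case F: False
        have "real (card (cells p T m)) \<le> real (p ^ m)" using card_cells_le[OF \<open>0 < p\<close>]
            by (rule of_nat_mono)
        also have "\<dots> \<le> C" unfolding C_def using False F \<open>0 < p\<close>
            by (intro of_nat_mono power_increasing) auto
        also have "\<dots> \<le> C * real p powr (s * real m)"
        proof -
          have "1 \<le> real p powr (s * real m)" using p \<open>0 < s\<close> by (intro ge_one_powr_ge_zero) auto
          then show ?thesis using C1 by simp
        qed
        finally show ?thesis .
      qed
    next
      case True
      have "real (card (cells p T m)) \<le> (\<Sum>i\<in>F. 5 * real (card (cells p T (m - l i))))"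
        using of_nat_mono[OF rec, of m, where 'a = real] True by simp
      also have "\<dots> \<le> (\<Sum>i\<in>F. 5 * (C * real p powr (s * real m) * ((1 / real p) ^ l i) powr s))"
      proof (intro sum_mono mult_left_mono)
        fix i assume i: "i \<in> F"
        have li: "l i \<le> m" "1 \<le> l i" using lM[OF i] l[OF i] True by auto
        have "real (card (cells p T (m - l i))) \<le> C * real p powr (s * real (m - l i))"
          using li by (intro less) auto
        also have "real p powr (s * real (m - l i))
            = real p powr (s * real m) * ((1 / real p) ^ l i) powr s"
        proof -
          have "(1 / real p) ^ l i = real p powr (- real (l i))"
            using \<open>0 < p\<close> by (simp add: powr_minus powr_realpow power_one_over divide_inverse
                power_inverse)
          then show ?thesis using li
              by (simp add: powr_powr powr_add[symmetric] of_nat_diff algebra_simps)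
        qed
        finally show "real (card (cells p T (m - l i)))
            \<le> C * real p powr (s * real m) * ((1 / real p) ^ l i) powr s"
          by (simp add: mult.assoc)
      qed simp
      also have "\<dots> = C * real p powr (s * real m) * (5 * (\<Sum>i\<in>F. ((1 / real p) ^ l i) powr s))"
        by (simp add: sum_distrib_left mult_ac)
      also have "\<dots> \<le> C * real p powr (s * real m) * 1"
        using C1 small by (intro mult_left_mono) auto
      finally show ?thesis by simp
    qed
  qed
  then show ?thesis using C1 by (intro exI[of _ C]) auto
qed

text \<open>Covering sets need not be open and may have diameter 0. Each is enlarged to a ball whose
  radius is comparable to \<open>max (a i) (\<eta> i)\<close>, where the powers of the auxiliary
  lengths \<open>\<eta> i\<close> have small sum. Compactness then leaves a finite cover, as
  \<open>card_cells_of_cover\<close> requires. The exponent \<open>s'\<close> is positive even if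
  \<open>s = 0\<close>.\<close>

lemma card_cells_le_of_hausdorff_measure_0:
  assumes p: "2 \<le> p" and inv: "mult_invariant p T" and comp: "compact T"
    and s: "0 \<le> s" "s < s'" and null: "hausdorff_measure s T = 0"
  shows "\<exists>C>0. \<forall>m. real (card (cells p T m)) \<le> C * real p powr (s' * real m)"
proof -
  have "0 < p" using p by simp
  have "0 < s'" using s by simp
  define \<delta> where "\<delta> = 1 / real p"
  have \<delta>: "0 < \<delta>" "\<delta> < 1" using p by (auto simp: \<delta>_def)
  \<comment> \<open>The 10 stands for five cells per ball times two contributions
    \<open>\<epsilon>\<close>, from the diameters and from the \<open>\<eta> i\<close>. The power of
    \<open>\<delta>\<close> undoes the factor \<open>p\<close> lost in
    \<open>exists_scale\<close>.\<close>
  define \<epsilon> where "\<epsilon> = \<delta> powr s' / 10"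
  have \<epsilon>: "0 < \<epsilon>" "\<epsilon> \<le> \<delta> powr s'" using \<delta> by (auto simp: \<epsilon>_def)
  have "hausdorff_premeasure s \<delta> T \<le> hausdorff_measure s T"
    unfolding hausdorff_measure_def using \<delta> by (intro SUP_upper) auto
  then have "hausdorff_premeasure s \<delta> T < ennreal \<epsilon>" using null \<epsilon> by simp
  then obtain U where U: "T \<subseteq> (\<Union>i. U i)" "\<And>i. diameter (U i) \<le> \<delta>"
      "(\<Sum>i. hausdorff_gauge s (U i :: circle set)) < ennreal \<epsilon>"
    unfolding hausdorff_premeasure_def Inf_less_iff by blast
  define a where "a i = diameter (U i)" for i
  have a: "0 \<le> a i" "a i \<le> \<delta>" for i using U(2) diameter_ge_0[OF bounded_circle]
      by (auto simp: a_def)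
  have gauge: "ennreal (a i powr s') \<le> hausdorff_gauge s (U i)" if "U i \<noteq> {}" for i
  proof (cases "s = 0")
    case True
    have "a i powr s' \<le> 1" using a[of i] \<delta> s by (intro powr_le1) auto
    then show ?thesis using that True by (simp add: hausdorff_gauge_def)
  next
    case False
    have "a i powr s' \<le> a i powr s"
    proof (cases "a i = 0")
      case False
      then show ?thesis using a[of i] \<delta> s by (intro powr_mono') auto
    qed simp
    then show ?thesis using that False by (simp add: hausdorff_gauge_def a_def ennreal_leI)
  qed
  define \<eta> where "\<eta> i = (\<epsilon> * (1 / 2) ^ Suc i) powr (1 / s')" for i
  have eta: "0 < \<eta> i" "\<eta> i \<le> \<delta>" "\<eta> i powr s' = \<epsilon> * (1 / 2) ^ Suc i" for i
  proof -
    show "0 < \<eta> i" using \<epsilon> by (simp add: \<eta>_def)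
    have "\<epsilon> * (1 / 2) ^ Suc i \<le> \<epsilon> * 1" using \<epsilon> by (intro mult_left_mono power_le_one) auto
    then have "\<epsilon> * (1 / 2) ^ Suc i \<le> \<delta> powr s'" using \<epsilon>(2) by linarith
    then have "\<eta> i \<le> (\<delta> powr s') powr (1 / s')"
      unfolding \<eta>_def using \<epsilon>(1) \<open>0 < s'\<close> by (intro powr_mono2) simp_all
    also have "\<dots> = \<delta>" using \<open>0 < s'\<close> \<delta> by (simp add: powr_powr)
    finally show "\<eta> i \<le> \<delta>" .
    show "\<eta> i powr s' = \<epsilon> * (1 / 2) ^ Suc i" unfolding \<eta>_def using \<epsilon> \<open>0 < s'\<close>
        by (simp add: powr_powr)
  qed
  have "\<forall>i. \<exists>l\<ge>1. max (a i) (\<eta> i) \<le> (1 / real p) ^ l \<and> (1 / real p) ^ l \<le> real p * max (a i) (\<eta> i)"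
  proof
    fix i
    show "\<exists>l\<ge>1. max (a i) (\<eta> i) \<le> (1 / real p) ^ l \<and> (1 / real p) ^ l \<le> real p * max (a i) (\<eta> i)"
      using a[of i] eta(1,2)[of i] by (intro exists_scale p) (auto simp: \<delta>_def max_def)
  qed
  then obtain l where l: "\<And>i. 1 \<le> l i" "\<And>i. max (a i) (\<eta> i) \<le> (1 / real p) ^ l i"
      "\<And>i. (1 / real p) ^ l i \<le> real p * max (a i) (\<eta> i)" by metis
  define I where "I = {i. U i \<noteq> {}}"
  have "\<forall>i\<in>I. \<exists>x. x \<in> U i" by (auto simp: I_def)
  then obtain x where x: "\<And>i. i \<in> I \<Longrightarrow> x i \<in> U i" by metis
  let ?B = "\<lambda>i. ball (x i) (2 * (1 / real p) ^ l i)"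
  have UB: "U i \<subseteq> ?B i" if "i \<in> I" for i
  proof
    fix y assume "y \<in> U i"
    then have "dist (x i) y \<le> a i"
      unfolding a_def using x[OF that] by (intro diameter_bounded_bound bounded_circle)
    also have "\<dots> \<le> (1 / real p) ^ l i" using l(2)[of i] by simp
    also have "\<dots> < 2 * (1 / real p) ^ l i" using \<open>0 < p\<close> by simp
    finally show "y \<in> ?B i" by simp
  qed
  have "T \<subseteq> (\<Union>i\<in>I. ?B i)"
  proof
    fix y assume "y \<in> T"
    then obtain i where "y \<in> U i" using U(1) by blast
    moreover from this have "i \<in> I" by (auto simp: I_def)
    ultimately show "y \<in> (\<Union>i\<in>I. ?B i)" using UB by blast
  qed
  then obtain F where F: "F \<subseteq> I" "finite F" "T \<subseteq> (\<Union>i\<in>F. ?B i)"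
    using compactE_image[OF comp, of I ?B] by (metis open_ball)
  have sa: "(\<Sum>i\<in>F. a i powr s') \<le> \<epsilon>"
  proof -
    have "ennreal (\<Sum>i\<in>F. a i powr s') = (\<Sum>i\<in>F. ennreal (a i powr s'))" by (simp add: sum_ennreal)
    also have "\<dots> \<le> (\<Sum>i\<in>F. hausdorff_gauge s (U i))"
      using F(1) by (intro sum_mono gauge) (auto simp: I_def)
    also have "\<dots> \<le> (\<Sum>i. hausdorff_gauge s (U i))" using F(2) by (intro sum_le_suminf) auto
    also have "\<dots> \<le> ennreal \<epsilon>" using U(3) by simp
    finally show ?thesis using \<epsilon> by (simp add: ennreal_le_iff)
  qed
  have sh: "(\<Sum>i\<in>F. (1 / 2 :: real) ^ Suc i) \<le> 1"
    using sum_le_suminf[OF sums_summable[OF power_half_series] F(2)] sums_unique[OF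
        power_half_series] by simp
  have "5 * (\<Sum>i\<in>F. ((1 / real p) ^ l i) powr s') \<le> 5 * (\<Sum>i\<in>F. real p powr s' * (a i powr s'
      + \<epsilon> * (1 / 2) ^ Suc i))"
  proof (intro mult_left_mono sum_mono)
    fix i assume "i \<in> F"
    have "((1 / real p) ^ l i) powr s' \<le> (real p * max (a i) (\<eta> i)) powr s'"
      using l(3) \<open>0 < s'\<close> by (intro powr_mono2) auto
    also have "\<dots> = real p powr s' * max (a i) (\<eta> i) powr s'" using a[of i] by (simp add: powr_mult)
    also have "\<dots> \<le> real p powr s' * (a i powr s' + \<eta> i powr s')"
      by (intro mult_left_mono) (auto simp: max_def)
    finally show "((1 / real p) ^ l i) powr s' \<le> real p powr s' * (a i powr s'
        + \<epsilon> * (1 / 2) ^ Suc i)"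
      by (simp only: eta(3))
  qed simp
  also have "\<dots> = 5 * real p powr s' * ((\<Sum>i\<in>F. a i powr s') + \<epsilon> * (\<Sum>i\<in>F. (1 / 2) ^ Suc i))"
    by (simp only: sum_distrib_left sum.distrib distrib_left mult.assoc)
  also have "\<dots> \<le> 5 * real p powr s' * (\<epsilon> + \<epsilon> * 1)"
    using \<epsilon> sa sh by (intro mult_left_mono add_mono) auto
  also have "\<dots> = 1" using \<open>0 < p\<close> by (simp add: \<epsilon>_def \<delta>_def powr_divide)
  finally have "5 * (\<Sum>i\<in>F. ((1 / real p) ^ l i) powr s') \<le> 1" .
  then show ?thesis using card_cells_of_cover[OF p inv F(2) \<open>0 < s'\<close> F(3)] l(1) by blast
qed

text \<open>A null exponent \<open>s < a\<close> would bound the growth of the counts by an exponent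
  \<open>s'\<close> strictly between \<open>s\<close> and \<open>a\<close>, against
  \<open>N\<close>.\<close>

lemma hausdorff_dim_ge:
  assumes p: "2 \<le> p" and inv: "mult_invariant p T" and comp: "compact T"
    and N: "\<And>m. m0 \<le> m \<Longrightarrow> real p powr (a * real m) \<le> real (card (cells p T m))"
  shows "ennreal a \<le> hausdorff_dim T"
  unfolding hausdorff_dim_def
proof (intro Inf_greatest, safe)
  fix s :: real assume s: "0 \<le> s" "hausdorff_measure s T = 0"
  show "ennreal a \<le> ennreal s"
  proof (rule ccontr)
    assume "\<not> ennreal a \<le> ennreal s"
    then have "s < a" using s(1) by (meson ennreal_leI not_le)
    define s' where "s' = (s + a) / 2"
    have s': "s < s'" "s' < a" using \<open>s < a\<close> by (auto simp: s'_def)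
    obtain C where C: "0 < C" "\<And>m. real (card (cells p T m)) \<le> C * real p powr (s' * real m)"
      using card_cells_le_of_hausdorff_measure_0[OF p inv comp s(1) s'(1) s(2)] by blast
    define r where "r = real p powr (a - s')"
    have "1 < r" unfolding r_def using s'(2) p by (intro gr_one_powr) auto
    then obtain n where n: "C < r ^ n" using real_arch_pow by blast
    define m where "m = max n m0"
    have "r ^ n \<le> r ^ m" using \<open>1 < r\<close> by (intro power_increasing) (auto simp: m_def)
    then have "C < r ^ m" using n by simp
    also have "r ^ m = real p powr ((a - s') * real m)"
      using p by (simp add: r_def powr_realpow[symmetric] powr_powr)
    finally have "C * real p powr (s' * real m)
        < real p powr ((a - s') * real m) * real p powr (s' * real m)"
      using p by (intro mult_strict_right_mono) auto
    also have "\<dots> = real p powr (a * real m)" by (simp add: powr_add[symmetric] algebra_simps)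
    also have "\<dots> \<le> real (card (cells p T m))" by (rule N) (simp add: m_def)
    also have "\<dots> \<le> C * real p powr (s' * real m)" by (rule C(2))
    finally show False by simp
  qed
qed

text \<open>As in Fekete's lemma, \<open>a k\<close> is \<open>\<beta> * k\<close> up to a small
  linear error, with \<open>\<beta> \<ge> H\<close>. The difference is therefore about
  \<open>\<beta> * m\<close> for every \<open>j\<close>; a quarter of \<open>H\<close> is spent on
  the linear error and a quarter on the constants. Applied to logarithms of cell counts, it bounds
  the entropy gained between tree levels \<open>j + c\<close> and \<open>j + c + m\<close>,
  uniformly in \<open>j\<close>.\<close>

lemma subadditive_growth:
  fixes a :: "nat \<Rightarrow> real"
  assumes sub: "\<And>j k. a (j + k) \<le> a j + a k" and lower: "\<And>k. H * real k \<le> a k" and "0 < H"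
  shows "\<exists>m0. \<forall>m\<ge>m0. \<forall>j\<le>m. H / 2 * real m \<le> a (2 * m + c) - a (m - j) - a (j + c) - K0"
proof -
  define \<beta> where "\<beta> = (INF k\<in>{1..}. a k / real k)"
  have bdd: "bdd_below ((\<lambda>k. a k / real k) ` {1..})"
    by (intro bdd_belowI[of _ H]) (use lower in \<open>auto simp: field_simps\<close>)
  have beta_le: "\<beta> * real k \<le> a k" for k
  proof (cases "k = 0")
    case False
    then have "\<beta> \<le> a k / real k" unfolding \<beta>_def using bdd by (intro cINF_lower) auto
    then show ?thesis using False by (simp add: field_simps)
  qed (use lower[of 0] in simp)
  have "H \<le> \<beta>" unfolding \<beta>_def by (intro cINF_greatest) (use lower in \<open>auto simp: field_simps\<close>)
  obtain k0 where k0: "1 \<le> k0" "a k0 / real k0 < \<beta> + H / 4"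
    using cINF_less_iff[OF _ bdd, of "\<beta> + H / 4"] \<open>0 < H\<close> unfolding \<beta>_def[symmetric] by auto
  have mult: "a (n * k + r) \<le> real n * a k + a r" for n k r
  proof (induction n)
    case (Suc n)
    have "a (Suc n * k + r) \<le> a k + a (n * k + r)" using sub[of k "n * k + r"]
        by (simp add: add.assoc)
    with Suc show ?case by (simp add: algebra_simps)
  qed simp
  define K1 where "K1 = Max (a ` {..k0})"
  have upper: "a k \<le> (\<beta> + H / 4) * real k + K1" for k
  proof -
    have "a k \<le> real (k div k0) * a k0 + a (k mod k0)" using mult[of "k div k0" k0 "k mod k0"]
        by simp
    also have "a (k mod k0) \<le> K1"
      unfolding K1_def using k0(1) by (intro Max_ge) (auto intro!: imageI less_imp_le
          mod_less_divisor)
    also have "real (k div k0) * a k0 \<le> real (k div k0) * ((\<beta> + H / 4) * real k0)"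
      using k0 by (intro mult_left_mono) (auto simp: field_simps)
    also have "\<dots> = (\<beta> + H / 4) * real (k div k0 * k0)" by simp
    also have "\<dots> \<le> (\<beta> + H / 4) * real k"
      using \<open>H \<le> \<beta>\<close> \<open>0 < H\<close> by (intro mult_left_mono of_nat_mono) auto
    finally show ?thesis by simp
  qed
  define K where "K = H / 4 * real c + 2 * K1 + K0"
  obtain m0 where m0: "4 * K / H \<le> real m0" using real_arch_simple by blast
  show ?thesis
  proof (intro exI[of _ m0] allI impI)
    fix m j assume "m0 \<le> m" "j \<le> m"
    then have "4 * K / H \<le> real m" using m0 by linarith
    then have K: "K \<le> H / 4 * real m" using \<open>0 < H\<close> by (simp add: field_simps)
    have "real m + real c = real (m - j) + real (j + c)" using \<open>j \<le> m\<close> by simp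
    then have "a (m - j) + a (j + c) \<le> (\<beta> + H / 4) * (real m + real c) + 2 * K1"
      using upper[of "m - j"] upper[of "j + c"] by (simp only: distrib_left)
    moreover have "\<beta> * (2 * real m + real c) \<le> a (2 * m + c)" using beta_le[of "2 * m + c"] by simp
    ultimately have low: "\<beta> * real m - H / 4 * (real m + real c) - 2 * K1 \<le> a (2 * m
        + c) - a (m - j) - a (j + c)"
      by (simp add: algebra_simps)
    have Hb: "H * real m \<le> \<beta> * real m" using \<open>H \<le> \<beta>\<close> by (intro mult_right_mono) auto
    have lin: "x / 2 \<le> t - K0"
      if "b - (x + y) / 4 - 2 * K1 \<le> t" "x \<le> b" "y / 4 + 2 * K1 + K0 \<le> x / 4" for x y b t :: real
      using that by (simp add: field_simps)
    show "H / 2 * real m \<le> a (2 * m + c) - a (m - j) - a (j + c) - K0"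
      using lin[OF _ Hb, of "H * real c" "a (2 * m + c) - a (m - j) - a (j + c)"] low K
      by (simp add: K_def distrib_left add_divide_distrib)
  qed
qed


section \<open>Randomly shifted points of an invariant set\<close>

text \<open>Second-order Taylor remainder, with \<open>cos t \<ge> 1 / 2\<close> for
  \<open>\<bar>t\<bar> \<le> 1 \<le> pi / 3\<close>.\<close>

lemma cos_le_quadratic:
  fixes x :: real
  assumes "\<bar>x\<bar> \<le> 1"
  shows "cos x \<le> 1 - x\<^sup>2 / 4"
proof -
  obtain t where t: "\<bar>t\<bar> \<le> \<bar>x\<bar>"
    "cos x = (\<Sum>m<2. cos_coeff m * x ^ m) + (cos (t + 1 / 2 * real 2 * pi) / fact 2) * x ^ 2"
    using Maclaurin_cos_expansion[of x 2] by blast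
  have "\<bar>t\<bar> \<le> pi / 3" using t(1) assms pi_gt3 by linarith
  then have "cos (pi / 3) \<le> cos \<bar>t\<bar>" by (intro cos_monotone_0_pi_le) (use pi_gt3 in auto)
  then have "1 / 2 \<le> cos t" by (simp add: cos_60)
  then have "1 / 2 * x\<^sup>2 \<le> cos t * x\<^sup>2" by (intro mult_right_mono) auto
  moreover have "cos x = 1 - cos t * x\<^sup>2 / 2"
    using t(2) by (simp add: numeral_2_eq_2 cos_coeff_def)
  ultimately show ?thesis by simp
qed

lemma card_image_factor:
  assumes "finite A" "\<And>x y. x \<in> A \<Longrightarrow> y \<in> A \<Longrightarrow> f x = f y \<Longrightarrow> g x = g y"
  shows "card (g ` A) \<le> card (f ` A)"
proof -
  have "g x = g (inv_into A f (f x))" if "x \<in> A" for x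
    using that by (intro assms(2)) (auto simp: f_inv_into_f inv_into_into)
  then have "g ` A \<subseteq> (\<lambda>v. g (inv_into A f v)) ` (f ` A)" by blast
  then show ?thesis using assms(1) by (intro surj_card_le) auto
qed

lemma exists_cell_representatives:
  assumes "0 < p" "S \<noteq> {}"
  shows "\<exists>A \<subseteq> unit_lift S. finite A \<and> A \<noteq> {} \<and> inj_on (\<lambda>x. \<lfloor>real p ^ k * x\<rfloor>) A \<and> card A
      = card (cells p S k)"
proof -
  obtain A where A: "A \<subseteq> unit_lift S" "inj_on (\<lambda>x. \<lfloor>real p ^ k * x\<rfloor>) A" "cells p S k
      = (\<lambda>x. \<lfloor>real p ^ k * x\<rfloor>) ` A"
    using subset_image_inj[of "cells p S k" "\<lambda>x. \<lfloor>real p ^ k * x\<rfloor>" "unit_lift S"]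
        unfolding cells_def by blast
  then have "finite A" using finite_cells[OF assms(1), of S k] finite_image_iff by metis
  moreover have "card A = card (cells p S k)" using A by (simp add: card_image)
  moreover have "A \<noteq> {}" using \<open>card A = card (cells p S k)\<close> card_cells_pos[OF assms, of k] by auto
  ultimately show ?thesis using A by blast
qed

lemma finite_int_card_le_2:
  assumes "finite (Q :: int set)" "\<And>q r. q \<in> Q \<Longrightarrow> r \<in> Q \<Longrightarrow> \<bar>q - r\<bar> \<le> 1"
  shows "card Q \<le> 2"
proof (cases "Q = {}")
  case False
  define m where "m = Min Q"
  have m: "m \<in> Q" "\<And>q. q \<in> Q \<Longrightarrow> m \<le> q" unfolding m_def using assms(1) False by auto
  have "Q \<subseteq> {m, m + 1}"
  proof
    fix q assume "q \<in> Q"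
    then have "m \<le> q" "\<bar>q - m\<bar> \<le> 1" using m assms(2)[OF _ m(1)] by blast+
    then show "q \<in> {m, m + 1}" by auto
  qed
  then have "card Q \<le> card {m, m + 1}" by (intro card_mono) auto
  then show ?thesis by simp
qed simp

section \<open>Entropy of the interval tree over cell representatives\<close>

context
  fixes p :: nat and S :: "circle set" and A :: "real set" and \<Lambda> :: nat
  assumes p: "2 \<le> p" and inv: "mult_invariant p S" "S \<noteq> {}"
    and A: "A \<subseteq> unit_lift S" "finite A" "A \<noteq> {}" "inj_on (\<lambda>x. \<lfloor>real p ^ \<Lambda> * x\<rfloor>) A"
      "card A = card (cells p S \<Lambda>)"
begin

lemma representatives_unit: "A \<subseteq> {0..<1}"
  using A(1) by (auto simp: unit_lift_def)

text \<open>By \<open>tree_key_coarse\<close> the key depends only on the half-cell of level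
  \<open>l\<close>, and each occupied cell has two halves.\<close>

lemma tree_ent_le: "ent A (tree_key p A l) \<le> ln (2 * real (card (cells p S l)))"
proof -
  have "0 < p" using p by simp
  have "card (tree_key p A l ` A) \<le> card ((\<lambda>x. \<lfloor>2 * real p ^ l * x\<rfloor>) ` A)"
    by (rule card_image_factor[OF A(2)]) (rule tree_key_coarse[OF p A(2,3) representatives_unit])
  also have "\<dots> \<le> card ((\<lambda>(q, r). 2 * q + r) ` (cells p S l \<times> {0, 1}))"
  proof (intro card_mono finite_imageI finite_cartesian_product finite_cells \<open>0 < p\<close> image_subsetI)
    fix x assume "x \<in> A"
    then have c: "\<lfloor>real p ^ l * x\<rfloor> \<in> cells p S l" using A(1) by (auto simp: cells_def)
    define y where "y = real p ^ l * x"
    have "\<lfloor>2 * y\<rfloor> - 2 * \<lfloor>y\<rfloor> \<in> {0, 1}" by (simp; linarith)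
    then have "(\<lambda>(q, r). 2 * q + r) (\<lfloor>y\<rfloor>, \<lfloor>2 * y\<rfloor> - 2 * \<lfloor>y\<rfloor>) \<in> (\<lambda>(q, r). 2 * q
        + r) ` (cells p S l \<times> {0, 1})"
      using c unfolding y_def by (intro imageI SigmaI)
    then show "\<lfloor>2 * real p ^ l * x\<rfloor> \<in> (\<lambda>(q, r). 2 * q + r) ` (cells p S l \<times> {0, 1})"
      by (simp add: y_def mult.assoc)
  qed simp
  also have "\<dots> \<le> card (cells p S l \<times> {0, 1 :: int})"
    by (intro card_image_le finite_cartesian_product finite_cells \<open>0 < p\<close>) simp
  also have "\<dots> = 2 * card (cells p S l)" by (simp add: card_cartesian_product)
  finally have "ent A (tree_key p A l) \<le> ln (real (2 * card (cells p S l)))"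
    by (rule ent_le_ln_card[OF A(2,3)])
  then show ?thesis by simp
qed

text \<open>A class is shorter than a cell of level \<open>l\<close>, so it meets at most two of
  them. Inside a cell the representatives differ in their next \<open>\<Lambda> - l\<close> digits,
  and by invariance these form a cell of \<open>S\<close>. So all classes are small, and the entropy
  is large.\<close>

lemma tree_ent_ge:
  assumes "l \<le> \<Lambda>"
  shows "ln (real (card (cells p S \<Lambda>)) / (2 * real (card (cells p S (\<Lambda> - l)))))
      \<le> ent A (tree_key p A l)"
proof -
  have "0 < p" using p by simp
  have "card (fiber A (tree_key p A l) x) \<le> 2 * card (cells p S (\<Lambda> - l))" if "x \<in> A" for x
  proof -
    let ?C = "fiber A (tree_key p A l) x"
    have C: "?C \<subseteq> A" "finite ?C" using A(2) by (auto simp: fiber_def)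
    have two: "card ((\<lambda>x. \<lfloor>real p ^ l * x\<rfloor>) ` ?C) \<le> 2"
    proof (rule finite_int_card_le_2)
      fix q r assume "q \<in> (\<lambda>x. \<lfloor>real p ^ l * x\<rfloor>) ` ?C" "r \<in> (\<lambda>x. \<lfloor>real p ^ l * x\<rfloor>) ` ?C"
      then obtain y z where yz: "y \<in> ?C" "z \<in> ?C" "q = \<lfloor>real p ^ l * y\<rfloor>" "r = \<lfloor>real p ^ l * z\<rfloor>"
          by blast
      then have "\<bar>y - z\<bar> < 1 / real p ^ l"
        by (intro tree_key_diam[OF p A(2,3) representatives_unit]) (auto simp: fiber_def)
      then have "real p ^ l * \<bar>y - z\<bar> < 1" using \<open>0 < p\<close> by (simp add: field_simps)
      then have "\<bar>real p ^ l * y - real p ^ l * z\<bar> < 1"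
        by (simp add: right_diff_distrib[symmetric] abs_mult)
      then show "\<bar>q - r\<bar> \<le> 1" unfolding yz by linarith
    qed (use C in simp)
    have "card ?C = card ((\<lambda>x. \<lfloor>real p ^ (l + (\<Lambda> - l)) * x\<rfloor>) ` ?C)"
      using assms A(4) C(1) by (simp add: card_image inj_on_subset)
    also have "\<dots> \<le> card ((\<lambda>x. \<lfloor>real p ^ l * x\<rfloor>) ` ?C) * card (cells p S (\<Lambda> - l))"
      by (rule card_subcells_le[OF \<open>0 < p\<close> inv(1)]) (use C A(1) in \<open>auto simp: unit_lift_def\<close>)
    also have "\<dots> \<le> 2 * card (cells p S (\<Lambda> - l))" by (rule mult_le_mono1[OF two])
    finally show ?thesis .
  qed
  then have f: "real (card (fiber A (tree_key p A l) x)) \<le> 2 * real (card (cells p S (\<Lambda> - l)))"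
      if "x \<in> A" for x
    using that by (metis of_nat_le_iff of_nat_mult of_nat_numeral)
  have "0 < 2 * real (card (cells p S (\<Lambda> - l)))" using card_cells_pos[OF \<open>0 < p\<close> inv(2)] by simp
  from ent_ge[OF A(2,3) this f] show ?thesis by (simp add: A(5))
qed

end

text \<open>What \<open>tree_spread_sum_ge\<close> yields for \<open>b = h / 8\<close>: an entropy
  gain of at least \<open>h / 4\<close> per level, minus \<open>b\<close>, divided by
  \<open>ln (p / b)\<close>.\<close>

definition spread_rate :: "nat \<Rightarrow> real \<Rightarrow> real"
  where "spread_rate p h = (if h = 0 then 0 else (h / 8) / ln (8 * real p / h))"

lemma spread_rate_nonneg:
  assumes "2 \<le> p" "0 \<le> h" "h \<le> 1"
  shows "0 \<le> spread_rate p h"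
proof -
  have "1 \<le> 8 * real p / h" if "0 < h" using assms that by (simp add: field_simps)
  then show ?thesis using assms by (auto simp: spread_rate_def intro!: divide_nonneg_nonneg
      ln_ge_zero)
qed

text \<open>Resolving \<open>S\<close> at level \<open>2 * m + c\<close> makes every window of
  \<open>m\<close> levels starting at \<open>j + c\<close>, \<open>j < m\<close>, gain entropy
  linear in \<open>m\<close>, so a single \<open>A\<close> serves all scales \<open>j\<close>. The
  gap \<open>c\<close> between the scale of a digit and the scale of the coupled steps is fixed
  before \<open>m\<close>.\<close>

lemma exists_spread_measure:
  assumes p: "2 \<le> p" and inv: "mult_invariant p S" "S \<noteq> {}" and h: "0 < h" "h \<le> 1"
    and N: "\<And>k. real p powr (h * real k) \<le> real (card (cells p S k))"
  shows "\<exists>m0. \<forall>m\<ge>m0. \<exists>A\<subseteq>unit_lift S. finite A \<and> A \<noteq> {} \<and>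
    (\<forall>j<m. real m * spread_rate p h \<le> (\<Sum>t<m. avg A (tree_spread p A (j + c + t))))"
proof -
  have "0 < p" using p by simp
  define a where "a k = ln (real (card (cells p S k)))" for k
  have pos: "0 < real (card (cells p S k))" for k using card_cells_pos[OF \<open>0 < p\<close> inv(2)] by simp
  have sub: "a (j + k) \<le> a j + a k" for j k
  proof -
    have "real (card (cells p S (j + k))) \<le> real (card (cells p S j)) * real (card (cells p S k))"
      using card_cells_add[OF \<open>0 < p\<close> inv(1)] by (metis of_nat_le_iff of_nat_mult)
    then have "a (j + k) \<le> ln (real (card (cells p S j)) * real (card (cells p S k)))"
      unfolding a_def using pos by (intro ln_mono) auto
    also have "\<dots> = a j + a k" unfolding a_def using pos by (intro ln_mult_pos) auto
    finally show ?thesis .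
  qed
  have "ln 2 \<le> ln (real p)" using p by simp
  then have lnp: "1 / 2 \<le> ln (real p)" using ln2_ge_two_thirds by linarith
  have lower: "h * ln (real p) * real k \<le> a k" for k
  proof -
    have "ln (real p powr (h * real k)) \<le> a k"
      unfolding a_def using N[of k] \<open>0 < p\<close> by (intro ln_mono) (auto simp: pos)
    then show ?thesis using \<open>0 < p\<close> by (simp add: ln_powr mult_ac)
  qed
  \<comment> \<open>\<open>ln 4\<close> pays for the two factors 2 in \<open>tree_ent_le\<close> and
    \<open>tree_ent_ge\<close>.\<close>
  obtain m0 where m0: "\<And>m j. m0 \<le> m \<Longrightarrow> j \<le> m \<Longrightarrow>
      h * ln (real p) / 2 * real m \<le> a (2 * m + c) - a (m - j) - a (j + c) - ln 4"
    using subadditive_growth[of a "h * ln (real p)" c "ln 4", OF sub lower] lnp h by auto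
  show ?thesis
  proof (intro exI[of _ m0] allI impI)
    fix m assume "m0 \<le> m"
    define \<Lambda> where "\<Lambda> = 2 * m + c"
    obtain A where A: "A \<subseteq> unit_lift S" "finite A" "A \<noteq> {}" "inj_on (\<lambda>x. \<lfloor>real p ^ \<Lambda> * x\<rfloor>) A"
      "card A = card (cells p S \<Lambda>)"
      using exists_cell_representatives[OF \<open>0 < p\<close> inv(2)] by blast
    note unit = representatives_unit[OF p inv A]
    have "real m * spread_rate p h \<le> (\<Sum>t<m. avg A (tree_spread p A (j + c + t)))" if "j < m" for j
    proof -
      let ?l = "j + c"
      have "ln (real (card (cells p S \<Lambda>)) / (2 * real (card (cells p S (\<Lambda> - (?l + m))))))
          \<le> ent A (tree_key p A (?l + m))"
        using \<open>j < m\<close> by (intro tree_ent_ge[OF p inv A]) (simp add: \<Lambda>_def)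
      moreover have "\<Lambda> - (?l + m) = m - j" using \<open>j < m\<close> by (simp add: \<Lambda>_def)
      ultimately have u: "a \<Lambda> - a (m - j) - ln 2 \<le> ent A (tree_key p A (?l + m))"
        using pos by (simp add: ln_div ln_mult_pos a_def)
      have v: "ent A (tree_key p A ?l) \<le> ln 2 + a ?l"
        using tree_ent_le[OF p inv A, of ?l] pos by (simp add: ln_mult_pos a_def)
      have "ln (4::real) = ln 2 + ln 2" using ln_mult_pos[of 2 "2::real"] by simp
      then have "h * ln (real p) / 2 * real m \<le> ent A (tree_key p A (?l
          + m)) - ent A (tree_key p A ?l)"
        using m0[OF \<open>m0 \<le> m\<close>, of j] \<open>j < m\<close> u v unfolding \<Lambda>_def by linarith
      moreover have "h / 4 * real m \<le> h * ln (real p) / 2 * real m"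
        using lnp h by (intro mult_right_mono) auto
      moreover have "ent A (tree_key p A (?l + m)) - ent A (tree_key p A ?l) - real m * (h / 8)
          \<le> ln (real p / (h / 8)) * (\<Sum>t<m. avg A (tree_spread p A (?l + t)))"
        using h by (intro tree_spread_sum_ge[OF p A(2,3) unit]) auto
      ultimately have "real m * (h / 8) \<le> ln (8 * real p / h) * (\<Sum>t<m. avg A (tree_spread p A (?l
          + t)))"
        by (simp add: mult.commute)
      moreover have "0 < ln (8 * real p / h)" using h p
          by (intro ln_gt_zero) (simp add: field_simps)
      ultimately show ?thesis using h by (simp add: spread_rate_def field_simps)
    qed
    then show "\<exists>A\<subseteq>unit_lift S. finite A \<and> A \<noteq> {} \<and>
        (\<forall>j<m. real m * spread_rate p h \<le> (\<Sum>t<m. avg A (tree_spread p A (j + c + t))))"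
      using A by blast
  qed
qed

section \<open>Product spaces and random shifts\<close>

primrec outcomes :: "(nat \<Rightarrow> 'a set) \<Rightarrow> nat \<Rightarrow> 'a list set" where
  "outcomes B 0 = {[]}"
| "outcomes B (Suc k) = (\<lambda>(a, as). a # as) ` (B k \<times> outcomes B k)"

lemma finite_outcomes: "(\<And>k. finite (B k)) \<Longrightarrow> finite (outcomes B k)"
  by (induction k) auto

lemma outcomes_nonempty: "(\<And>k. B k \<noteq> {}) \<Longrightarrow> outcomes B k \<noteq> {}"
  by (induction k) auto

lemma walk_avg_outcomes:
  "walk_avg B y k F x = avg (outcomes B k) (\<lambda>\<omega>. F (x + (\<Sum>a\<leftarrow>\<omega>. y a)))"
proof (induction k arbitrary: x)
  case 0
  then show ?case by (simp add: avg_def)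
next
  case (Suc k)
  have inj: "inj_on (\<lambda>(a, as). a # as) (B k \<times> outcomes B k)" by (auto simp: inj_on_def)
  have "avg (outcomes B (Suc k)) (\<lambda>\<omega>. F (x + (\<Sum>a\<leftarrow>\<omega>. y a)))
      = (\<Sum>a\<in>B k. \<Sum>as\<in>outcomes B k. F (x + y a + (\<Sum>a\<leftarrow>as. y a))) / (real (card (B k)) * real (card
          (outcomes B k)))"
    unfolding avg_def outcomes.simps sum.reindex[OF inj] card_image[OF inj] card_cartesian_product
    by (simp add: sum.cartesian_product split_def add.assoc)
  also have "\<dots> = avg (B k) (\<lambda>a. avg (outcomes B k) (\<lambda>\<omega>. F (x + y a + (\<Sum>a\<leftarrow>\<omega>. y a))))"
    by (simp add: avg_def sum_divide_distrib[symmetric] mult.commute)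
  finally show ?case by (simp add: Suc)
qed

definition shifted_points :: "nat \<Rightarrow> real set \<Rightarrow> (nat \<times> real) set"
  where "shifted_points m A = {..<m} \<times> A"

definition dilate :: "nat \<Rightarrow> nat \<times> real \<Rightarrow> real"
  where "dilate p a = real p ^ fst a * snd a"

text \<open>The shift is part of the key, so coupled points are multiplied by the same power of
  \<open>p\<close>. The tree level \<open>l + t\<close> compensates for it: after dilation by
  \<open>p ^ t\<close> every class has length at most \<open>1 / p ^ l\<close>.\<close>

definition shifted_key :: "nat \<Rightarrow> real set \<Rightarrow> nat \<Rightarrow> nat \<times> real \<Rightarrow> nat \<times> int list"
  where "shifted_key p A l a = (fst a, tree_key p A (l + fst a) (snd a))"

lemma pair_avg_shifted:
  assumes "finite A"
  shows "pair_avg (shifted_points m A) (shifted_key p A l) G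
    = avg {..<m} (\<lambda>t. pair_avg A (tree_key p A (l + t)) (\<lambda>x x'. G (t, x) (t, x')))"
proof -
  have fib: "fiber (shifted_points m A) (shifted_key p A l) (t, x) = {t} \<times> fiber A (tree_key p A (l
      + t)) x"
    if "t < m" for t x
    using that by (auto simp: fiber_def shifted_points_def shifted_key_def)
  have "avg (fiber (shifted_points m A) (shifted_key p A l) (t, x)) (G (t, x))
      = avg (fiber A (tree_key p A (l + t)) x) (\<lambda>x'. G (t, x) (t, x'))" if "t < m" for t x
  proof -
    have "{t} \<times> fiber A (tree_key p A (l + t)) x = Pair t ` fiber A (tree_key p A (l + t)) x"
        by auto
    moreover have "inj_on (Pair t) (fiber A (tree_key p A (l + t)) x)" by (simp add: inj_on_def)
    ultimately show ?thesis
      unfolding fib[OF that] avg_def by (simp add: sum.reindex card_image)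
  qed
  then have "(\<Sum>a\<in>shifted_points m A. avg (fiber (shifted_points m A) (shifted_key p A l) a) (G a))
      = (\<Sum>t<m. \<Sum>x\<in>A. avg (fiber A (tree_key p A (l + t)) x) (\<lambda>x'. G (t, x) (t, x')))"
    unfolding shifted_points_def by (subst sum.cartesian_product) (auto intro!: sum.cong)
  then have "pair_avg (shifted_points m A) (shifted_key p A l) G
      = (\<Sum>t<m. \<Sum>x\<in>A. avg (fiber A (tree_key p A (l
          + t)) x) (\<lambda>x'. G (t, x) (t, x'))) / real (m * card A)"
    by (subst avg_def) (simp add: shifted_points_def card_cartesian_product)
  also have "\<dots> = avg {..<m} (\<lambda>t. pair_avg A (tree_key p A (l + t)) (\<lambda>x x'. G (t, x) (t, x')))"
    unfolding avg_def[of "{..<m}"] avg_def[of A]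
        by (simp add: sum_divide_distrib[symmetric] mult.commute)
  finally show ?thesis .
qed

context
  fixes p m l :: nat and A :: "real set"
  assumes p: "2 \<le> p" and fin: "finite A" "A \<noteq> {}" and sub: "A \<subseteq> {0..<1}" and m: "0 < m"
begin

lemma dilate_diff_le:
  assumes "a \<in> shifted_points m A" "a' \<in> fiber (shifted_points m A) (shifted_key p A l) a"
  shows "\<bar>dilate p a' - dilate p a\<bar> \<le> 1 / real p ^ l"
proof -
  obtain t x x' where a: "a = (t, x)" "a' = (t, x')" "x \<in> A" "x' \<in> A" "tree_key p A (l + t) x'
      = tree_key p A (l + t) x"
    using assms by (cases a, cases a') (auto simp: shifted_points_def fiber_def shifted_key_def)
  have "\<bar>x' - x\<bar> \<le> 1 / real p ^ (l + t)" using tree_key_diam[OF p fin sub a(4,3,5)] by simp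
  then have "real p ^ t * \<bar>x' - x\<bar> \<le> real p ^ t * (1 / real p ^ (l + t))"
      by (intro mult_left_mono) auto
  also have "\<dots> = 1 / real p ^ l" using p by (simp add: power_add)
  also have "real p ^ t * \<bar>x' - x\<bar> = \<bar>dilate p a' - dilate p a\<bar>"
    by (simp add: dilate_def a right_diff_distrib[symmetric] abs_mult)
  finally show ?thesis .
qed

text \<open>Dilation by \<open>p ^ t\<close> brings the variance bound of tree level
  \<open>l + t\<close> back to scale \<open>p ^ -l\<close>, with the same constant for all
  \<open>t\<close>. The random shift thereby replaces the spread at a single level, which may
  vanish, by the mean over a window of \<open>m\<close> levels.\<close>

lemma pair_avg_dilate_ge:
  assumes "real m * \<kappa> \<le> (\<Sum>t<m. avg A (tree_spread p A (l + t)))"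
  shows "(1 / (4 * real p ^ Suc l))\<^sup>2 * \<kappa>
    \<le> pair_avg (shifted_points m A) (shifted_key p A l) (\<lambda>a a'. (dilate p a' - dilate p a)\<^sup>2)"
proof -
  have "\<kappa> \<le> avg {..<m} (\<lambda>t. avg A (tree_spread p A (l + t)))"
    using assms m by (simp add: avg_def[of "{..<m}"] field_simps)
  then have "(1 / (4 * real p ^ Suc l))\<^sup>2 * \<kappa>
      \<le> (1 / (4 * real p ^ Suc l))\<^sup>2 * avg {..<m} (\<lambda>t. avg A (tree_spread p A (l + t)))"
    by (intro mult_left_mono) auto
  also have "\<dots> = avg {..<m} (\<lambda>t. (1 / (4 * real p ^ Suc l))\<^sup>2 * avg A (tree_spread p A (l + t)))"
    by (rule avg_cmult[symmetric])
  also have "\<dots> \<le> avg {..<m} (\<lambda>t. pair_avg A (tree_key p A (l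
      + t)) (\<lambda>x x'. (dilate p (t, x') - dilate p (t, x))\<^sup>2))"
  proof (rule avg_mono)
    fix t
    have "(1 / (4 * real p ^ Suc l))\<^sup>2 * avg A (tree_spread p A (l + t))
        = (real p ^ t)\<^sup>2 * ((1 / (4 * real p ^ Suc (l + t)))\<^sup>2 * avg A (tree_spread p A (l + t)))"
      using p by (simp add: power_add power_divide power_mult_distrib)
    also have "\<dots> \<le> (real p ^ t)\<^sup>2 * pair_avg A (tree_key p A (l + t)) (\<lambda>x x'. (x' - x)\<^sup>2)"
      by (intro mult_left_mono tree_pair_spread[OF p fin sub]) simp
    also have "\<dots> = pair_avg A (tree_key p A (l
        + t)) (\<lambda>x x'. (dilate p (t, x') - dilate p (t, x))\<^sup>2)"
      unfolding avg_cmult[symmetric]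
      by (intro avg_cong) (simp add: dilate_def right_diff_distrib[symmetric] power_mult_distrib)
    finally show "(1 / (4 * real p ^ Suc l))\<^sup>2 * avg A (tree_spread p A (l + t))
        \<le> pair_avg A (tree_key p A (l + t)) (\<lambda>x x'. (dilate p (t, x') - dilate p (t, x))\<^sup>2)" .
  qed
  also have "\<dots> = pair_avg (shifted_points m A) (shifted_key p A l) (\<lambda>a a'. (dilate p a' - dilate p
      a)\<^sup>2)"
    by (rule pair_avg_shifted[OF fin(1), symmetric])
  finally show ?thesis .
qed

text \<open>The angles are at most 1, so \<open>cos_le_quadratic\<close> applies. Its factor
  \<open>1 / 4\<close> and the \<open>(1 / 4)\<^sup>2\<close> of the variance bound combine to
  \<open>(1 / 8)\<^sup>2\<close>.\<close>

lemma pair_avg_cos_dilate_le: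
  assumes \<kappa>: "real m * \<kappa> \<le> (\<Sum>t<m. avg A (tree_spread p A (l + t)))"
    and \<theta>: "0 \<le> \<theta>" "\<theta> \<le> real p ^ l"
  shows "pair_avg (shifted_points m A) (shifted_key p A l) (\<lambda>a a'. cos (\<theta> * (dilate p a' - dilate p
      a)))
    \<le> exp (- (\<theta> / (8 * real p ^ Suc l))\<^sup>2 * \<kappa>)"
proof -
  let ?E = "pair_avg (shifted_points m A) (shifted_key p A l)"
  have B: "finite (shifted_points m A)" "shifted_points m A \<noteq> {}"
    using fin m by (auto simp: shifted_points_def)
  have "?E (\<lambda>a a'. cos (\<theta> * (dilate p a' - dilate p a)))
      \<le> ?E (\<lambda>a a'. 1 - (\<theta>\<^sup>2 / 4) * (dilate p a' - dilate p a)\<^sup>2)"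
  proof (intro avg_mono)
    fix a a' assume a: "a \<in> shifted_points m A"
        "a' \<in> fiber (shifted_points m A) (shifted_key p A l) a"
    have "\<bar>\<theta> * (dilate p a' - dilate p a)\<bar> = \<theta> * \<bar>dilate p a' - dilate p a\<bar>" using \<theta>
        by (simp add: abs_mult)
    also have "\<dots> \<le> real p ^ l * (1 / real p ^ l)"
      by (intro mult_mono \<theta> dilate_diff_le a) auto
    also have "\<dots> = 1" using p by simp
    finally show "cos (\<theta> * (dilate p a' - dilate p a))
        \<le> 1 - (\<theta>\<^sup>2 / 4) * (dilate p a' - dilate p a)\<^sup>2"
      using cos_le_quadratic[of "\<theta> * (dilate p a' - dilate p a)"] by (simp add: power_mult_distrib)
  qed
  also have "\<dots> = 1 - (\<theta>\<^sup>2 / 4) * ?E (\<lambda>a a'. (dilate p a' - dilate p a)\<^sup>2)"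
    by (simp only: avg_diff avg_cmult pair_avg_fst[OF B(1)] avg_const[OF B])
  also have "\<dots> \<le> 1 - (\<theta>\<^sup>2 / 4) * ((1 / (4 * real p ^ Suc l))\<^sup>2 * \<kappa>)"
    by (intro diff_left_mono mult_left_mono pair_avg_dilate_ge \<kappa>) simp
  also have "\<dots> = 1 + (- (\<theta> / (8 * real p ^ Suc l))\<^sup>2 * \<kappa>)"
      by (simp add: power_divide power_mult_distrib)
  also have "\<dots> \<le> exp (- (\<theta> / (8 * real p ^ Suc l))\<^sup>2 * \<kappa>)" by (rule exp_ge_add_one_self)
  finally show ?thesis .
qed

end


section \<open>Dimension of sumsets\<close>

lemma to_circle_outcome_mem:
  assumes "\<And>k. mult_invariant p (S k)" "\<And>k. A k \<subseteq> unit_lift (S k)"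
    and "\<omega> \<in> outcomes (\<lambda>k. shifted_points m (A k)) n"
  shows "to_circle (\<Sum>a\<leftarrow>\<omega>. dilate p a) \<in> sumset S n"
  using assms(3)
proof (induction n arbitrary: \<omega>)
  case 0
  have "to_circle 0 = 0" by transfer simp
  then show ?case using 0 by (simp add: sumset_def)
next
  case (Suc n)
  then obtain t x as where as: "\<omega> = (t, x) # as" "x \<in> A n"
      "as \<in> outcomes (\<lambda>k. shifted_points m (A k)) n"
    by (auto simp: shifted_points_def)
  have "to_circle (\<Sum>a\<leftarrow>\<omega>. dilate p a) = to_circle (\<Sum>a\<leftarrow>as. dilate p a) + to_circle (real p ^ t * x)"
    by (simp add: as(1) dilate_def to_circle_add add.commute)
  moreover have "to_circle (real p ^ t * x) \<in> S n"
    using as(2) assms(2)[of n] by (intro to_circle_power_mem assms(1)) (auto simp: unit_lift_def)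
  ultimately show ?case unfolding sumset_Suc using Suc.IH[OF as(3)] by blast
qed

text \<open>The bound of \<open>walk_avg_shift\<close> for \<open>C = 2 * I * p ^ Suc j\<close>,
  \<open>r = 1 / p ^ (j + c)\<close>, \<open>L = \<Lambda> / p ^ j\<close> and
  \<open>\<theta> = 1 / L\<close>. All powers of \<open>p ^ j\<close> cancel, so the error is the
  same at every level; \<open>E\<close> is the total mean spread of the summands.\<close>

definition shift_error :: "nat \<Rightarrow> nat \<Rightarrow> nat \<Rightarrow> nat \<Rightarrow> real \<Rightarrow> real"
  where "shift_error p I c \<Lambda> E = 2 * real I * real p / real p ^ c + 2 / real \<Lambda>
    + 4 * exp (- (1 / (8 * real p ^ Suc c * real \<Lambda>))\<^sup>2 * E)"

text \<open>The entropies of the \<open>m\<close> digits of the real sum \<open>Z\<close> telescope.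
  As \<open>Z\<close> is not reduced modulo 1, the integer part is split off: given it, the level
  \<open>m\<close> cell of \<open>Z\<close> takes at most as many values as the sumset has cells, so
  the entropy gained is at most the logarithm of their number.\<close>

lemma card_cells_sumset_ge:
  assumes p: "2 \<le> p" and inv: "\<And>k. mult_invariant p (S k)" "\<And>k. S k \<noteq> {}"
    and A: "\<And>k. A k \<subseteq> unit_lift (S k)" "\<And>k. finite (A k)" "\<And>k. A k \<noteq> {}"
    and \<kappa>: "\<And>k j. j < m \<Longrightarrow> real m * \<kappa> k \<le> (\<Sum>t<m. avg (A k) (tree_spread p (A k) (j + c + t)))"
    and "0 < m" "0 < I" "2 \<le> \<Lambda>"
  shows "real m * (ln (real p) - (real p)\<^sup>2 * (3 * shift_error p I c \<Lambda> (\<Sum>k<n. \<kappa> k) + 2 / real I))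
    \<le> ln (real (card (cells p (sumset S n) m)))"
proof -
  have "0 < p" using p by simp
  define B where "B k = shifted_points m (A k)" for k
  define \<Omega> where "\<Omega> = outcomes B n"
  define Z where "Z \<omega> = (\<Sum>a\<leftarrow>\<omega>. dilate p a)" for \<omega>
  define g where "g = (ln (real p) - (real p)\<^sup>2 * (3 * shift_error p I c \<Lambda> (\<Sum>k<n. \<kappa> k)
      + 2 / real I))"
  have finB: "finite (B k)" and neB: "B k \<noteq> {}" for k
    using A(2,3) \<open>0 < m\<close> by (auto simp: B_def shifted_points_def)
  have \<Omega>: "finite \<Omega>" "\<Omega> \<noteq> {}"
    unfolding \<Omega>_def using finite_outcomes[of B, OF finB] outcomes_nonempty[of B, OF neB] by auto
  have A01: "A k \<subseteq> {0..<1}" for k using A(1)[of k] by (auto simp: unit_lift_def)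
  have mem: "to_circle (Z \<omega>) \<in> sumset S n" if "\<omega> \<in> \<Omega>" for \<omega>
  proof -
    have "B = (\<lambda>k. shifted_points m (A k))" by (simp add: B_def fun_eq_iff)
    then show ?thesis
      using that to_circle_outcome_mem[of p S A \<omega> m n, OF inv(1) A(1)] by (simp add: \<Omega>_def Z_def)
  qed
  define D where "D j = ent \<Omega> (\<lambda>\<omega>. \<lfloor>real p ^ j * Z \<omega>\<rfloor>)" for j
  have step: "g \<le> D (Suc j) - D j" if "j < m" for j
  proof -
    have SI: "\<bar>avg \<Omega> (\<lambda>\<omega>. F (real p ^ Suc j * Z \<omega>)) - avg \<Omega> (\<lambda>\<omega>. F (real p ^ Suc j * Z \<omega> + d))\<bar>
        \<le> shift_error p I c \<Lambda> (\<Sum>k<n. \<kappa> k)"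
      if F: "\<And>x. \<bar>F x\<bar> \<le> 1" "\<And>x x'. \<bar>F x - F x'\<bar> \<le> 2 * real I * \<bar>x - x'\<bar>" and d: "0 \<le> d" "d
          \<le> real p" for F d
    proof -
      \<comment> \<open>\<open>F\<close> lives on the magnified line, where the cells of level
        \<open>Suc j\<close> have length 1. Undoing the magnification turns \<open>d \<le> p\<close>
        into \<open>d' \<le> 1 / p ^ j\<close>.\<close>
      define F' where "F' z = F (real p ^ Suc j * z)" for z
      define d' where "d' = d / real p ^ Suc j"
      define l where "l = j + c"
      define L where "L = real \<Lambda> / real p ^ j"
      define r where "r = 1 / real p ^ l"
      define \<theta> where "\<theta> = 1 / L"
      define w where "w = (1 / (8 * real p ^ Suc c * real \<Lambda>))\<^sup>2"
      have "0 < L" using \<open>0 < p\<close> \<open>2 \<le> \<Lambda>\<close> by (simp add: L_def)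
      have "0 \<le> r" by (simp add: r_def)
      have rL: "r \<le> L / 2"
      proof -
        have "1 / real p ^ l \<le> 1 / real p ^ j"
          unfolding l_def using \<open>0 < p\<close> by (intro divide_left_mono power_increasing) auto
        also have "\<dots> \<le> (real \<Lambda> / 2) / real p ^ j" using \<open>2 \<le> \<Lambda>\<close> by (intro divide_right_mono) auto
        finally show ?thesis by (simp add: r_def L_def)
      qed
      have \<theta>: "0 \<le> \<theta>" "\<theta> \<le> real p ^ l" "\<theta> * (L / 2 + r) \<le> 1"
      proof -
        show "0 \<le> \<theta>" using \<open>0 < L\<close> by (simp add: \<theta>_def)
        have "\<theta> = real p ^ j / real \<Lambda>" by (simp add: \<theta>_def L_def)
        also have "\<dots> \<le> real p ^ j / 1" using \<open>2 \<le> \<Lambda>\<close> by (intro divide_left_mono) auto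
        also have "\<dots> \<le> real p ^ l" unfolding l_def using \<open>0 < p\<close> by (simp add: power_increasing)
        finally show "\<theta> \<le> real p ^ l" .
        have "\<theta> * (L / 2 + r) \<le> \<theta> * L" using rL \<open>0 \<le> \<theta>\<close> by (intro mult_left_mono) auto
        then show "\<theta> * (L / 2 + r) \<le> 1" using \<open>0 < L\<close> by (simp add: \<theta>_def)
      qed
      have w: "(\<theta> / (8 * real p ^ Suc l))\<^sup>2 = w"
        using \<open>0 < p\<close> by (simp add: w_def \<theta>_def L_def l_def power_add field_simps)
      have F'lip: "\<bar>F' x - F' x'\<bar> \<le> (2 * real I * real p ^ Suc j) * \<bar>x - x'\<bar>" for x x'
      proof -
        have "\<bar>F' x - F' x'\<bar> \<le> 2 * real I * \<bar>real p ^ Suc j * x - real p ^ Suc j * x'\<bar>"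
          unfolding F'_def by (rule F(2))
        also have "\<bar>real p ^ Suc j * x - real p ^ Suc j * x'\<bar> = real p ^ Suc j * \<bar>x - x'\<bar>"
          by (simp add: right_diff_distrib[symmetric] abs_mult)
        finally show ?thesis by (simp only: mult.assoc)
      qed
      have d': "0 \<le> d'" "d' \<le> 1 / real p ^ j"
        using d \<open>0 < p\<close> by (simp_all add: d'_def field_simps)
      have dL: "d' \<le> L + r"
      proof -
        have "1 / real p ^ j \<le> real \<Lambda> / real p ^ j" using \<open>2 \<le> \<Lambda>\<close> by (intro divide_right_mono) auto
        then show ?thesis using d' \<open>0 \<le> r\<close> by (simp add: L_def)
      qed
      have "\<bar>walk_avg B (dilate p) n F' 0 - walk_avg B (dilate p) n F' (0 + d')\<bar>
        \<le> (2 * real I * real p ^ Suc j) * r + 2 * d' / L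
            + 4 * (\<Prod>k<n. exp (- w * \<kappa> k)) * cos (\<theta> * (d' - L / 2))"
      proof (rule walk_avg_shift[where f = "\<lambda>k. shifted_key p (A k) l", OF finB neB _ F'lip])
        show "\<bar>F' x\<bar> \<le> 1" for x unfolding F'_def by (rule F(1))
        show "\<bar>dilate p a' - dilate p a\<bar> \<le> r"
            if "a \<in> B k" "a' \<in> fiber (B k) (shifted_key p (A k) l) a" for k a a'
          using that unfolding B_def r_def by (rule dilate_diff_le[OF p A(2,3) A01 \<open>0 < m\<close>])
        show "pair_avg (B k) (shifted_key p (A k) l) (\<lambda>a a'. cos (\<theta> * (dilate p a' - dilate p a)))
            \<le> exp (- w * \<kappa> k)" for k
          using pair_avg_cos_dilate_le[OF p A(2,3) A01 \<open>0 < m\<close> \<kappa>[OF \<open>j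
              < m\<close>, of k, folded l_def] \<theta>(1,2)]
          unfolding B_def w .
      qed (use \<open>0 \<le> r\<close> \<open>0 < L\<close> \<theta> d' dL in auto)
      also have "(2 * real I * real p ^ Suc j) * r = 2 * real I * real p / real p ^ c"
        using \<open>0 < p\<close> by (simp add: r_def l_def power_add field_simps)
      also have "2 * d' / L \<le> 2 / real \<Lambda>"
      proof -
        have "2 * d' / L \<le> 2 * (1 / real p ^ j) / L" using d' \<open>0 < L\<close>
            by (intro divide_right_mono mult_left_mono) auto
        also have "\<dots> = 2 / real \<Lambda>" using \<open>0 < p\<close> by (simp add: L_def)
        finally show ?thesis .
      qed
      also have "(\<Prod>k<n. exp (- w * \<kappa> k)) = exp (- w * (\<Sum>k<n. \<kappa> k))"
        by (simp add: exp_sum sum_distrib_left)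
      also have "4 * exp (- w * (\<Sum>k<n. \<kappa> k)) * cos (\<theta> * (d' - L / 2))
          \<le> 4 * exp (- w * (\<Sum>k<n. \<kappa> k)) * 1"
        by (intro mult_left_mono) auto
      finally have "\<bar>walk_avg B (dilate p) n F' 0 - walk_avg B (dilate p) n F' (0 + d')\<bar>
          \<le> shift_error p I c \<Lambda> (\<Sum>k<n. \<kappa> k)"
        by (simp add: shift_error_def w_def)
      then show ?thesis
        unfolding walk_avg_outcomes \<Omega>_def[symmetric] Z_def[symmetric] F'_def
        using \<open>0 < p\<close> by (simp add: distrib_left d'_def add.commute)
    qed
    have "ln (real p) - (real p)\<^sup>2 * (3 * shift_error p I c \<Lambda> (\<Sum>k<n. \<kappa> k) + 2 / real I)
        \<le> ent \<Omega> (\<lambda>\<omega>. \<lfloor>real p ^ Suc j * Z \<omega>\<rfloor>) - ent \<Omega> (\<lambda>\<omega>. \<lfloor>real p ^ Suc j * Z \<omega>\<rfloor> div int p)"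
      by (rule ent_digit_ge[OF \<Omega> \<open>0 < p\<close> \<open>0 < I\<close> SI])
    moreover have "\<lfloor>real p ^ Suc j * Z \<omega>\<rfloor> div int p = \<lfloor>real p ^ j * Z \<omega>\<rfloor>" for \<omega>
      using floor_divide_real_eq_div[of "int p" "real p ^ Suc j * Z \<omega>"] \<open>0 < p\<close> by simp
    ultimately show ?thesis unfolding g_def D_def by simp
  qed
  have "real j * g \<le> D j - D 0" if "j \<le> m" for j
    using that
  proof (induction j)
    case (Suc j)
    then show ?case using step[of j] by (simp add: distrib_right)
  qed simp
  then have "real m * g \<le> D m - D 0" by simp
  also have "D m \<le> D 0 + ln (real (card (cells p (sumset S n) m)))"
    unfolding D_def
  proof (rule ent_refine_le[OF \<Omega>])
    fix \<omega> \<omega>' assume "\<lfloor>real p ^ m * Z \<omega>\<rfloor> = \<lfloor>real p ^ m * Z \<omega>'\<rfloor>"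
    moreover have "\<lfloor>Z \<omega>\<rfloor> = \<lfloor>real p ^ m * Z \<omega>\<rfloor> div int (p ^ m)" for \<omega>
      using floor_divide_real_eq_div[of "int (p ^ m)" "real p ^ m * Z \<omega>"] \<open>0 < p\<close> by simp
    ultimately show "\<lfloor>real p ^ 0 * Z \<omega>\<rfloor> = \<lfloor>real p ^ 0 * Z \<omega>'\<rfloor>" by simp
  next
    fix \<omega> assume "\<omega> \<in> \<Omega>"
    let ?X = "Z ` fiber \<Omega> (\<lambda>\<omega>. \<lfloor>real p ^ 0 * Z \<omega>\<rfloor>) \<omega>"
    have X: "(\<lambda>x. \<lfloor>real p ^ 0 * x\<rfloor>) ` ?X \<subseteq> {\<lfloor>Z \<omega>\<rfloor>}" by (auto simp: fiber_def)
    have "card ((\<lambda>x. \<lfloor>real p ^ (0 + m) * x\<rfloor>) ` ?X)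
        \<le> card ((\<lambda>x. \<lfloor>real p ^ 0 * x\<rfloor>) ` ?X) * card (cells p (sumset S n) m)"
    proof (rule card_subcells_le[OF \<open>0 < p\<close> mult_invariant_sumset[OF inv(1)]])
      fix x assume "x \<in> ?X"
      then obtain \<omega>' where "\<omega>' \<in> \<Omega>" "x = Z \<omega>'" by (auto simp: fiber_def)
      then show "to_circle x \<in> sumset S n" using mem by simp
    qed (rule finite_subset[OF X], simp)
    also have "\<dots> \<le> 1 * card (cells p (sumset S n) m)"
      using card_mono[OF _ X] by (intro mult_le_mono1) simp
    finally show "card ((\<lambda>\<omega>. \<lfloor>real p ^ m * Z \<omega>\<rfloor>) ` fiber \<Omega> (\<lambda>\<omega>. \<lfloor>real p ^ 0 * Z \<omega>\<rfloor>) \<omega>)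
        \<le> card (cells p (sumset S n) m)"
      by (simp add: image_image)
  next
    obtain \<omega> where "\<omega> \<in> \<Omega>" using \<Omega>(2) by blast
    then have "to_circle (Z \<omega>) \<in> sumset S n" by (rule mem)
    then show "0 < card (cells p (sumset S n) m)" using \<open>0 < p\<close> by (intro card_cells_pos) auto
  qed
  finally show ?thesis by (simp add: g_def)
qed

text \<open>Each of the four terms gets \<open>\<epsilon> / 4\<close>. The gap \<open>c\<close> must
  be chosen after \<open>I\<close>, the Lipschitz constant of the cutoff, and \<open>K\<close> last,
  because the contraction rate \<open>w\<close> depends on \<open>c\<close> and
  \<open>\<Lambda>\<close>.\<close>

lemma exists_shift_error_small:
  assumes p: "2 \<le> p" and "0 < \<epsilon>"
  shows "\<exists>I c \<Lambda> K. 0 < I \<and> 2 \<le> \<Lambda> \<and>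
    (\<forall>E\<ge>K. (real p)\<^sup>2 * (3 * shift_error p I c \<Lambda> E + 2 / real I) \<le> \<epsilon>)"
proof -
  define P where "P = (real p)\<^sup>2"
  have P: "0 < P" using p by (simp add: P_def)
  obtain I :: nat where I: "8 * P / \<epsilon> < real I" using reals_Archimedean2 by blast
  obtain \<Lambda> :: nat where \<Lambda>: "max 2 (24 * P / \<epsilon>) < real \<Lambda>" using reals_Archimedean2 by blast
  obtain c where c: "24 * P * real I * real p / \<epsilon> < real p ^ c"
    using real_arch_pow[of "real p"] p by auto
  define w where "w = (1 / (8 * real p ^ Suc c * real \<Lambda>))\<^sup>2"
  have I0: "0 < real I" using I P \<open>0 < \<epsilon>\<close>
      by (meson divide_pos_pos less_trans mult_pos_pos zero_less_numeral)
  have \<Lambda>0: "2 < real \<Lambda>" using \<Lambda> by simp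
  have w: "0 < w" unfolding w_def using p \<Lambda>0 by simp
  define K where "K = ln (48 * P / \<epsilon>) / w"
  have "P * (3 * shift_error p I c \<Lambda> E + 2 / real I) \<le> \<epsilon>" if "K \<le> E" for E
  proof -
    have a: "P * (2 / real I) \<le> \<epsilon> / 4" using I I0 \<open>0 < \<epsilon>\<close> by (simp add: field_simps)
    have b: "P * (3 * (2 / real \<Lambda>)) \<le> \<epsilon> / 4"
    proof -
      have "24 * P / \<epsilon> < real \<Lambda>" using \<Lambda> by simp
      then show ?thesis using \<Lambda>0 \<open>0 < \<epsilon>\<close> by (simp add: field_simps)
    qed
    have pc: "0 < real p ^ c" using p by simp
    have d: "P * (3 * (2 * real I * real p / real p ^ c)) \<le> \<epsilon> / 4"
    proof -
      have "24 * P * real I * real p < real p ^ c * \<epsilon>" using c \<open>0 < \<epsilon>\<close>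
          by (simp add: pos_divide_less_eq)
      then have "P * 6 * real I * real p \<le> \<epsilon> / 4 * real p ^ c" by (simp add: mult_ac)
      then show ?thesis using pc by (simp add: pos_divide_le_eq mult_ac)
    qed
    have e: "P * (3 * (4 * exp (- w * E))) \<le> \<epsilon> / 4"
    proof -
      have "exp (- w * E) \<le> exp (- w * K)" using that w by simp
      also have "- w * K = - ln (48 * P / \<epsilon>)" using w by (simp add: K_def)
      also have "exp \<dots> = \<epsilon> / (48 * P)" using P \<open>0 < \<epsilon>\<close> by (simp add: exp_minus)
      finally have "P * (3 * (4 * exp (- w * E))) \<le> P * (3 * (4 * (\<epsilon> / (48 * P))))"
        using P by (intro mult_left_mono) auto
      then show ?thesis using P by simp
    qed
    have "P * (3 * shift_error p I c \<Lambda> E + 2 / real I)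
        = P * (3 * (2 * real I * real p / real p ^ c)) + P * (3 * (2 / real \<Lambda>))
          + P * (3 * (4 * exp (- w * E))) + P * (2 / real I)"
      unfolding shift_error_def w_def[symmetric] by (simp only: distrib_left add.assoc)
    then show ?thesis using a b d e by linarith
  qed
  moreover have "0 < I" "2 \<le> \<Lambda>" using I0 \<Lambda>0 by simp_all
  ultimately show ?thesis unfolding P_def by blast
qed

text \<open>\<open>K\<close> is fixed before \<open>n\<close>, while the threshold \<open>M\<close>
  for the level may depend on \<open>n\<close>: it dominates the thresholds of the first
  \<open>n\<close> sets. This is harmless, since a dimension bound only needs counts at large
  levels.\<close>

lemma hausdorff_dim_sumset_ge:
  assumes p: "2 \<le> p" and inv: "\<And>k. mult_invariant p (S k)" "\<And>k. S k \<noteq> {}" and cl: "\<And>k. closed (S k)"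
    and h: "\<And>k. 0 \<le> h k" "\<And>k. h k \<le> 1"
    and N: "\<And>k j. 0 < h k \<Longrightarrow> real p powr (h k * real j) \<le> real (card (cells p (S k) j))"
    and "0 < \<epsilon>"
  shows "\<exists>K. \<forall>n. K \<le> (\<Sum>k<n. spread_rate p (h k)) \<longrightarrow> ennreal (1 - \<epsilon>) \<le> hausdorff_dim (sumset S n)"
proof -
  have "0 < p" using p by simp
  have lnp: "0 < ln (real p)" using p by simp
  obtain I c \<Lambda> K where par: "0 < I" "2 \<le> \<Lambda>"
    "\<And>E. K \<le> E \<Longrightarrow> (real p)\<^sup>2 * (3 * shift_error p I c \<Lambda> E + 2 / real I) \<le> \<epsilon> * ln (real p)"
    using exists_shift_error_small[OF p, of "\<epsilon> * ln (real p)"] \<open>0 < \<epsilon>\<close> lnp by (metis mult_pos_pos)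
  show ?thesis
  proof (intro exI[of _ K] allI impI)
    fix n assume K: "K \<le> (\<Sum>k<n. spread_rate p (h k))"
    \<comment> \<open>Sets must be chosen for all \<open>k\<close>. Beyond \<open>n\<close>, rate 0
      imposes no condition on \<open>m\<close>, and \<open>triv\<close> supplies them.\<close>
    define \<kappa> where "\<kappa> k = (if k < n then spread_rate p (h k) else 0)" for k
    have triv: "\<exists>A\<subseteq>unit_lift (S k). finite A \<and> A \<noteq> {} \<and>
        (\<forall>j<m. real m * 0 \<le> (\<Sum>t<m. avg A (tree_spread p A (j + c + t))))" for k m
    proof -
      obtain A where A: "A \<subseteq> unit_lift (S k)" "finite A" "A \<noteq> {}"
        using exists_cell_representatives[OF \<open>0 < p\<close> inv(2)[of k]] by blast
      have "A \<subseteq> {0..<1}" using A(1) by (auto simp: unit_lift_def)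
      then have "0 \<le> (\<Sum>t<m. avg A (tree_spread p A (j + c + t)))" for j
        by (intro sum_nonneg avg_nonneg tree_spread_nonneg[OF p A(2,3)])
      then show ?thesis using A by auto
    qed
    have "\<forall>k. \<exists>m0. \<forall>m\<ge>m0. \<exists>A\<subseteq>unit_lift (S k). finite A \<and> A \<noteq> {} \<and>
        (\<forall>j<m. real m * spread_rate p (h k) \<le> (\<Sum>t<m. avg A (tree_spread p A (j + c + t))))"
    proof
      fix k
      show "\<exists>m0. \<forall>m\<ge>m0. \<exists>A\<subseteq>unit_lift (S k). finite A \<and> A \<noteq> {} \<and>
        (\<forall>j<m. real m * spread_rate p (h k) \<le> (\<Sum>t<m. avg A (tree_spread p A (j + c + t))))"
      proof (cases "h k = 0")
        case True
        then have "spread_rate p (h k) = 0" by (simp add: spread_rate_def)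
        then show ?thesis using triv[of k] by metis
      next
        case False
        then have "0 < h k" using h(1)[of k] by simp
        from exists_spread_measure[OF p inv this h(2) N[OF this]] show ?thesis .
      qed
    qed
    then obtain m0 where m0: "\<And>k m. m0 k \<le> m \<Longrightarrow> \<exists>A\<subseteq>unit_lift (S k). finite A \<and> A \<noteq> {} \<and>
        (\<forall>j<m. real m * spread_rate p (h k) \<le> (\<Sum>t<m. avg A (tree_spread p A (j + c + t))))" by metis
    define M where "M = Suc (\<Sum>k<n. m0 k)"
    have count: "real p powr ((1 - \<epsilon>) * real m) \<le> real (card (cells p (sumset S n) m))" if "M \<le> m"
        for m
    proof -
      have "\<forall>k. \<exists>A\<subseteq>unit_lift (S k). finite A \<and> A \<noteq> {} \<and>
        (\<forall>j<m. real m * \<kappa> k \<le> (\<Sum>t<m. avg A (tree_spread p A (j + c + t))))"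
      proof
        fix k
        show "\<exists>A\<subseteq>unit_lift (S k). finite A \<and> A \<noteq> {} \<and>
          (\<forall>j<m. real m * \<kappa> k \<le> (\<Sum>t<m. avg A (tree_spread p A (j + c + t))))"
        proof (cases "k < n")
          case True
          then have "m0 k \<le> (\<Sum>k<n. m0 k)" by (intro member_le_sum) auto
          then have "m0 k \<le> m" using that by (simp add: M_def)
          from m0[OF this] show ?thesis using True by (simp add: \<kappa>_def)
        next
          case False
          then have "\<kappa> k = 0" by (simp add: \<kappa>_def)
          then show ?thesis using triv[of k m] by metis
        qed
      qed
      then obtain A where A: "\<And>k. A k \<subseteq> unit_lift (S k)" "\<And>k. finite (A k)" "\<And>k. A k \<noteq> {}"
        "\<And>k j. j < m \<Longrightarrow> real m * \<kappa> k \<le> (\<Sum>t<m. avg (A k) (tree_spread p (A k) (j + c + t)))" by metis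
      have "0 < m" using that by (simp add: M_def)
      let ?N = "real (card (cells p (sumset S n) m))"
      have "real m * (ln (real p) - (real p)\<^sup>2 * (3 * shift_error p I c \<Lambda> (\<Sum>k<n. \<kappa> k) + 2 / real I))
          \<le> ln ?N"
        by (rule card_cells_sumset_ge[OF p inv A \<open>0 < m\<close> par(1,2)])
      moreover have "K \<le> (\<Sum>k<n. \<kappa> k)" using K by (simp add: \<kappa>_def)
      then have "real m * (ln (real p) - \<epsilon> * ln (real p))
          \<le> real m * (ln (real p) - (real p)\<^sup>2 * (3 * shift_error p I c \<Lambda> (\<Sum>k<n. \<kappa> k)
              + 2 / real I))"
        by (intro mult_left_mono diff_left_mono par(3)) auto
      ultimately have "real m * (ln (real p) - \<epsilon> * ln (real p)) \<le> ln ?N" by linarith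
      moreover have "ln (real p powr ((1 - \<epsilon>) * real m)) = real m * (ln (real p) - \<epsilon> * ln (real p))"
        using \<open>0 < p\<close> by (simp add: ln_powr algebra_simps)
      moreover have "0 < ?N"
      proof -
        have "sumset S n \<noteq> {}"
          using inv(2) unfolding sumset_def
              by (auto intro!: exI[of _ "\<lambda>i. SOME x. x \<in> S i"] simp: some_in_eq)
        then show ?thesis using card_cells_pos[OF \<open>0 < p\<close>] by simp
      qed
      ultimately show ?thesis using \<open>0 < p\<close>
          by (metis ln_le_cancel_iff of_nat_0_less_iff powr_gt_zero less_numeral_extra(3)
          order_less_irrefl)
    qed
    show "ennreal (1 - \<epsilon>) \<le> hausdorff_dim (sumset S n)"
      by (rule hausdorff_dim_ge[OF p mult_invariant_sumset[OF inv(1)] compact_sumset[OF cl] count])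
  qed
qed

section \<open>Full dimension and divergence of the spread rates\<close>

lemma hausdorff_dim_le_1:
  assumes p: "2 \<le> p" and inv: "mult_invariant p S" "S \<noteq> {}"
  shows "hausdorff_dim S \<le> 1"
proof (rule ennreal_le_epsilon)
  fix e :: real assume "0 < e"
  have "real (card (cells p S 1)) \<le> real p" using card_cells_le[of p S 1] p by simp
  also have "real p < (real p ^ 1) powr (1 + e)"
      using p \<open>0 < e\<close> powr_less_mono[of 1 "1 + e" "real p"] by simp
  finally have "hausdorff_dim S \<le> ennreal (1 + e)"
    using \<open>0 < e\<close> by (intro hausdorff_dim_le[OF p inv, of _ 1]) auto
  then show "hausdorff_dim S \<le> 1 + ennreal e" using \<open>0 < e\<close> by simp
qed

text \<open>Otherwise level \<open>k\<close> has \<open>p powr (s0 * k)\<close> cells with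
  \<open>s0 < h\<close>, and \<open>hausdorff_dim_le\<close> at the midpoint of \<open>s0\<close>
  and \<open>h\<close>, which is positive even if \<open>s0 = 0\<close>, puts the dimension below
  \<open>h\<close>.\<close>

lemma card_cells_ge_powr:
  assumes p: "2 \<le> p" and inv: "mult_invariant p S" "S \<noteq> {}"
    and h: "0 < h" "ennreal h \<le> hausdorff_dim S"
  shows "real p powr (h * real k) \<le> real (card (cells p S k))"
proof (rule ccontr)
  have "0 < p" using p by simp
  let ?N = "real (card (cells p S k))"
  have N1: "1 \<le> ?N" using card_cells_pos[OF \<open>0 < p\<close> inv(2), of k] by simp
  assume "\<not> real p powr (h * real k) \<le> ?N"
  then have less: "?N < real p powr (h * real k)" by simp
  have "0 < k" using less N1 p by (intro gr0I) simp
  define s0 where "s0 = ln ?N / (real k * ln (real p))"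
  have kp: "0 < real k * ln (real p)" using \<open>0 < k\<close> p by simp
  have N: "?N = real p powr (s0 * real k)" using N1 p \<open>0 < k\<close> by (simp add: s0_def powr_def)
  have "0 \<le> s0" unfolding s0_def using N1 kp by (intro divide_nonneg_nonneg) auto
  have "s0 * real k < h * real k" using less unfolding N using p
      by (simp only: powr_less_cancel_iff of_nat_less_iff)
  then have "s0 < h" using \<open>0 < k\<close> by simp
  define s where "s = (s0 + h) / 2"
  have s: "s0 < s" "s < h" "0 < s" using \<open>s0 < h\<close> \<open>0 \<le> s0\<close> by (auto simp: s_def)
  have "?N < real p powr (s * real k)" unfolding N using s(1) \<open>0 < k\<close> p
      by (intro powr_less_mono) auto
  also have "\<dots> = (real p ^ k) powr s" using \<open>0 < p\<close>
      by (simp add: powr_realpow[symmetric] powr_powr mult.commute)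
  finally have "hausdorff_dim S \<le> ennreal s" by (intro hausdorff_dim_le[OF p inv s(3) \<open>0 < k\<close>])
  then have "ennreal h \<le> ennreal s" using h(2) by simp
  then show False using s by (simp add: ennreal_le_iff)
qed

text \<open>Counts at exponent 1 leave no cell empty, so \<open>S\<close> is dense. Dimension 1 is
  treated apart because \<open>dim_log_ratio\<close> is infinite there while
  \<open>spread_rate\<close> is not.\<close>

lemma eq_UNIV_of_hausdorff_dim_1:
  assumes p: "2 \<le> p" and inv: "mult_invariant p S" "S \<noteq> {}" and cl: "closed S" and "1
      \<le> hausdorff_dim S"
  shows "S = UNIV"
proof -
  have "0 < p" using p by simp
  have full: "cells p S k = {0..<int p ^ k}" for k
  proof (rule card_subset_eq[OF _ cells_subset[OF \<open>0 < p\<close>]])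
    have "real p powr (1 * real k) \<le> real (card (cells p S k))"
      using assms(5) by (intro card_cells_ge_powr[OF p inv]) auto
    then have "real (p ^ k) \<le> real (card (cells p S k))" using \<open>0 < p\<close> by (simp add: powr_realpow)
    then have "p ^ k \<le> card (cells p S k)" by (simp only: of_nat_le_iff)
    then show "card (cells p S k) = card {0..<int p ^ k}"
      using card_cells_le[OF \<open>0 < p\<close>, of S k] by (simp add: nat_power_eq)
  qed simp
  have "x \<in> closure S" for x
    unfolding closure_approachable
  proof (intro allI impI)
    fix e :: real assume "0 < e"
    obtain t where t: "t \<in> {0..<1}" "x = to_circle t" using to_circle_unit by blast
    obtain k where k: "(1 / real p) ^ k < e" using real_arch_pow_inv[OF \<open>0 < e\<close>, of "1 / real p"] p
        by auto
    have "\<lfloor>real p ^ k * t\<rfloor> \<in> cells p UNIV k" using t by (simp add: cells_def unit_lift_def)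
    then have "\<lfloor>real p ^ k * t\<rfloor> \<in> cells p S k" using full cells_subset[OF \<open>0 < p\<close>, of UNIV k]
        by blast
    then obtain y where y: "to_circle y \<in> S" "\<lfloor>real p ^ k * y\<rfloor> = \<lfloor>real p ^ k * t\<rfloor>"
      by (auto simp: cells_def unit_lift_def)
    then have "\<bar>real p ^ k * y - real p ^ k * t\<bar> < 1" by linarith
    then have "real p ^ k * \<bar>y - t\<bar> < 1" by (simp add: right_diff_distrib[symmetric] abs_mult)
    then have "\<bar>y - t\<bar> < (1 / real p) ^ k" using \<open>0 < p\<close> by (simp add: field_simps)
    then have "dist (to_circle y) x < e" using dist_to_circle_le[of y t] k t(2) by simp
    then show "\<exists>y\<in>S. dist y x < e" using y(1) by blast
  qed
  then show ?thesis using cl by (metis UNIV_eq_I closure_closed)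
qed

text \<open>Coordinate \<open>i\<close> is free and absorbs whatever the other summands
  contribute.\<close>

lemma sumset_eq_UNIV:
  assumes "S i = UNIV" "i < n" "\<And>k. S k \<noteq> {}"
  shows "sumset S n = UNIV"
proof -
  have "x \<in> sumset S n" for x
  proof -
    define s where "s k = (SOME y. y \<in> S k)" for k
    have s: "s k \<in> S k" for k unfolding s_def using assms(3) by (simp add: some_in_eq)
    define s' where "s' = s(i := x - (\<Sum>k\<in>{..<n} - {i}. s k))"
    have "(\<Sum>k<n. s' k) = s' i + (\<Sum>k\<in>{..<n} - {i}. s' k)" using assms(2) by (intro sum.remove) auto
    also have "(\<Sum>k\<in>{..<n} - {i}. s' k) = (\<Sum>k\<in>{..<n} - {i}. s k)"
        by (intro sum.cong) (auto simp: s'_def)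
    finally have "x = (\<Sum>k<n. s' k)" by (simp add: s'_def)
    moreover have "\<forall>k<n. s' k \<in> S k" using s assms(1) by (simp add: s'_def)
    ultimately show ?thesis unfolding sumset_def by blast
  qed
  then show ?thesis by blast
qed

lemma hausdorff_dim_UNIV:
  assumes p: "2 \<le> (p :: nat)"
  shows "1 \<le> hausdorff_dim (UNIV :: circle set)"
proof -
  have "0 < p" using p by simp
  have "real p powr (1 * real m) \<le> real (card (cells p UNIV m))" for m
  proof -
    have "q \<in> cells p UNIV m" if "q \<in> {0..<int p ^ m}" for q
    proof -
      have pm: "0 < real p ^ m" using \<open>0 < p\<close> by simp
      have "real_of_int q < real_of_int (int p ^ m)" using that
          by (simp only: of_int_less_iff atLeastLessThan_iff)
      then have "real_of_int q / real p ^ m \<in> {0..<1}" using that pm by simp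
      moreover have "q = \<lfloor>real p ^ m * (real_of_int q / real p ^ m)\<rfloor>" using pm by simp
      ultimately show ?thesis unfolding cells_def unit_lift_def by blast
    qed
    then have "card {0..<int p ^ m} \<le> card (cells p UNIV m)"
      using finite_cells[OF \<open>0 < p\<close>] by (intro card_mono) auto
    then have "real (p ^ m) \<le> real (card (cells p UNIV m))" by (simp add: nat_power_eq)
    then show ?thesis using \<open>0 < p\<close> by (simp add: powr_realpow)
  qed
  note count = this
  have "ennreal 1 \<le> hausdorff_dim (UNIV :: circle set)"
  proof (rule hausdorff_dim_ge[OF p _ compact_circle])
    show "real p powr (1 * real m) \<le> real (card (cells p UNIV m))" if "0 \<le> m" for m by (rule count)
  qed (simp add: mult_invariant_def)
  then show ?thesis by simp
qed

text \<open>For \<open>h \<le> 1 / 2\<close> one has \<open>- ln h \<ge> ln 2\<close>, so the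
  constant \<open>ln (8 * p)\<close> is absorbed by a multiple of \<open>- ln h\<close>.\<close>

lemma spread_rate_ge:
  assumes p: "2 \<le> p" and h: "0 \<le> h" "h \<le> 1 / 2"
  shows "(1 / (8 * (ln (8 * real p) / ln 2 + 1))) * (h / \<bar>ln h\<bar>) \<le> spread_rate p h"
proof (cases "h = 0")
  case False
  then have "0 < h" using h by simp
  have l: "ln 2 \<le> - ln h"
  proof -
    have "ln h \<le> ln (1 / 2)" using \<open>0 < h\<close> h by (intro ln_mono) auto
    then show ?thesis by (simp add: ln_div)
  qed
  have l2: "0 < ln (2 :: real)" by simp
  have l8: "0 < ln (8 * real p)" using p by (intro ln_gt_zero) simp
  have "ln (8 * real p / h) = ln (8 * real p) - ln h" using p \<open>0 < h\<close> by (simp add: ln_div)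
  also have "\<dots> \<le> (ln (8 * real p) / ln 2 + 1) * (- ln h)"
  proof -
    have "ln (8 * real p) = ln (8 * real p) / ln 2 * ln 2" using l2 by simp
    also have "\<dots> \<le> ln (8 * real p) / ln 2 * (- ln h)" using l l8 l2 by (intro mult_left_mono) auto
    finally show ?thesis by (simp add: algebra_simps)
  qed
  finally have up: "ln (8 * real p / h) \<le> (ln (8 * real p) / ln 2 + 1) * (- ln h)" .
  have pos: "0 < ln (8 * real p / h)" using p \<open>0 < h\<close> h
      by (intro ln_gt_zero) (simp add: field_simps)
  have "h / 8 / ((ln (8 * real p) / ln 2 + 1) * (- ln h)) \<le> h / 8 / ln (8 * real p / h)"
  proof (intro divide_left_mono up)
    have "0 < ln (8 * real p) / ln 2 + 1" using l8 l2 by (simp add: add_pos_pos)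
    then show "0 < (ln (8 * real p) / ln 2 + 1) * (- ln h) * ln (8 * real p / h)"
      using l l2 pos by (intro mult_pos_pos) linarith+
  qed (use \<open>0 < h\<close> in simp)
  moreover have "\<bar>ln h\<bar> = - ln h" using l l2 by linarith
  then have "1 / (8 * X) * (h / \<bar>ln h\<bar>) = h / 8 / (X * (- ln h))" for X by simp
  ultimately show ?thesis using False by (simp only: spread_rate_def if_False)
qed (simp add: spread_rate_def)

text \<open>If the claim failed, the truncated rates would be summable and tend to 0. Then
  \<open>d k\<close> reaches \<open>1 / 2\<close>, where the truncation acts, only finitely often,
  and there \<open>d k < 1\<close> keeps the ratio finite. Elsewhere \<open>spread_rate_ge\<close>
  compares the ratios with the rates, so their sum would be finite.\<close>

lemma sum_spread_rate_unbounded: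
  assumes p: "2 \<le> p" and d: "\<And>k. d k < 1" and inf: "(\<Sum>k. dim_log_ratio (d k)) = \<infinity>"
  shows "\<exists>N. \<forall>n\<ge>N. K \<le> (\<Sum>k<n. spread_rate p (min (enn2real (d k)) (1 / 2)))"
proof (rule ccontr)
  define f where "f k = spread_rate p (min (enn2real (d k)) (1 / 2))" for k
  have f0: "0 \<le> f k" for k unfolding f_def by (rule spread_rate_nonneg[OF p]) auto
  assume "\<not> (\<exists>N. \<forall>n\<ge>N. K \<le> (\<Sum>k<n. spread_rate p (min (enn2real (d k)) (1 / 2))))"
  then have "\<forall>N. \<exists>n\<ge>N. (\<Sum>k<n. f k) < K" unfolding f_def[symmetric] by (simp add: not_le)
  then have "(\<Sum>k<N. f k) \<le> K" for N
  proof -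
    obtain n where "n \<ge> N" "(\<Sum>k<n. f k) < K" using \<open>\<forall>N. \<exists>n\<ge>N. (\<Sum>k<n. f k) < K\<close> by blast
    moreover have "(\<Sum>k<N. f k) \<le> (\<Sum>k<n. f k)" using \<open>n \<ge> N\<close> f0 by (intro sum_mono2) auto
    ultimately show ?thesis by linarith
  qed
  then have sf: "summable f" using f0 by (intro summableI_nonneg_bounded) auto
  define c0 where "c0 = 1 / (8 * (ln (8 * real p) / ln 2 + 1))"
  have "0 < ln (8 * real p) / ln 2" using p by (intro divide_pos_pos ln_gt_zero) auto
  then have c0: "0 < c0" by (simp add: c0_def)
  \<comment> \<open>The threshold is the lower bound of \<open>spread_rate_ge\<close> at
    \<open>h = 1 / 2\<close>, so \<open>f k\<close> below it excludes truncation.\<close>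
  have "\<forall>\<^sub>F k in sequentially. f k < c0 * ((1 / 2) / ln 2)"
    using summable_LIMSEQ_zero[OF sf] by (rule order_tendstoD(2)) (use c0 in simp)
  then obtain N0 where N0: "\<And>k. N0 \<le> k \<Longrightarrow> f k < c0 * ((1 / 2) / ln 2)"
    unfolding eventually_sequentially by blast
  define g where "g k = (if k < N0 then enn2real (dim_log_ratio (d k)) else f k / c0)" for k
  have g0: "0 \<le> g k" for k using f0 c0 by (simp add: g_def)
  have "summable (\<lambda>k. f k / c0)" using sf by (rule summable_divide)
  moreover have "\<forall>\<^sub>F k in sequentially. g k = f k / c0"
    unfolding eventually_sequentially by (intro exI[of _ N0]) (simp add: g_def)
  ultimately have sg: "summable g" using summable_cong[of g "\<lambda>k. f k / c0"] by blast
  have le: "dim_log_ratio (d k) \<le> ennreal (g k)" for k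
  proof -
    define h where "h = enn2real (d k)"
    have dk: "d k = ennreal h" unfolding h_def
        by (rule ennreal_enn2real[symmetric], rule less_trans[OF d]) simp
    have h: "0 \<le> h" "h < 1" using d[of k] unfolding dk by (auto simp: h_def)
    have ratio: "dim_log_ratio (d k) = ennreal (h / \<bar>ln h\<bar>)"
    proof (cases "h = 0")
      case True
      then show ?thesis unfolding dk by (simp add: dim_log_ratio_0)
    next
      case False
      then show ?thesis unfolding dk using h by (intro dim_log_ratio_between) auto
    qed
    show ?thesis
    proof (cases "k < N0")
      case True
      then show ?thesis unfolding g_def ratio by simp
    next
      case False
      have fk: "f k = spread_rate p (min h (1 / 2))" by (simp add: f_def h_def)
      have "h < 1 / 2"
      proof (rule ccontr)
        assume "\<not> h < 1 / 2"
        then have "min h (1 / 2) = 1 / 2" by (intro min_absorb2) simp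
        then have "f k = spread_rate p (1 / 2)" unfolding fk by simp
        moreover have "c0 * ((1 / 2) / ln 2) \<le> spread_rate p (1 / 2)"
          using spread_rate_ge[OF p, of "1 / 2"] by (simp add: c0_def ln_div)
        ultimately show False using N0[of k] False by simp
      qed
      then have "c0 * (h / \<bar>ln h\<bar>) \<le> f k" using spread_rate_ge[OF p h(1)]
          by (simp add: c0_def fk min_def)
      then have "h / \<bar>ln h\<bar> \<le> f k / c0" using c0 by (simp add: field_simps)
      then show ?thesis unfolding ratio using False by (simp add: g_def ennreal_leI)
    qed
  qed
  have "(\<Sum>k. dim_log_ratio (d k)) \<le> (\<Sum>k. ennreal (g k))" by (intro suminf_le le) auto
  also have "\<dots> = ennreal (suminf g)" by (rule suminf_ennreal2[OF g0 sg])
  also have "\<dots> < \<infinity>" by simp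
  finally show False using inf by simp
qed

theorem corollary1p2:
  fixes p :: nat and S :: "nat \<Rightarrow> circle set"
  assumes "p \<ge> 2"
    and "\<And>i. closed (S i)"
    and "\<And>i. S i \<noteq> {}"
    and "\<And>i. mult_invariant p (S i)"
    and "(\<Sum>i. dim_log_ratio (hausdorff_dim (S i))) = \<infinity>"
  shows "(\<lambda>n. hausdorff_dim (sumset S n)) \<longlonglongrightarrow> 1"
proof (rule order_tendstoI)
  have ne: "sumset S n \<noteq> {}" for n
    using assms(3) unfolding sumset_def
        by (auto intro!: exI[of _ "\<lambda>i. SOME x. x \<in> S i"] simp: some_in_eq)
  have le1: "hausdorff_dim (sumset S n) \<le> 1" for n
    by (rule hausdorff_dim_le_1[OF assms(1) mult_invariant_sumset[OF assms(4)] ne])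
  show "\<forall>\<^sub>F n in sequentially. hausdorff_dim (sumset S n) < a" if "1 < a" for a
    by (intro always_eventually allI) (rule le_less_trans[OF le1 that])
  show "\<forall>\<^sub>F n in sequentially. a < hausdorff_dim (sumset S n)" if "a < 1" for a
  proof (cases "\<exists>i. 1 \<le> hausdorff_dim (S i)")
    case True
    then obtain i where "1 \<le> hausdorff_dim (S i)" by blast
    then have "S i = UNIV" by (rule eq_UNIV_of_hausdorff_dim_1[OF assms(1,4,3,2)])
    then have "a < hausdorff_dim (sumset S n)" if "i < n" for n
      using sumset_eq_UNIV[OF _ that assms(3)] hausdorff_dim_UNIV[OF assms(1)] \<open>a < 1\<close> by simp
    then show ?thesis unfolding eventually_sequentially by (intro exI[of _ "Suc i"]) simp
  next
    case False
    then have d: "hausdorff_dim (S i) < 1" for i by (simp add: not_le)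
    obtain r where r: "a = ennreal r" "0 \<le> r" using \<open>a < 1\<close> by (cases a) auto
    have "r < 1" using \<open>a < 1\<close> r by (simp add: ennreal_less_one_iff)
    \<comment> \<open>Truncation at \<open>1 / 2\<close> stays in the range of
      \<open>spread_rate_ge\<close>; a smaller exponent is still a lower bound for the cell
      counts.\<close>
    define h where "h k = min (enn2real (hausdorff_dim (S k))) (1 / 2)" for k
    have hdim: "ennreal (h k) \<le> hausdorff_dim (S k)" for k
    proof -
      have "ennreal (h k) \<le> ennreal (enn2real (hausdorff_dim (S k)))" unfolding h_def
          by (intro ennreal_leI) simp
      also have "\<dots> = hausdorff_dim (S k)" by (rule ennreal_enn2real, rule less_trans[OF d]) simp
      finally show ?thesis .
    qed
    \<comment> \<open>\<open>1 - (1 - r) / 2\<close> is the midpoint of \<open>r\<close> and 1,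
      which gives the strict inequality.\<close>
    have "\<exists>K. \<forall>n. K \<le> (\<Sum>k<n. spread_rate p (h k)) \<longrightarrow>
        ennreal (1 - (1 - r) / 2) \<le> hausdorff_dim (sumset S n)"
    proof (rule hausdorff_dim_sumset_ge[OF assms(1,4,3,2)])
      show "real p powr (h k * real j) \<le> real (card (cells p (S k) j))" if "0 < h k" for k j
        by (rule card_cells_ge_powr[OF assms(1,4,3) that hdim])
    qed (use \<open>r < 1\<close> in \<open>auto simp: h_def\<close>)
    then obtain K where K: "\<And>n. K \<le> (\<Sum>k<n. spread_rate p (h k)) \<Longrightarrow>
        ennreal (1 - (1 - r) / 2) \<le> hausdorff_dim (sumset S n)" by blast
    obtain N where N: "\<And>n. N \<le> n \<Longrightarrow> K \<le> (\<Sum>k<n. spread_rate p (h k))"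
      using sum_spread_rate_unbounded[OF assms(1) d assms(5), of K] unfolding h_def by blast
    have "a < hausdorff_dim (sumset S n)" if "N \<le> n" for n
    proof -
      have "a < ennreal (1 - (1 - r) / 2)" unfolding r(1) using r(2) \<open>r < 1\<close>
          by (simp add: ennreal_less_iff field_simps)
      then show ?thesis using K[OF N[OF that]] by (rule less_le_trans)
    qed
    then show ?thesis unfolding eventually_sequentially by blast
  qed
qed

end
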